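(* Let $\tilde W^!$ be $\tilde W^!_A$ or $\tilde W^!_C$, let $\mathbf a\in f(\tilde W^!_{int})$ and let $\tilde w\in f^{-1}(\mathbf a)$. Then the following conditions are equivalent: (1) $\tilde w$ is a good element; (2) $\tilde w$ is a minimal length element in the unique distinguished conjugacy class $\mathcal O$ contained in $f^{-1}(\mathbf a)$; (3) $\tilde w$ is a minimal element for the Bruhat order on $f^{-1}(\mathbf a)$.
   Context: Groups. $S'_n$ is the group of permutations $\sigma$ of $\{\pm1,\dots,\pm n\}$ with $\sigma(-i)=-\sigma(i)$; $S_n\subset S'_n$ is the subgroup with $\sigma(i)>0$ for all $i>0$. $S'_n$ acts on $\mathbb R^n$ by $\sigma\cdot[a_1,\dots,a_n]=[a_{\sigma^{-1}(1)},\dots,a_{\sigma^{-1}(n)}]$ with $a_{-i}:=-a_i$. $e_i$ standard basis, $\langle e_i,e_j\rangle=\delta_{ij}$. $(t^\chi w)(t^{\chi'}w')=t^{\chi+w\chi'}ww'$. Put $\omega=[\frac12,\dots,\frac12]$. Type A: $\tilde W^!_A=\mathbb Z^n\rtimes S_n$, $W=S_n$, $\Phi^+=\{e_i-e_j:i<j\}$. Type C: $\tilde W^!_C=(\mathbb Z^n\sqcup(\mathbb Z^n+\omega))\rtimes S'_n$, $W=S'_n$, $\Phi^+=\{2e_i\}\cup\{e_i\pm e_j:i<j\}$. Length: $l(t^\chi w)=\sum_{\alpha\in\Phi^+,\,w^{-1}\alpha\in\Phi^+}|\langle\chi,\alpha\rangle|+\sum_{\alpha\in\Phi^+,\,w^{-1}\alpha\in\Phi^-}|\langle\chi,\alpha\rangle-1|$.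 $W_a=Q^\vee\rtimes W$, $Q^\vee$ the coroot lattice (type A: integer vectors of sum zero; type C: $\mathbb Z^n$), a Coxeter group with generators the simple reflections of $W$ and $s_0=t^{\theta^\vee}s_\theta$, $\theta$ the highest root. $\Omega$ is the group of length-$0$ elements, $\tilde W^!=W_a\rtimes\Omega$; Bruhat order: $w\tau\le w'\tau'$ ($w,w'\in W_a$, $\tau,\tau'\in\Omega$) iff $\tau=\tau'$ and $w\le w'$ in $W_a$. $\tilde W^!_{int}=\tilde W^!\cap(\mathbb Z^n\rtimes S'_n)$ (all of $\tilde W^!_A$ in type A, $W_a$ in type C). The map $f$. For $\tilde w\in\tilde W^!$ choose $m\ge1$ with $\tilde w^m=t^\chi$ and put $v_{\tilde w}=\chi/m\in\mathbb Q^n$ (independent of $m$), $[v_{\tilde w}]$ its $W$-orbit, $\eta(\tilde w)$ the image of $\tilde w$ in $\tilde W^!/W_a$; $f(\tilde w)=([v_{\tilde w}],\eta(\tilde w))$. $f$ is constant on conjugacy classes. $\tilde w$ is good if $l(\tilde w^m)=m\,l(\tilde w)$ for all $m\ge1$. Distinguished classes. A double partition is a finite lexicographically weakly decreasing sequence $\tilde\lambda=[(b_1,c_1),\dots,(b_k,c_k)]$ in $\mathbb Z_{\ge1}\times\mathbb Z$; consider those with $\sum b_i=n$ and $\gcd(b_i,c_i)=1$ for all $i$ (where $\gcd(b,0)=b$), and in type C also all $c_i\ge0$. With $B_j=b_1+\dots+b_j$, let $\tilde w_{(\tilde\lambda,\tilde\emptyset)}=t^{[a_1,\dots,a_n]}\prod_j(B_{j-1}+1,\dots,B_j)$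 where $a_{B_j}=c_j$ and $a_i=0$ otherwise, and $(i_1\cdots i_r)$ is the permutation $i_1\to i_2\to\dots\to i_r\to i_1$. The distinguished (integral) conjugacy classes of $\tilde W^!$ are the conjugacy classes in $\tilde W^!$ of these elements $\tilde w_{(\tilde\lambda,\tilde\emptyset)}$. Each $f^{-1}(\mathbf a)$ with $\mathbf a\in f(\tilde W^!_{int})$ contains exactly one distinguished conjugacy class. *)

theory Defs
  imports
    Complex_Main
    "HOL-Combinatorics.Cycles"
    "HOL-Library.Function_Algebras"
    "HOL-Algebra.Coset"
begin

datatype cartan_type = TypeA | TypeC

section \<open>Vectors and signed permutations\<close>

text \<open>
  A vector \<open>[a\<^sub>1, \<dots>, a\<^sub>n]\<close> is encoded as a function on all integers, using the convention
  \<open>a\<^sub>-\<^sub>i = - a\<^sub>i\<close>: it is odd (so it vanishes at 0) and vanishes outside \<open>{-n..n}\<close>. Addition, negation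
  and zero are pointwise. Rational coordinates suffice for all vectors that occur.
\<close>

type_synonym vec = "int \<Rightarrow> rat"
type_synonym sperm = "int \<Rightarrow> int"

definition vecs :: "nat \<Rightarrow> vec set" where
  "vecs n = {a. (\<forall>i. a (- i) = - a i) \<and> (\<forall>i. \<bar>i\<bar> > int n \<longrightarrow> a i = 0)}"

definition int_vecs :: "nat \<Rightarrow> vec set" where
  "int_vecs n = {a \<in> vecs n. \<forall>i. a i \<in> \<int>}"

definition scale :: "rat \<Rightarrow> vec \<Rightarrow> vec" where
  "scale c a = (\<lambda>i. c * a i)"

definition ip :: "nat \<Rightarrow> vec \<Rightarrow> vec \<Rightarrow> rat" where
  "ip n a b = (\<Sum>i = 1..int n. a i * b i)"

definition unit_vec :: "int \<Rightarrow> vec" where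
  "unit_vec i = (\<lambda>j. if j = i then 1 else if j = - i then - 1 else 0)"

definition omega_vec :: "nat \<Rightarrow> vec" where
  "omega_vec n = (\<Sum>i = 1..int n. scale (1/2) (unit_vec i))"

definition signed_perms :: "nat \<Rightarrow> sperm set" where
  "signed_perms n =
     {\<sigma>. \<sigma> permutes {i. 1 \<le> \<bar>i\<bar> \<and> \<bar>i\<bar> \<le> int n} \<and> (\<forall>i. \<sigma> (- i) = - \<sigma> i)}"

definition unsigned_perms :: "nat \<Rightarrow> sperm set" where
  "unsigned_perms n = {\<sigma> \<in> signed_perms n. \<forall>i > 0. \<sigma> i > 0}"

text \<open>As vectors are odd functions, \<open>(\<sigma> \<cdot> a)\<^sub>i\<close> is the value of \<open>a\<close> at \<open>\<sigma>\<^sup>-\<^sup>1 i\<close> for either sign of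
  \<open>\<sigma>\<^sup>-\<^sup>1 i\<close>.\<close>

definition act :: "sperm \<Rightarrow> vec \<Rightarrow> vec" where
  "act \<sigma> a = (\<lambda>i. a (inv_into UNIV \<sigma> i))"


section \<open>Root data and extended affine Weyl groups\<close>

fun weyl :: "cartan_type \<Rightarrow> nat \<Rightarrow> sperm set" where
  "weyl TypeA n = unsigned_perms n"
| "weyl TypeC n = signed_perms n"

fun trans_lattice :: "cartan_type \<Rightarrow> nat \<Rightarrow> vec set" where
  "trans_lattice TypeA n = int_vecs n"
| "trans_lattice TypeC n = int_vecs n \<union> {a + omega_vec n | a. a \<in> int_vecs n}"

fun coroot_lattice :: "cartan_type \<Rightarrow> nat \<Rightarrow> vec set" where
  "coroot_lattice TypeA n = {a \<in> int_vecs n. (\<Sum>i = 1..int n. a i) = 0}"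
| "coroot_lattice TypeC n = int_vecs n"

fun pos_roots :: "cartan_type \<Rightarrow> nat \<Rightarrow> vec set" where
  "pos_roots TypeA n =
     {unit_vec i - unit_vec j | i j. 1 \<le> i \<and> i < j \<and> j \<le> int n}"
| "pos_roots TypeC n =
     {scale 2 (unit_vec i) | i. 1 \<le> i \<and> i \<le> int n}
     \<union> {unit_vec i + unit_vec j | i j. 1 \<le> i \<and> i < j \<and> j \<le> int n}
     \<union> {unit_vec i - unit_vec j | i j. 1 \<le> i \<and> i < j \<and> j \<le> int n}"

definition neg_roots :: "cartan_type \<Rightarrow> nat \<Rightarrow> vec set" where
  "neg_roots T n = uminus ` pos_roots T n"

definition simple_roots :: "cartan_type \<Rightarrow> nat \<Rightarrow> vec set" where
  "simple_roots T n =
     {\<alpha> \<in> pos_roots T n. \<not> (\<exists>\<beta> \<in> pos_roots T n. \<exists>\<gamma> \<in> pos_roots T n. \<alpha> = \<beta> + \<gamma>)}"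

text \<open>The highest root exceeds every positive root by a nonnegative integral combination of simple
  roots. There is none in type A with \<open>n = 1\<close>, where the root system is empty.\<close>

definition highest_root :: "cartan_type \<Rightarrow> nat \<Rightarrow> vec \<Rightarrow> bool" where
  "highest_root T n \<theta> \<longleftrightarrow> \<theta> \<in> pos_roots T n \<and>
     (\<forall>\<alpha> \<in> pos_roots T n. \<exists>c :: vec \<Rightarrow> nat.
        \<theta> = \<alpha> + (\<Sum>\<beta> \<in> simple_roots T n. scale (of_nat (c \<beta>)) \<beta>))"

definition coroot :: "nat \<Rightarrow> vec \<Rightarrow> vec" where
  "coroot n \<alpha> = scale (2 / ip n \<alpha> \<alpha>) \<alpha>"

definition is_reflection :: "nat \<Rightarrow> vec \<Rightarrow> sperm \<Rightarrow> bool" where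
  "is_reflection n \<alpha> s \<longleftrightarrow> (\<forall>x \<in> vecs n. act s x = x - scale (ip n x (coroot n \<alpha>)) \<alpha>)"

text \<open>The pair \<open>(\<chi>, w)\<close> stands for \<open>t\<^sup>\<chi> w\<close>.\<close>

type_synonym aff = "vec \<times> sperm"

definition ext_aff :: "cartan_type \<Rightarrow> nat \<Rightarrow> aff monoid" where
  "ext_aff T n =
     \<lparr>carrier = trans_lattice T n \<times> weyl T n,
      monoid.mult = (\<lambda>(\<chi>, w) (\<chi>', w'). (\<chi> + act w \<chi>', w \<circ> w')),
      one = (0, id)\<rparr>"

definition ext_aff_int :: "cartan_type \<Rightarrow> nat \<Rightarrow> aff set" where
  "ext_aff_int T n = carrier (ext_aff T n) \<inter> (int_vecs n \<times> signed_perms n)"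

definition aff_weyl :: "cartan_type \<Rightarrow> nat \<Rightarrow> aff set" where
  "aff_weyl T n = coroot_lattice T n \<times> weyl T n"

definition aff_simple_refls :: "cartan_type \<Rightarrow> nat \<Rightarrow> aff set" where
  "aff_simple_refls T n =
     {(0, s) | s \<alpha>. s \<in> weyl T n \<and> \<alpha> \<in> simple_roots T n \<and> is_reflection n \<alpha> s}
     \<union> {(coroot n \<theta>, s) | s \<theta>. s \<in> weyl T n \<and> highest_root T n \<theta> \<and> is_reflection n \<theta> s}"

fun aff_length :: "cartan_type \<Rightarrow> nat \<Rightarrow> aff \<Rightarrow> rat" where
  "aff_length T n (\<chi>, w) =
     (\<Sum>\<alpha> | \<alpha> \<in> pos_roots T n \<and> act (inv_into UNIV w) \<alpha> \<in> pos_roots T n. \<bar>ip n \<chi> \<alpha>\<bar>)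
     + (\<Sum>\<alpha> | \<alpha> \<in> pos_roots T n \<and> act (inv_into UNIV w) \<alpha> \<in> neg_roots T n. \<bar>ip n \<chi> \<alpha> - 1\<bar>)"

definition length_zero :: "cartan_type \<Rightarrow> nat \<Rightarrow> aff set" where
  "length_zero T n = {x \<in> carrier (ext_aff T n). aff_length T n x = 0}"


section \<open>Bruhat order\<close>

text \<open>The Bruhat order of a Coxeter system \<open>(G, S)\<close>: the reflexive transitive closure of
  \<open>u \<rightarrow> u t\<close>, where \<open>t\<close> is a conjugate of an element of \<open>S\<close> and the word length increases.\<close>

definition word_length :: "('a, 'b) monoid_scheme \<Rightarrow> 'a set \<Rightarrow> 'a \<Rightarrow> nat" where
  "word_length G S w =
     (LEAST k. \<exists>ss. length ss = k \<and> set ss \<subseteq> S \<and> w = foldr (\<otimes>\<^bsub>G\<^esub>) ss \<one>\<^bsub>G\<^esub>)"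

definition cox_refls :: "('a, 'b) monoid_scheme \<Rightarrow> 'a set \<Rightarrow> 'a set" where
  "cox_refls G S = {g \<otimes>\<^bsub>G\<^esub> s \<otimes>\<^bsub>G\<^esub> inv\<^bsub>G\<^esub> g | g s. g \<in> carrier G \<and> s \<in> S}"

definition cox_bruhat_le :: "('a, 'b) monoid_scheme \<Rightarrow> 'a set \<Rightarrow> 'a \<Rightarrow> 'a \<Rightarrow> bool" where
  "cox_bruhat_le G S =
     (\<lambda>u v. u \<in> carrier G \<and> (\<exists>t \<in> cox_refls G S. v = u \<otimes>\<^bsub>G\<^esub> t)
        \<and> word_length G S u < word_length G S v)\<^sup>*\<^sup>*"

definition bruhat_le :: "cartan_type \<Rightarrow> nat \<Rightarrow> aff \<Rightarrow> aff \<Rightarrow> bool" where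
  "bruhat_le T n x y \<longleftrightarrow>
     (\<exists>u \<in> aff_weyl T n. \<exists>v \<in> aff_weyl T n. \<exists>\<tau> \<in> length_zero T n.
        x = u \<otimes>\<^bsub>ext_aff T n\<^esub> \<tau> \<and> y = v \<otimes>\<^bsub>ext_aff T n\<^esub> \<tau> \<and>
        cox_bruhat_le (ext_aff T n\<lparr>carrier := aff_weyl T n\<rparr>) (aff_simple_refls T n) u v)"


section \<open>The map f and good elements\<close>

text \<open>For \<open>x\<close> in the extended affine Weyl group such a \<open>v\<close> exists and does not depend on \<open>m\<close>.\<close>

definition newton_vec :: "cartan_type \<Rightarrow> nat \<Rightarrow> aff \<Rightarrow> vec" where
  "newton_vec T n x =
     (THE v. \<exists>m \<ge> 1. \<exists>\<chi>. x [^]\<^bsub>ext_aff T n\<^esub> (m :: nat) = (\<chi>, id) \<and> v = scale (1 / of_nat m) \<chi>)"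

definition weyl_orbit :: "cartan_type \<Rightarrow> nat \<Rightarrow> vec \<Rightarrow> vec set" where
  "weyl_orbit T n v = {act w v | w. w \<in> weyl T n}"

text \<open>The second component is the image in \<open>ext_aff T n Mod aff_weyl T n\<close>.\<close>

definition f_map :: "cartan_type \<Rightarrow> nat \<Rightarrow> aff \<Rightarrow> vec set \<times> aff set" where
  "f_map T n x = (weyl_orbit T n (newton_vec T n x), aff_weyl T n #>\<^bsub>ext_aff T n\<^esub> x)"

definition f_fiber :: "cartan_type \<Rightarrow> nat \<Rightarrow> vec set \<times> aff set \<Rightarrow> aff set" where
  "f_fiber T n a = {x \<in> carrier (ext_aff T n). f_map T n x = a}"

definition good :: "cartan_type \<Rightarrow> nat \<Rightarrow> aff \<Rightarrow> bool" where
  "good T n x \<longleftrightarrow>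
     (\<forall>m \<ge> 1. aff_length T n (x [^]\<^bsub>ext_aff T n\<^esub> (m :: nat)) = of_nat m * aff_length T n x)"


section \<open>Distinguished conjugacy classes\<close>

text \<open>Lexicographically weakly decreasing sequences of pairs \<open>(b, c)\<close> with \<open>b \<ge> 1\<close>.\<close>

definition double_partition :: "(nat \<times> int) list \<Rightarrow> bool" where
  "double_partition l \<longleftrightarrow>
     sorted_wrt (\<lambda>(b, c) (b', c'). b' < b \<or> b' = b \<and> c' \<le> c) l \<and> (\<forall>(b, c) \<in> set l. b \<ge> 1)"

definition admissible :: "cartan_type \<Rightarrow> nat \<Rightarrow> (nat \<times> int) list \<Rightarrow> bool" where
  "admissible T n l \<longleftrightarrow>
     double_partition l \<and> sum_list (map fst l) = n \<and>
     (\<forall>(b, c) \<in> set l. gcd (int b) c = 1) \<and>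
     (T = TypeC \<longrightarrow> (\<forall>(b, c) \<in> set l. c \<ge> 0))"

text \<open>\<open>block_end l j\<close> is \<open>B\<^sub>j = b\<^sub>1 + \<dots> + b\<^sub>j\<close>; lists are indexed from 0, so the block of \<open>l ! j\<close> is
  \<open>{B\<^sub>j + 1..B\<^sub>j\<^sub>+\<^sub>1}\<close>.\<close>

definition block_end :: "(nat \<times> int) list \<Rightarrow> nat \<Rightarrow> int" where
  "block_end l j = int (sum_list (map fst (take j l)))"

text \<open>The cycle \<open>i\<^sub>1 \<rightarrow> i\<^sub>2 \<rightarrow> \<dots> \<rightarrow> i\<^sub>r \<rightarrow> i\<^sub>1\<close> of positive integers, extended to the negative integers as
  an odd function.\<close>

definition signed_cycle :: "int list \<Rightarrow> sperm" where
  "signed_cycle xs = cycle_of_list xs \<circ> cycle_of_list (map uminus xs)"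

definition dist_elt :: "(nat \<times> int) list \<Rightarrow> aff" where
  "dist_elt l =
     (\<Sum>j < length l. scale (of_int (snd (l ! j))) (unit_vec (block_end l (Suc j))),
      foldr (\<circ>) (map (\<lambda>j. signed_cycle [block_end l j + 1..block_end l (Suc j)]) [0..<length l]) id)"

definition conj_class :: "('a, 'b) monoid_scheme \<Rightarrow> 'a \<Rightarrow> 'a set" where
  "conj_class G x = {g \<otimes>\<^bsub>G\<^esub> x \<otimes>\<^bsub>G\<^esub> inv\<^bsub>G\<^esub> g | g. g \<in> carrier G}"

definition distinguished :: "cartan_type \<Rightarrow> nat \<Rightarrow> aff set \<Rightarrow> bool" where
  "distinguished T n C \<longleftrightarrow> (\<exists>l. admissible T n l \<and> C = conj_class (ext_aff T n) (dist_elt l))"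

text \<open>For \<open>a\<close> in the image of the integral elements there is exactly one such class.\<close>

definition distinguished_class :: "cartan_type \<Rightarrow> nat \<Rightarrow> vec set \<times> aff set \<Rightarrow> aff set" where
  "distinguished_class T n a = (THE C. distinguished T n C \<and> C \<subseteq> f_fiber T n a)"

definition min_length_in :: "cartan_type \<Rightarrow> nat \<Rightarrow> aff \<Rightarrow> aff set \<Rightarrow> bool" where
  "min_length_in T n x C \<longleftrightarrow> x \<in> C \<and> (\<forall>y \<in> C. aff_length T n x \<le> aff_length T n y)"

definition bruhat_minimal_in :: "cartan_type \<Rightarrow> nat \<Rightarrow> aff \<Rightarrow> aff set \<Rightarrow> bool" where
  "bruhat_minimal_in T n x F \<longleftrightarrow> x \<in> F \<and> (\<forall>y \<in> F. bruhat_le T n y x \<longrightarrow> y = x)"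

end

theory Submission
  imports Defs "HOL-Analysis.Function_Topology" "HOL-Library.Product_Lexorder" "HOL-Library.Multiset"
begin

text \<open>
  A translation \<open>t\<^sup>\<chi>\<close> has length \<open>N(\<chi>)\<close>, the sum of \<open>\<bar>\<langle>\<chi>, \<alpha>\<rangle>\<bar>\<close> over the positive roots, and length is
  subadditive. Hence \<open>l(w) \<ge> N(v\<^sub>w)\<close>, with equality exactly for good \<open>w\<close>, and \<open>N(v\<^sub>w)\<close> is constant on
  each fiber of \<open>f\<close>.

  Every \<open>w\<close> is connected, by conjugations with simple reflections that never increase the length, to
  some \<open>w'\<close> that moves a point \<open>p\<close> of the closed base alcove by a vector \<open>v\<close> fixed by the linear part
  of \<open>w'\<close>: minimise \<open>\<bar>w' p - p\<bar>\<^sup>2\<close> over the finitely many reachable \<open>w'\<close> and all \<open>p\<close>, and note that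
  conjugation by the reflection in a wall through \<open>p\<close> across which this function decreases does not
  increase the length (He and Nie). If an affine root vanishing at \<open>p\<close> and \<open>p + v\<close> separates the base
  alcove from its image under \<open>w'\<close>, then its reflection shortens \<open>w'\<close> without changing \<open>f\<close>; otherwise
  every affine root changes sign at most once along the powers of \<open>w'\<close>, so \<open>w'\<close> is good. The lifting
  property carries a smaller element of the fiber back from \<open>w'\<close> to \<open>w\<close>. Thus the good elements are
  both the Bruhat minimal and the shortest elements of a fiber.

  For a good integral \<open>w'\<close> the absence of such a separating root forces each cycle to have coprime
  length and translation part and excludes negative cycles, so \<open>w'\<close> is conjugate to a distinguished
  element. The latter is determined by its Newton vector, since the slope \<open>c/b\<close> of a coprime pair
  determines the pair.
\<close>

section \<open>The extended affine Weyl group\<close>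

text \<open>With \<open>e_(-i) = - e_i\<close> every root of either type is a difference
  \<open>e_i - e_j\<close>, the indices running over \<open>1..n\<close> in type A and over all
  nonzero ones in type C, so one argument serves both types. The given length formula and the word
  length are both reduced to counting the affine roots that change sign.

  The obstacle is that the point \<open>p\<close> of least displacement may lie on walls of the
  alcove, where a minimum does not force the gradient to vanish. So a second extremal choice is
  made: among the reachable elements with the same displacement at \<open>p\<close>, take one whose
  descent direction pairs maximally with \<open>a0 - p\<close>. Reflections in the walls through
  \<open>p\<close> cannot improve it, hence this direction points into the alcove, and least
  displacement forces it to be zero. That is exactly the statement that the displacement vector is
  fixed by the linear part, and it identifies this vector with the Newton vector.

  A shorter element found for a conjugate \<open>w'\<close> says nothing by itself about
  \<open>w\<close> in the Bruhat order; it is carried back one simple conjugation at a time.\<close>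

locale affine_weyl =
  fixes T :: cartan_type and n :: nat
  assumes n_pos: "n \<ge> 1"
begin

abbreviation G :: "aff monoid" where "G \<equiv> ext_aff T n"

abbreviation gmult :: "aff \<Rightarrow> aff \<Rightarrow> aff" (infixl "\<cdot>" 70) where "(\<cdot>) \<equiv> monoid.mult G"

abbreviation ginv :: "aff \<Rightarrow> aff" where "ginv \<equiv> m_inv G"

definition J :: "int set" where "J = {i. 1 \<le> \<bar>i\<bar> \<and> \<bar>i\<bar> \<le> int n}"

text \<open>A separate constant, because simplification with an assumption \<open>T = TypeA\<close> would replace the locale
  parameter.\<close>

definition is_A :: bool where "is_A \<longleftrightarrow> T = TypeA"

text \<open>The roots are \<open>e_i - e_j\<close> for distinct \<open>i\<close>, \<open>j\<close>
  in \<open>I\<close>. In type C this includes \<open>e_i - e_(-i) = 2 e_i\<close>, and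
  \<open>(i, j)\<close> and \<open>(- j, - i)\<close> name the same root.\<close>

definition I :: "int set" where "I = {i \<in> J. is_A \<longrightarrow> i > 0}"

lemma finite_J [simp]: "finite J"
proof -
  have "J \<subseteq> {- int n..int n}" by (auto simp: J_def)
  then show ?thesis using finite_subset by blast
qed

lemma uminus_J [simp]: "- i \<in> J \<longleftrightarrow> i \<in> J"
  by (auto simp: J_def)

lemma zero_notin_J [simp]: "0 \<notin> J"
  by (auto simp: J_def)

lemma I_subset_J: "I \<subseteq> J"
  by (auto simp: I_def)

lemma I_J [dest]: "i \<in> I \<Longrightarrow> i \<in> J"
  using I_subset_J by blast

lemma finite_I [simp]: "finite I"
  using I_subset_J finite_subset finite_J by blast

lemma J_cases: "i \<in> J \<Longrightarrow> i \<in> {1..int n} \<or> - i \<in> {1..int n}"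
  by (auto simp: J_def)

section \<open>Signed permutations and their action on vectors\<close>

lemma signed_perms_iff: "\<sigma> \<in> signed_perms n \<longleftrightarrow> \<sigma> permutes J \<and> (\<forall>i. \<sigma> (- i) = - \<sigma> i)"
  by (simp add: signed_perms_def J_def)

lemma weyl_iff:
  "\<sigma> \<in> weyl T n \<longleftrightarrow> \<sigma> permutes J \<and> (\<forall>i. \<sigma> (- i) = - \<sigma> i) \<and> (is_A \<longrightarrow> (\<forall>i>0. \<sigma> i > 0))"
  unfolding is_A_def by (cases T) (auto simp: unsigned_perms_def signed_perms_iff)

lemma weyl_permutes: "\<sigma> \<in> weyl T n \<Longrightarrow> \<sigma> permutes J"
  by (simp add: weyl_iff)

lemma weyl_bij: "\<sigma> \<in> weyl T n \<Longrightarrow> bij \<sigma>"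
  by (rule permutes_bij[OF weyl_permutes])

lemma weyl_odd: "\<sigma> \<in> weyl T n \<Longrightarrow> \<sigma> (- i) = - \<sigma> i"
  by (simp add: weyl_iff)

lemma weyl_inv_f [simp]: "\<sigma> \<in> weyl T n \<Longrightarrow> inv_into UNIV \<sigma> (\<sigma> i) = i"
  using weyl_bij bij_is_inj inv_f_f by metis

lemma weyl_f_inv [simp]: "\<sigma> \<in> weyl T n \<Longrightarrow> \<sigma> (inv_into UNIV \<sigma> i) = i"
  using weyl_bij bij_is_surj surj_f_inv_f by metis

lemma weyl_J [simp]: "\<sigma> \<in> weyl T n \<Longrightarrow> \<sigma> i \<in> J \<longleftrightarrow> i \<in> J"
  by (rule permutes_in_image[OF weyl_permutes])

lemma weyl_notin: "\<sigma> \<in> weyl T n \<Longrightarrow> i \<notin> J \<Longrightarrow> \<sigma> i = i"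
  by (rule permutes_not_in[OF weyl_permutes])

lemma weyl_id [simp]: "id \<in> weyl T n"
  by (simp add: weyl_iff permutes_id)

lemma weyl_comp: "\<sigma> \<in> weyl T n \<Longrightarrow> \<tau> \<in> weyl T n \<Longrightarrow> \<sigma> \<circ> \<tau> \<in> weyl T n"
  unfolding weyl_iff by (simp add: permutes_compose)

lemma weyl_inv: assumes "\<sigma> \<in> weyl T n" shows "inv_into UNIV \<sigma> \<in> weyl T n"
proof -
  have 1: "inv_into UNIV \<sigma> permutes J"
    using assms by (simp add: weyl_permutes permutes_inv)
  have 2: "inv_into UNIV \<sigma> (- i) = - inv_into UNIV \<sigma> i" for i
    using assms by (metis weyl_f_inv weyl_inv_f weyl_odd)
  have 3: "inv_into UNIV \<sigma> i > 0" if "is_A" "i > 0" for i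
  proof (rule ccontr)
    let ?j = "inv_into UNIV \<sigma> i"
    assume "\<not> ?j > 0"
    moreover have "?j \<noteq> 0"
    proof
      assume "?j = 0"
      then have "\<sigma> 0 = i" using weyl_f_inv[OF assms] by metis
      moreover have "\<sigma> 0 = 0" using weyl_notin[OF assms] by simp
      ultimately show False using that by simp
    qed
    ultimately have "- ?j > 0" by simp
    then have "\<sigma> (- ?j) > 0" using assms that(1) unfolding weyl_iff by blast
    moreover have "\<sigma> (- ?j) = - i" using weyl_odd[OF assms] weyl_f_inv[OF assms] by metis
    ultimately show False using that by simp
  qed
  show ?thesis using 1 2 3 unfolding weyl_iff by blast
qed

lemma weyl_I [simp]: assumes "\<sigma> \<in> weyl T n" shows "\<sigma> i \<in> I \<longleftrightarrow> i \<in> I"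
proof -
  have *: "\<tau> i \<in> I" if "i \<in> I" "\<tau> \<in> weyl T n" for i \<tau>
    using that unfolding I_def weyl_iff by (auto simp: permutes_in_image)
  then show ?thesis using assms weyl_inv weyl_inv_f by metis
qed

lemma inv_comp_weyl:
  "\<sigma> \<in> weyl T n \<Longrightarrow> \<tau> \<in> weyl T n \<Longrightarrow>
   inv_into UNIV (\<sigma> \<circ> \<tau>) i = inv_into UNIV \<tau> (inv_into UNIV \<sigma> i)"
  by (simp add: o_inv_distrib weyl_bij)

lemma inv_inv_weyl [simp]: "\<sigma> \<in> weyl T n \<Longrightarrow> inv_into UNIV (inv_into UNIV \<sigma>) = \<sigma>"
  by (simp add: inv_inv_eq weyl_bij)

lemma act_id [simp]: "act id a = a"
  by (simp add: act_def)

lemma act_comp: "\<sigma> \<in> weyl T n \<Longrightarrow> \<tau> \<in> weyl T n \<Longrightarrow> act (\<sigma> \<circ> \<tau>) a = act \<sigma> (act \<tau> a)"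
  by (simp add: act_def inv_comp_weyl)

lemma act_add: "act \<sigma> (a + b) = act \<sigma> a + act \<sigma> b"
  by (simp add: act_def fun_eq_iff)

lemma act_diff: "act \<sigma> (a - b) = act \<sigma> a - act \<sigma> b"
  by (simp add: act_def fun_eq_iff)

lemma act_uminus: "act \<sigma> (- b) = - act \<sigma> b"
  by (simp add: act_def fun_eq_iff)

lemma act_zero [simp]: "act \<sigma> 0 = 0"
  by (simp add: act_def fun_eq_iff)

lemma act_scale: "act \<sigma> (Defs.scale c a) = Defs.scale c (act \<sigma> a)"
  by (simp add: act_def Defs.scale_def)

lemma vecs_iff: "a \<in> vecs n \<longleftrightarrow> (\<forall>i. a (- i) = - a i) \<and> (\<forall>i. i \<notin> J \<longrightarrow> a i = 0)"
proof -
  have "a 0 = 0" if "\<forall>i. a (- i) = - a i"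
    using that[rule_format, of 0] by simp
  moreover have "i \<notin> J \<longleftrightarrow> i = 0 \<or> \<bar>i\<bar> > int n" for i by (auto simp: J_def)
  ultimately show ?thesis unfolding vecs_def by auto
qed

lemma vecs_act: "a \<in> vecs n \<Longrightarrow> \<sigma> \<in> weyl T n \<Longrightarrow> act \<sigma> a \<in> vecs n"
  unfolding vecs_iff act_def by (simp add: weyl_odd[OF weyl_inv] weyl_notin[OF weyl_inv])

lemma vecs_add: "a \<in> vecs n \<Longrightarrow> b \<in> vecs n \<Longrightarrow> a + b \<in> vecs n"
  and vecs_uminus: "a \<in> vecs n \<Longrightarrow> - a \<in> vecs n"
  and vecs_diff: "a \<in> vecs n \<Longrightarrow> b \<in> vecs n \<Longrightarrow> a - b \<in> vecs n"
  and vecs_zero: "0 \<in> vecs n"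
  unfolding vecs_iff by simp_all

lemma int_vecs_iff: "a \<in> int_vecs n \<longleftrightarrow> a \<in> vecs n \<and> (\<forall>i\<in>J. a i \<in> \<int>)"
proof -
  have "a i \<in> \<int>" if "a \<in> vecs n" "\<forall>i\<in>J. a i \<in> \<int>" for i
    using that by (cases "i \<in> J") (auto simp: vecs_iff)
  then show ?thesis unfolding int_vecs_def by blast
qed

lemma omega_vec_eq:
  "omega_vec n i = (if i \<in> {1..int n} then 1/2 else if - i \<in> {1..int n} then - 1/2 else 0)"
proof -
  have "(\<Sum>l = 1..int n. Defs.scale (1/2) (unit_vec l)) i = (\<Sum>l = 1..int n. Defs.scale (1/2) (unit_vec l) i)"
    by (induction rule: infinite_finite_induct[of _ "{1..int n}"]) auto
  also have "\<dots> = (\<Sum>l = 1..int n. (if l = i then 1/2 else 0) - (if l = - i then 1/2 else 0))"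
    by (intro sum.cong) (auto simp: Defs.scale_def unit_vec_def)
  also have "\<dots> = (if i \<in> {1..int n} then 1/2 else 0) - (if - i \<in> {1..int n} then 1/2 else 0)"
    by (simp only: sum_subtractf) (simp add: sum.delta)
  finally show ?thesis unfolding omega_vec_def by auto
qed

lemma omega_vec_vecs: "omega_vec n \<in> vecs n"
  unfolding vecs_iff omega_vec_eq by (auto simp: J_def)

section \<open>The translation lattice and the coroot lattice\<close>

lemma trans_lattice_iff:
  "a \<in> trans_lattice T n \<longleftrightarrow>
   a \<in> vecs n \<and> ((\<forall>i\<in>J. a i \<in> \<int>) \<or> (\<not> is_A \<and> (\<forall>i\<in>J. a i - 1/2 \<in> \<int>)))"
proof -
  have om: "omega_vec n i - 1/2 \<in> \<int>" if "i \<in> J" for i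
    using that by (auto simp: omega_vec_eq J_def)
  have 1: "(\<exists>b. a = b + omega_vec n \<and> b \<in> int_vecs n) \<longleftrightarrow> a - omega_vec n \<in> int_vecs n" for a
    by (auto intro!: exI[of _ "a - omega_vec n"])
  have 2: "a - omega_vec n \<in> int_vecs n \<longleftrightarrow> a \<in> vecs n \<and> (\<forall>i\<in>J. a i - 1/2 \<in> \<int>)" for a
  proof -
    have A: "a - omega_vec n \<in> vecs n \<longleftrightarrow> a \<in> vecs n"
      using vecs_diff[of a "omega_vec n"] vecs_add[of "a - omega_vec n" "omega_vec n"] omega_vec_vecs
      by auto
    have B: "a i - omega_vec n i \<in> \<int> \<longleftrightarrow> a i - 1/2 \<in> \<int>" if "i \<in> J" for i
      using Ints_add[of "a i - omega_vec n i" "omega_vec n i - 1/2"]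
        Ints_diff[of "a i - 1/2" "omega_vec n i - 1/2"] om[OF that] by auto
    show ?thesis unfolding int_vecs_iff A using B by auto
  qed
  have C: "a \<in> trans_lattice TypeC n \<longleftrightarrow> a \<in> vecs n \<and> ((\<forall>i\<in>J. a i \<in> \<int>) \<or> (\<forall>i\<in>J. a i - 1/2 \<in> \<int>))"
    using 1 2 by (auto simp: int_vecs_iff)
  have A: "a \<in> trans_lattice TypeA n \<longleftrightarrow> a \<in> vecs n \<and> (\<forall>i\<in>J. a i \<in> \<int>)"
    by (simp add: int_vecs_iff)
  show ?thesis
  proof (cases is_A)
    case True then have "T = TypeA" by (simp add: is_A_def)
    with True show ?thesis using A by auto
  next
    case False then have "T = TypeC" unfolding is_A_def by (cases T) simp_all
    with False show ?thesis using C by auto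
  qed
qed

lemma trans_lattice_vecs: "a \<in> trans_lattice T n \<Longrightarrow> a \<in> vecs n"
  by (simp add: trans_lattice_iff)

lemma trans_lattice_odd: "a \<in> trans_lattice T n \<Longrightarrow> a (- i) = - a i"
  using trans_lattice_vecs vecs_iff by blast

lemma trans_lattice_notin: "a \<in> trans_lattice T n \<Longrightarrow> i \<notin> J \<Longrightarrow> a i = 0"
  using trans_lattice_vecs vecs_iff by blast

text \<open>The coordinates are all integral or all half-integral, so the halves cancel. This keeps
  the constants of affine roots integral under the whole group; \<open>j = - i\<close> covers the
  roots \<open>2 e_i\<close>.\<close>

lemma trans_lattice_diff_Ints:
  assumes "a \<in> trans_lattice T n" "i \<in> J" "j \<in> J" shows "a i - a j \<in> \<int>"
proof -
  have "a i - a j = (a i - 1/2) - (a j - 1/2)" by simp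
  then show ?thesis using assms unfolding trans_lattice_iff by (metis Ints_diff)
qed

lemma half_Ints: "(a::rat) - 1/2 \<in> \<int> \<Longrightarrow> - a - 1/2 \<in> \<int>"
  using Ints_diff[OF Ints_minus, of "a - 1/2" 1] by (simp add: algebra_simps)

lemma half_add_Ints: "(a::rat) - 1/2 \<in> \<int> \<Longrightarrow> b - 1/2 \<in> \<int> \<Longrightarrow> a + b \<in> \<int>"
  using Ints_add[OF Ints_add, of "a - 1/2" "b - 1/2" 1] by simp

lemma half_add_Ints': "(a::rat) - 1/2 \<in> \<int> \<Longrightarrow> b \<in> \<int> \<Longrightarrow> a + b - 1/2 \<in> \<int>"
  using Ints_add[of "a - 1/2" "b"] by (simp add: algebra_simps)

lemma trans_lattice_uminus: "a \<in> trans_lattice T n \<Longrightarrow> - a \<in> trans_lattice T n"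
  unfolding trans_lattice_iff using vecs_uminus half_Ints by auto

lemma trans_lattice_zero [simp]: "0 \<in> trans_lattice T n"
  unfolding trans_lattice_iff using vecs_zero by auto

lemma trans_lattice_add:
  "a \<in> trans_lattice T n \<Longrightarrow> b \<in> trans_lattice T n \<Longrightarrow> a + b \<in> trans_lattice T n"
proof -
  assume a: "a \<in> trans_lattice T n" and b: "b \<in> trans_lattice T n"
  then consider "\<forall>i\<in>J. a i \<in> \<int>" "\<forall>i\<in>J. b i \<in> \<int>"
    | "\<not> is_A" "\<forall>i\<in>J. a i - 1/2 \<in> \<int>" "\<forall>i\<in>J. b i \<in> \<int>"
    | "\<not> is_A" "\<forall>i\<in>J. a i \<in> \<int>" "\<forall>i\<in>J. b i - 1/2 \<in> \<int>"
    | "\<not> is_A" "\<forall>i\<in>J. a i - 1/2 \<in> \<int>" "\<forall>i\<in>J. b i - 1/2 \<in> \<int>"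
    unfolding trans_lattice_iff by blast
  then have "(\<forall>i\<in>J. a i + b i \<in> \<int>) \<or> (\<not> is_A \<and> (\<forall>i\<in>J. a i + b i - 1/2 \<in> \<int>))"
  proof cases
    case 1 then show ?thesis by (meson Ints_add)
  next
    case 2 then show ?thesis using half_add_Ints' by blast
  next
    case 3 then show ?thesis using half_add_Ints' by (metis add.commute)
  next
    case 4 then show ?thesis using half_add_Ints by blast
  qed
  then show ?thesis using a b vecs_add unfolding trans_lattice_iff plus_fun_apply by blast
qed

lemma trans_lattice_act:
  "a \<in> trans_lattice T n \<Longrightarrow> \<sigma> \<in> weyl T n \<Longrightarrow> act \<sigma> a \<in> trans_lattice T n"
  unfolding trans_lattice_iff using vecs_act[of a \<sigma>] by (auto simp: act_def weyl_inv)

lemma coroot_lattice_iff: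
  "a \<in> coroot_lattice T n \<longleftrightarrow>
   a \<in> int_vecs n \<and> (is_A \<longrightarrow> (\<Sum>i = 1..int n. a i) = 0)"
  unfolding is_A_def by (cases T) auto

lemma coroot_lattice_trans: "a \<in> coroot_lattice T n \<Longrightarrow> a \<in> trans_lattice T n"
  unfolding coroot_lattice_iff trans_lattice_iff int_vecs_iff by auto

lemma coroot_lattice_zero [simp]: "0 \<in> coroot_lattice T n"
  unfolding coroot_lattice_iff int_vecs_iff by (auto simp: vecs_zero)

lemma coroot_lattice_add:
  "a \<in> coroot_lattice T n \<Longrightarrow> b \<in> coroot_lattice T n \<Longrightarrow> a + b \<in> coroot_lattice T n"
  unfolding coroot_lattice_iff int_vecs_iff by (auto simp: vecs_add sum.distrib)

lemma coroot_lattice_uminus: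
  "a \<in> coroot_lattice T n \<Longrightarrow> - a \<in> coroot_lattice T n"
  unfolding coroot_lattice_iff int_vecs_iff by (auto simp: vecs_uminus sum_negf)

lemma weyl_act_sum:
  assumes "\<sigma> \<in> weyl T n" is_A
  shows "(\<Sum>i = 1..int n. act \<sigma> a i) = (\<Sum>i = 1..int n. a i)"
proof -
  have "bij_betw (inv_into UNIV \<sigma>) I I"
    using assms(1) weyl_inv[OF assms(1)]
    by (intro bij_betwI[where g = \<sigma>]) auto
  then have "(\<Sum>i\<in>I. a (inv_into UNIV \<sigma> i)) = (\<Sum>i\<in>I. a i)"
    by (rule sum.reindex_bij_betw)
  moreover have "I = {1..int n}" using assms(2) by (auto simp: I_def J_def)
  ultimately show ?thesis by (simp add: act_def)
qed

text \<open>Permuting and negating changes coordinates by integers and, in type A, keeps their sum.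
  Since the Weyl group thus acts trivially modulo the coroot lattice, the coset of \<open>Wa\<close>
  depends on the translation part only.\<close>

lemma act_diff_coroot:
  assumes "\<sigma> \<in> weyl T n" "a \<in> trans_lattice T n"
  shows "act \<sigma> a - a \<in> coroot_lattice T n"
proof -
  have "act \<sigma> a - a \<in> vecs n"
    using assms by (simp add: vecs_act vecs_diff trans_lattice_vecs)
  moreover have "(act \<sigma> a - a) i \<in> \<int>" if "i \<in> J" for i
    using trans_lattice_diff_Ints[OF assms(2), of "inv_into UNIV \<sigma> i" i] that assms(1) weyl_inv
    by (simp add: act_def)
  ultimately show ?thesis unfolding coroot_lattice_iff int_vecs_iff
    using weyl_act_sum[OF assms(1)] by (simp add: sum_subtractf)
qed

lemma coroot_lattice_act:
  "a \<in> coroot_lattice T n \<Longrightarrow> \<sigma> \<in> weyl T n \<Longrightarrow> act \<sigma> a \<in> coroot_lattice T n"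
  using coroot_lattice_add[OF act_diff_coroot, of \<sigma> a a] coroot_lattice_trans by simp

section \<open>The group structure and the cosets of the affine Weyl group\<close>

lemma carrier_G: "carrier G = trans_lattice T n \<times> weyl T n"
  and mult_G: "x \<cdot> y = (fst x + act (snd x) (fst y), snd x \<circ> snd y)"
  and one_G: "\<one>\<^bsub>G\<^esub> = (0, id)"
  by (auto simp: ext_aff_def split: prod.splits)

lemma group_G: "group G"
proof (rule groupI)
  fix x y z assume "x \<in> carrier G" "y \<in> carrier G" "z \<in> carrier G"
  then show "x \<cdot> y \<cdot> z = x \<cdot> (y \<cdot> z)"
    by (auto simp: mult_G carrier_G act_comp act_add o_assoc)
next
  fix x assume x: "x \<in> carrier G"
  let ?s = "inv_into UNIV (snd x)"
  have "(act ?s (- fst x), ?s) \<cdot> x = \<one>\<^bsub>G\<^esub>"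
    using x by (auto simp: mult_G one_G carrier_G act_uminus weyl_bij bij_is_inj)
  moreover have "(act ?s (- fst x), ?s) \<in> carrier G"
    using x by (auto simp: carrier_G trans_lattice_uminus trans_lattice_act weyl_inv)
  ultimately show "\<exists>y\<in>carrier G. y \<cdot> x = \<one>\<^bsub>G\<^esub>" by blast
qed (auto simp: carrier_G mult_G one_G trans_lattice_add trans_lattice_act weyl_comp)

sublocale G: group G by (rule group_G)

lemma inv_G: assumes "x \<in> carrier G"
  shows "ginv x = (- act (inv_into UNIV (snd x)) (fst x), inv_into UNIV (snd x))"
proof -
  let ?s = "inv_into UNIV (snd x)"
  have "(act ?s (- fst x), ?s) \<cdot> x = \<one>\<^bsub>G\<^esub>"
    using assms by (auto simp: mult_G one_G carrier_G act_uminus weyl_bij bij_is_inj)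
  moreover have "(act ?s (- fst x), ?s) \<in> carrier G"
    using assms by (auto simp: carrier_G trans_lattice_uminus trans_lattice_act weyl_inv)
  ultimately show ?thesis using G.inv_equality[of _ x] assms by (simp add: act_uminus)
qed

lemma aff_weyl_subgroup: "subgroup (aff_weyl T n) G"
proof (rule G.subgroupI)
  show "aff_weyl T n \<subseteq> carrier G" by (auto simp: aff_weyl_def carrier_G coroot_lattice_trans)
  then show "ginv a \<in> aff_weyl T n" if "a \<in> aff_weyl T n" for a
    using that by (subst inv_G) (auto simp: aff_weyl_def coroot_lattice_uminus coroot_lattice_act weyl_inv)
  have "(0, id) \<in> aff_weyl T n" by (auto simp: aff_weyl_def)
  then show "aff_weyl T n \<noteq> {}" by blast
qed (auto simp: aff_weyl_def mult_G coroot_lattice_add coroot_lattice_act weyl_comp)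

abbreviation Wa :: "aff set" where "Wa \<equiv> aff_weyl T n"

lemma Wa_carrier [simp]: "x \<in> Wa \<Longrightarrow> x \<in> carrier G"
  using subgroup.subset[OF aff_weyl_subgroup] by blast

lemma Wa_mult: "x \<in> Wa \<Longrightarrow> y \<in> Wa \<Longrightarrow> x \<cdot> y \<in> Wa"
  and Wa_inv: "x \<in> Wa \<Longrightarrow> ginv x \<in> Wa"
  and Wa_one: "\<one>\<^bsub>G\<^esub> \<in> Wa"
  using subgroup.m_closed[OF aff_weyl_subgroup] subgroup.one_closed[OF aff_weyl_subgroup]
    G.subgroupE(3)[OF aff_weyl_subgroup] by simp_all

lemma mem_coset_iff:
  assumes "x \<in> carrier G"
  shows "y \<in> Wa #>\<^bsub>G\<^esub> x \<longleftrightarrow> y \<in> carrier G \<and> fst y - fst x \<in> coroot_lattice T n"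
proof -
  have "y \<in> Wa #>\<^bsub>G\<^esub> x \<longleftrightarrow> y \<in> carrier G \<and> y \<cdot> ginv x \<in> Wa"
  proof
    assume "y \<in> Wa #>\<^bsub>G\<^esub> x"
    then obtain h where "h \<in> Wa" "y = h \<cdot> x" by (auto simp: r_coset_def)
    then show "y \<in> carrier G \<and> y \<cdot> ginv x \<in> Wa"
      using assms by (simp add: G.inv_solve_right' G.m_assoc)
  next
    assume "y \<in> carrier G \<and> y \<cdot> ginv x \<in> Wa"
    then show "y \<in> Wa #>\<^bsub>G\<^esub> x"
      unfolding r_coset_def using assms
      by (auto intro!: bexI[of _ "y \<cdot> ginv x"] simp: G.m_assoc)
  qed
  moreover have "y \<cdot> ginv x \<in> Wa \<longleftrightarrow> fst y - fst x \<in> coroot_lattice T n" if y: "y \<in> carrier G"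
  proof -
    let ?s = "snd y \<circ> inv_into UNIV (snd x)"
    have s: "?s \<in> weyl T n" "fst x \<in> trans_lattice T n"
      using y assms by (auto simp: carrier_G weyl_comp weyl_inv)
    have e: "y \<cdot> ginv x = (fst y - act ?s (fst x), ?s)"
      using y assms
      by (simp add: inv_G mult_G act_uminus act_comp weyl_inv carrier_G mem_Times_iff)
    have "fst y - act ?s (fst x) \<in> coroot_lattice T n \<longleftrightarrow> fst y - fst x \<in> coroot_lattice T n"
      using act_diff_coroot[OF s]
        coroot_lattice_add[of "fst y - act ?s (fst x)" "act ?s (fst x) - fst x"]
        coroot_lattice_add[OF _ coroot_lattice_uminus, of "fst y - fst x" "act ?s (fst x) - fst x"]
      by auto
    then show ?thesis using e s by (simp add: aff_weyl_def)
  qed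
  ultimately show ?thesis by blast
qed

lemma coset_eq_iff:
  assumes "x \<in> carrier G" "y \<in> carrier G"
  shows "Wa #>\<^bsub>G\<^esub> x = Wa #>\<^bsub>G\<^esub> y \<longleftrightarrow> fst x - fst y \<in> coroot_lattice T n"
proof
  assume "Wa #>\<^bsub>G\<^esub> x = Wa #>\<^bsub>G\<^esub> y"
  moreover have "x \<in> Wa #>\<^bsub>G\<^esub> x" using mem_coset_iff assms by auto
  ultimately show "fst x - fst y \<in> coroot_lattice T n" using mem_coset_iff assms by auto
next
  assume d: "fst x - fst y \<in> coroot_lattice T n"
  have "z - fst x \<in> coroot_lattice T n \<longleftrightarrow> z - fst y \<in> coroot_lattice T n" for z
    using coroot_lattice_add[OF _ d, of "z - fst x"]
      coroot_lattice_add[OF _ coroot_lattice_uminus[OF d], of "z - fst y"] by auto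
  then show "Wa #>\<^bsub>G\<^esub> x = Wa #>\<^bsub>G\<^esub> y"
    using mem_coset_iff assms by blast
qed

text \<open>The quotient by \<open>Wa\<close> is the translation lattice modulo the coroot lattice,
  hence abelian.\<close>

lemma coset_conj:
  assumes "x \<in> carrier G" "g \<in> carrier G"
  shows "Wa #>\<^bsub>G\<^esub> (g \<cdot> x \<cdot> ginv g) = Wa #>\<^bsub>G\<^esub> x"
proof -
  let ?r = "snd g \<circ> snd x \<circ> inv_into UNIV (snd g)"
  have w: "snd g \<in> weyl T n" "?r \<in> weyl T n" "fst g \<in> trans_lattice T n" "fst x \<in> trans_lattice T n"
    using assms by (auto simp: carrier_G weyl_comp weyl_inv)
  have "fst (g \<cdot> x \<cdot> ginv g) - fst x
     = (act (snd g) (fst x) - fst x) + - (act ?r (fst g) - fst g)"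
    using assms
    by (simp add: inv_G mult_G act_uminus act_comp weyl_comp weyl_inv carrier_G mem_Times_iff)
  also have "\<dots> \<in> coroot_lattice T n"
    using act_diff_coroot w coroot_lattice_add coroot_lattice_uminus by presburger
  finally show ?thesis using coset_eq_iff assms by simp
qed

lemma coset_Wa_mult:
  assumes "x \<in> carrier G" "u \<in> Wa"
  shows "Wa #>\<^bsub>G\<^esub> (u \<cdot> x) = Wa #>\<^bsub>G\<^esub> x"
  using assms G.coset_mult_assoc[of Wa u x] subgroup.subset[OF aff_weyl_subgroup]
    G.coset_join2[OF _ aff_weyl_subgroup, of u] by simp

section \<open>Affine roots and inversions\<close>

text \<open>Points have real coordinates because a point of least displacement is obtained from
  compactness. Oddness is kept as a separate hypothesis \<open>odd_fun\<close>.\<close>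

definition ap :: "aff \<Rightarrow> (int \<Rightarrow> real) \<Rightarrow> int \<Rightarrow> real" where
  "ap x p = (\<lambda>i. real_of_rat (fst x i) + p (inv_into UNIV (snd x) i))"

definition lp :: "aff \<Rightarrow> (int \<Rightarrow> real) \<Rightarrow> int \<Rightarrow> real" where
  "lp x p = (\<lambda>i. p (inv_into UNIV (snd x) i))"

definition odd_fun :: "(int \<Rightarrow> real) \<Rightarrow> bool" where
  "odd_fun p \<longleftrightarrow> (\<forall>i. p (- i) = - p i)"

lemma carrier_fst [simp]: "x \<in> carrier G \<Longrightarrow> fst x \<in> trans_lattice T n"
  and carrier_snd [simp]: "x \<in> carrier G \<Longrightarrow> snd x \<in> weyl T n"
  by (auto simp: carrier_G)

lemma ap_mult: "x \<in> carrier G \<Longrightarrow> y \<in> carrier G \<Longrightarrow> ap (x \<cdot> y) p = ap x (ap y p)"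
  by (simp add: ap_def mult_G act_def inv_comp_weyl of_rat_add fun_eq_iff)

lemma lp_mult: "x \<in> carrier G \<Longrightarrow> y \<in> carrier G \<Longrightarrow> lp (x \<cdot> y) p = lp x (lp y p)"
  by (simp add: lp_def mult_G inv_comp_weyl fun_eq_iff)

lemma ap_one [simp]: "ap \<one>\<^bsub>G\<^esub> p = p"
  by (simp add: ap_def one_G)

lemma lp_one [simp]: "lp \<one>\<^bsub>G\<^esub> p = p"
  by (simp add: lp_def one_G)

lemma ap_inv [simp]: "x \<in> carrier G \<Longrightarrow> ap (ginv x) (ap x p) = p"
  and ap_inv' [simp]: "x \<in> carrier G \<Longrightarrow> ap x (ap (ginv x) p) = p"
  by (simp_all flip: ap_mult)

lemma odd_funD: "odd_fun p \<Longrightarrow> p (- i) = - p i"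
  by (simp add: odd_fun_def)

lemma inv_weyl_odd: "\<sigma> \<in> weyl T n \<Longrightarrow> inv_into UNIV \<sigma> (- i) = - inv_into UNIV \<sigma> i"
  by (simp add: weyl_inv weyl_odd)

lemma odd_ap [simp]: "odd_fun p \<Longrightarrow> x \<in> carrier G \<Longrightarrow> odd_fun (ap x p)"
  unfolding odd_fun_def ap_def by (simp add: inv_weyl_odd trans_lattice_odd of_rat_minus)

lemma ap_add: "ap x (p + u) = ap x p + lp x u"
  by (simp add: ap_def lp_def fun_eq_iff)

lemma ap_diff: "ap x p - ap x q = lp x (p - q)"
  by (simp add: ap_def lp_def fun_eq_iff)

text \<open>The zero point reads off the translation part; the point \<open>real_of_int\<close>, odd
  and injective, reads off the permutation.\<close>

lemma ap_faithful:
  assumes "x \<in> carrier G" "y \<in> carrier G" "\<And>p. odd_fun p \<Longrightarrow> ap x p = ap y p"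
  shows "x = y"
proof -
  have o: "odd_fun (\<lambda>i. 0)" "odd_fun real_of_int" by (auto simp: odd_fun_def)
  have "fst x i = fst y i" for i
    using assms(3)[OF o(1)] by (simp add: ap_def fun_eq_iff)
  then have f: "fst x = fst y" by blast
  have "inv_into UNIV (snd x) i = inv_into UNIV (snd y) i" for i
    using assms(3)[OF o(2)] f by (simp add: ap_def fun_eq_iff)
  then have "inv_into UNIV (snd x) = inv_into UNIV (snd y)" by blast
  then have "snd x = snd y" using assms inv_inv_weyl carrier_snd by metis
  then show ?thesis using f by (simp add: prod_eq_iff)
qed

text \<open>The Coxeter number, which is also the number of indices in \<open>I\<close>. The point
  \<open>a0\<close> is half the sum of the positive coroots divided by \<open>N\<close>, so a
  positive root takes there its height divided by \<open>N\<close>.\<close>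

definition N :: int where "N = (if is_A then int n else 2 * int n)"

text \<open>A point of the base alcove. Its coordinates modulo the integers are equally spaced at distance
  \<open>1/N\<close>, so affine roots take values in \<open>(1/N)\<int>\<close> there and the simple ones are those of value \<open>1/N\<close>.\<close>

definition a0 :: "int \<Rightarrow> real" where
  "a0 i = (if i \<in> J then (if i > 0 then (of_int N + 1 - 2 * i) / (2 * of_int N)
                       else - (of_int N + 1 + 2 * i) / (2 * of_int N)) else 0)"

lemma N_pos: "N > 0"
  using n_pos by (simp add: N_def)

lemma a0_odd [simp]: "odd_fun a0"
  unfolding odd_fun_def a0_def by (auto simp: divide_simps)

lemma a0_diff:
  assumes "i \<in> I" "j \<in> I" "i \<noteq> j"
  shows "\<exists>m::int. m \<noteq> 0 \<and> \<bar>m\<bar> < N \<and> a0 i - a0 j = of_int m / of_int N"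
proof -
  \<comment> \<open>In units of \<open>1/N\<close> and up to a common shift, \<open>h\<close> is the
    position of a coordinate: positive indices occupy \<open>-n..-1\<close>, and in type C the
    negative ones fill the adjacent stretch below.\<close>
  define h where "h i = (if i > 0 then - i else - i - N - 1)" for i :: int
  have "a0 i - a0 j = (of_int (h i) - of_int (h j)) / of_int N"
    using assms N_pos unfolding a0_def h_def by (auto simp: field_simps dest: I_J)
  moreover have "h i - h j \<noteq> 0" "\<bar>h i - h j\<bar> < N"
    using assms unfolding I_def J_def h_def N_def by (auto split: if_splits)
  ultimately show ?thesis by (metis of_int_diff)
qed

lemma a0_inj:
  assumes "i \<in> I" "j \<in> I" "a0 i - a0 j = of_int k"
  shows "i = j"
proof (rule ccontr)
  assume "i \<noteq> j"
  then obtain m where m: "m \<noteq> 0" "\<bar>m\<bar> < N" "a0 i - a0 j = of_int m / of_int N"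
    using a0_diff assms by blast
  then have "real_of_int m = of_int (k * N)" using assms N_pos by (simp add: field_simps)
  then have "m = k * N" by linarith
  with m(1,2) show False using N_pos
    by (auto simp: abs_mult)
qed

text \<open>At odd points this is \<open>p i - p j - k\<close>; the symmetrised form makes \<open>(i, j)\<close> and \<open>(- j, - i)\<close> name
  the same function.\<close>

definition aroot :: "int \<Rightarrow> int \<Rightarrow> int \<Rightarrow> (int \<Rightarrow> real) \<Rightarrow> real" where
  "aroot i j k p = (p i - p (- i) - p j + p (- j)) / 2 - of_int k"

definition AR :: "((int \<Rightarrow> real) \<Rightarrow> real) set" where
  "AR = {aroot i j k | i j k. i \<in> I \<and> j \<in> I \<and> i \<noteq> j}"

lemma aroot_odd: "odd_fun p \<Longrightarrow> aroot i j k p = p i - p j - of_int k"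
  by (simp add: aroot_def odd_fun_def)

lemma aroot_AR: "i \<in> I \<Longrightarrow> j \<in> I \<Longrightarrow> i \<noteq> j \<Longrightarrow> aroot i j k \<in> AR"
  by (auto simp: AR_def)

lemma AR_E: assumes "\<beta> \<in> AR" obtains i j k where "\<beta> = aroot i j k" "i \<in> I" "j \<in> I" "i \<noteq> j"
  using assms by (auto simp: AR_def)

lemma aroot_swap: "aroot (- j) (- i) k = aroot i j k"
  by (simp add: aroot_def fun_eq_iff)

lemma aroot_minus: "aroot j i (- k) = - aroot i j k"
  by (simp add: aroot_def fun_eq_iff field_simps)

lemma AR_uminus: "\<beta> \<in> AR \<Longrightarrow> - \<beta> \<in> AR"
  by (erule AR_E) (auto simp flip: aroot_minus intro!: aroot_AR)

lemma aroot_eq_D: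
  assumes "aroot i j k = aroot i' j' k'" "i \<noteq> j" "i' \<noteq> j'" "i \<in> J" "j \<in> J" "i' \<in> J" "j' \<in> J"
  shows "k = k' \<and> (i' = i \<and> j' = j \<or> i' = - j \<and> j' = - i)"
proof -
  have k: "k = k'" using fun_cong[OF assms(1), of "\<lambda>i. 0"] by (simp add: aroot_def)
  have half_cancel: "a = b" if "a / 2 - real_of_int k = b / 2 - of_int k'" "k = k'" for a b :: real
    using that by simp
  have e: "(\<lambda>l. if l = m then 1 else 0) i - (\<lambda>l. if l = m then 1 else 0) (-i) - (\<lambda>l. if l = m then 1 else 0) j + (\<lambda>l. if l = m then 1 else 0) (- j)
      = (\<lambda>l. if l = m then 1 else (0::real)) i' - (\<lambda>l. if l = m then 1 else 0) (- i') - (\<lambda>l. if l = m then 1 else 0) j' + (\<lambda>l. if l = m then 1 else 0) (- j')" for m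
    using fun_cong[OF assms(1), of "\<lambda>l. if l = m then 1 else 0"] k
    unfolding aroot_def by (rule half_cancel)
  have nz: "i \<noteq> 0" "j \<noteq> 0" "i' \<noteq> 0" "j' \<noteq> 0" using assms zero_notin_J by metis+
  then have n: "i \<noteq> - i" "j \<noteq> - j" "i' \<noteq> - i'" "j' \<noteq> - j'" by auto
  have 1: "i = i' \<or> i = - j'" using e[of i] n assms(2,3) by (auto split: if_splits)
  have 2: "j = j' \<or> j = - i'" using e[of j] n assms(2,3) by (auto split: if_splits)
  have 3: "j = - i \<Longrightarrow> j' = - i'" using e[of i] n assms(2,3) by (auto split: if_splits)
  show ?thesis using k 1 2 3 by auto
qed

text \<open>Pulling back along \<open>x\<close> permutes the indices and shifts the constant. The
  shift \<open>c\<close> serves all constants and points at once and is an integer even for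
  half-integral translation parts.\<close>

lemma aroot_ap:
  assumes "x \<in> carrier G" "i \<in> J" "j \<in> J"
  obtains c where "real_of_rat (fst x i) - real_of_rat (fst x j) = of_int c"
    "\<And>k p. aroot i j k (ap x p) = aroot (inv_into UNIV (snd x) i) (inv_into UNIV (snd x) j) (k - c) p"
proof -
  have "fst x i - fst x j \<in> \<int>" using trans_lattice_diff_Ints assms by simp
  then obtain c where c: "fst x i - fst x j = of_int c" by (elim Ints_cases)
  have c': "real_of_rat (fst x i) - real_of_rat (fst x j) = of_int c"
    using arg_cong[OF c, of real_of_rat] by (simp add: of_rat_diff)
  have "aroot i j k (ap x p) = aroot (inv_into UNIV (snd x) i) (inv_into UNIV (snd x) j) (k - c) p" for k p
    using c' assms
    by (simp add: aroot_def ap_def inv_weyl_odd trans_lattice_odd of_rat_minus field_simps)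
  then show thesis using that c' by blast
qed

lemma AR_ap:
  assumes "\<beta> \<in> AR" "x \<in> carrier G" shows "(\<lambda>p. \<beta> (ap x p)) \<in> AR"
proof -
  obtain i j k where b: "\<beta> = aroot i j k" "i \<in> I" "j \<in> I" "i \<noteq> j" using AR_E assms(1) by metis
  obtain c where "\<And>k p. aroot i j k (ap x p) = aroot (inv_into UNIV (snd x) i) (inv_into UNIV (snd x) j) (k - c) p"
    using aroot_ap[OF assms(2), of i j] b by blast
  moreover have "inv_into UNIV (snd x) i \<noteq> inv_into UNIV (snd x) j"
    using b(4) assms(2) by (metis carrier_snd weyl_f_inv)
  ultimately show ?thesis unfolding b(1) using b assms(2) by (simp add: aroot_AR weyl_inv)
qed

definition lin :: "((int \<Rightarrow> real) \<Rightarrow> real) \<Rightarrow> (int \<Rightarrow> real) \<Rightarrow> real" where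
  "lin \<beta> u = \<beta> u - \<beta> 0"

lemma AR_add: "\<beta> \<in> AR \<Longrightarrow> \<beta> (p + u) = \<beta> p + lin \<beta> u"
  by (erule AR_E) (simp add: lin_def aroot_def field_simps)

lemma lin_scale: "\<beta> \<in> AR \<Longrightarrow> lin \<beta> (\<lambda>i. c * u i) = c * lin \<beta> u"
  by (erule AR_E) (simp add: lin_def aroot_def field_simps)

lemma lin_ap: 
  assumes "\<beta> \<in> AR" shows "lin (\<lambda>p. \<beta> (ap x p)) u = lin \<beta> (lp x u)"
proof -
  have "\<beta> (ap x u) = \<beta> (ap x 0 + lp x u)" by (simp flip: ap_add)
  then show ?thesis using assms by (simp add: AR_add) (simp add: lin_def)
qed

lemma AR_a0:
  assumes "\<beta> \<in> AR" shows "\<exists>m::int. m \<noteq> 0 \<and> \<beta> a0 = of_int m / of_int N"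
proof -
  obtain i j k where b: "\<beta> = aroot i j k" "i \<in> I" "j \<in> I" "i \<noteq> j" using AR_E assms(1) by metis
  obtain m where m: "m \<noteq> 0" "\<bar>m\<bar> < N" "a0 i - a0 j = of_int m / of_int N"
    using a0_diff b by blast
  have 1: "\<beta> a0 = of_int (m - k * N) / of_int N"
    using b m N_pos by (simp add: aroot_odd field_simps)
  have "m - k * N \<noteq> 0"
  proof
    assume "m - k * N = 0"
    then have "\<beta> a0 = 0" using 1 by simp
    then have "a0 i - a0 j = of_int k" using b by (simp add: aroot_odd)
    then show False using a0_inj b by blast
  qed
  then show ?thesis using 1 by blast
qed

lemma AR_a0_nz: "\<beta> \<in> AR \<Longrightarrow> \<beta> a0 \<noteq> 0"
  using AR_a0[of \<beta>] N_pos by auto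

lemma AR_apa0_nz: "\<beta> \<in> AR \<Longrightarrow> x \<in> carrier G \<Longrightarrow> \<beta> (ap x a0) \<noteq> 0"
  using AR_a0_nz[OF AR_ap] by blast

lemma AR_a0_ge: "\<beta> \<in> AR \<Longrightarrow> \<beta> a0 > 0 \<Longrightarrow> \<beta> a0 \<ge> 1 / of_int N"
proof -
  assume a: "\<beta> \<in> AR" "\<beta> a0 > 0"
  then obtain m :: int where m: "\<beta> a0 = of_int m / of_int N" using AR_a0 by blast
  then have "m > 0" using a(2) N_pos by (simp add: zero_less_divide_iff)
  then have "m \<ge> 1" by simp
  then show ?thesis using m N_pos by (simp add: divide_right_mono)
qed

text \<open>Each hyperplane separating \<open>a0\<close> from \<open>x a0\<close> appears once,
  through the affine root that vanishes on it and is positive at \<open>a0\<close>. So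
  \<open>len\<close> is the distance from the base alcove to its image.\<close>

definition Inv :: "aff \<Rightarrow> ((int \<Rightarrow> real) \<Rightarrow> real) set" where
  "Inv x = {\<beta> \<in> AR. \<beta> a0 > 0 \<and> \<beta> (ap x a0) < 0}"

definition len :: "aff \<Rightarrow> nat" where "len x = card (Inv x)"

lemma finite_Inv [simp]: assumes "x \<in> carrier G" shows "finite (Inv x)"
proof -
  let ?y = "ap x a0"
  \<comment> \<open>For fixed indices the constant is caught between the values of the coordinate
    difference at \<open>x a0\<close> and at \<open>a0\<close>.\<close>
  have "Inv x \<subseteq> (\<Union>(i,j)\<in>I\<times>I. aroot i j ` {\<lfloor>?y i - ?y j\<rfloor>..\<lceil>a0 i - a0 j\<rceil>})"
  proof
    fix \<beta> assume b: "\<beta> \<in> Inv x"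
    then obtain i j k where r: "\<beta> = aroot i j k" "i \<in> I" "j \<in> I" "i \<noteq> j"
      using AR_E unfolding Inv_def by blast
    have "a0 i - a0 j - of_int k > 0" "?y i - ?y j - of_int k < 0"
      using b r assms by (auto simp: Inv_def aroot_odd)
    then have "k \<in> {\<lfloor>?y i - ?y j\<rfloor>..\<lceil>a0 i - a0 j\<rceil>}"
      by (auto simp: floor_le_iff le_ceiling_iff)
    then show "\<beta> \<in> (\<Union>(i,j)\<in>I\<times>I. aroot i j ` {\<lfloor>?y i - ?y j\<rfloor>..\<lceil>a0 i - a0 j\<rceil>})"
      using r by blast
  qed
  moreover have "finite (\<Union>(i,j)\<in>I\<times>I. aroot i j ` {\<lfloor>?y i - ?y j\<rfloor>..\<lceil>a0 i - a0 j\<rceil>})"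
    by (intro finite_UN_I finite_cartesian_product) auto
  ultimately show ?thesis by (rule finite_subset)
qed

lemma comp_ap_inj: "x \<in> carrier G \<Longrightarrow> inj (\<lambda>\<beta> p. \<beta> (ap x p) :: real)"
  by (rule injI) (metis ap_inv' ext)

lemma card_comp_ap: "x \<in> carrier G \<Longrightarrow> card ((\<lambda>\<beta> p. \<beta> (ap x p) :: real) ` A) = card A"
  by (rule card_image) (rule inj_on_subset[OF comp_ap_inj], auto)

text \<open>A root separating \<open>a0\<close> from its image under the inverse becomes, after
  pullback along the inverse and negation, one separating \<open>a0\<close> from
  \<open>x a0\<close>.\<close>

lemma len_inv: assumes "x \<in> carrier G" shows "len (ginv x) = len x"
proof -
  have *: "len (ginv x) \<le> len x" if x: "x \<in> carrier G" for x
  proof -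
    have "(\<lambda>\<beta> p. - \<beta> (ap (ginv x) p)) ` Inv (ginv x) \<subseteq> Inv x"
      using x AR_uminus[OF AR_ap, of _ "ginv x"] by (auto simp: Inv_def fun_Compl_def)
    moreover have "inj (\<lambda>\<beta> p. - \<beta> (ap (ginv x) p) :: real)"
    proof (rule injI)
      fix \<beta> \<gamma> :: "(int \<Rightarrow> real) \<Rightarrow> real"
      assume "(\<lambda>p. - \<beta> (ap (ginv x) p)) = (\<lambda>p. - \<gamma> (ap (ginv x) p))"
      then have "- \<beta> (ap (ginv x) (ap x p)) = - \<gamma> (ap (ginv x) (ap x p))" for p by (rule fun_cong)
      then show "\<beta> = \<gamma>" using x by (intro ext) simp
    qed
    ultimately show ?thesis unfolding len_def
      using card_inj_on_le[OF inj_on_subset[OF _ subset_UNIV]] finite_Inv[OF x] by blast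
  qed
  from *[OF assms] *[of "ginv x"] assms show ?thesis by simp
qed

text \<open>A hyperplane between \<open>a0\<close> and \<open>x y a0\<close> lies between
  \<open>a0\<close> and \<open>x a0\<close> or between \<open>x a0\<close> and
  \<open>x y a0\<close>; the latter ones correspond under \<open>x\<close> to inversions of
  \<open>y\<close>.\<close>

lemma len_subadd:
  assumes x: "x \<in> carrier G" and y: "y \<in> carrier G"
  shows "len (x \<cdot> y) \<le> len x + len y"
proof -
  let ?i = "ginv x"
  have "Inv (x \<cdot> y) \<subseteq> Inv x \<union> (\<lambda>\<beta> p. \<beta> (ap ?i p)) ` Inv y"
  proof
    fix \<beta> assume b: "\<beta> \<in> Inv (x \<cdot> y)"
    then have b': "\<beta> \<in> AR" "\<beta> a0 > 0" "\<beta> (ap x (ap y a0)) < 0"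
      by (auto simp: Inv_def ap_mult x y)
    show "\<beta> \<in> Inv x \<union> (\<lambda>\<beta> p. \<beta> (ap ?i p)) ` Inv y"
    proof (cases "\<beta> (ap x a0) < 0")
      case True then show ?thesis using b' by (simp add: Inv_def)
    next
      case False
      then have A: "(\<lambda>p. \<beta> (ap x p)) \<in> Inv y"
        using b' AR_ap[OF b'(1) x] AR_apa0_nz[OF b'(1) x] by (simp add: Inv_def)
      have B: "\<beta> = (\<lambda>p. \<beta> (ap x (ap ?i p)))" using x by simp
      show ?thesis by (rule UnI2, rule image_eqI, rule B, rule A)
    qed
  qed
  then have "len (x \<cdot> y) \<le> card (Inv x \<union> (\<lambda>\<beta> p. \<beta> (ap ?i p)) ` Inv y)"
    unfolding len_def using x y by (intro card_mono) auto
  also have "\<dots> \<le> len x + len y"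
    unfolding len_def using card_Un_le[of "Inv x" "(\<lambda>\<beta> p. \<beta> (ap ?i p)) ` Inv y"] x
    by (simp add: card_comp_ap)
  finally show ?thesis .
qed

text \<open>No hyperplane is crossed, so \<open>x\<close> maps the base alcove to itself, possibly
  by a nontrivial symmetry.\<close>

lemma len_zero_sign:
  assumes "x \<in> carrier G" "len x = 0" "\<beta> \<in> AR"
  shows "\<beta> (ap x a0) > 0 \<longleftrightarrow> \<beta> a0 > 0"
proof -
  have e: "Inv x = {}" using assms by (simp add: len_def)
  have *: "\<beta> a0 > 0 \<Longrightarrow> \<beta> (ap x a0) > 0" if "\<beta> \<in> AR" for \<beta>
    using e that AR_apa0_nz[OF that assms(1)] by (force simp: Inv_def)
  have "\<beta> a0 < 0 \<Longrightarrow> \<beta> (ap x a0) < 0"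
    using *[OF AR_uminus[OF assms(3)]] by simp
  with *[OF assms(3)] AR_a0_nz[OF assms(3)]
  show ?thesis by (metis linorder_less_linear order_less_asym)
qed

lemma len_mult_zero:
  assumes "x \<in> carrier G" "y \<in> carrier G" "len y = 0"
  shows "len (x \<cdot> y) = len x"
proof -
  have "\<beta> (ap x (ap y a0)) < 0 \<longleftrightarrow> \<beta> (ap x a0) < 0" if "\<beta> \<in> AR" for \<beta>
    using len_zero_sign[OF assms(2,3) AR_ap[OF that assms(1)]] AR_a0_nz[OF AR_ap[OF that assms(1)]]
      AR_apa0_nz[OF AR_ap[OF that assms(1)] assms(2)] by linarith
  then have "Inv (x \<cdot> y) = Inv x"
    unfolding Inv_def ap_mult[OF assms(1,2)] by blast
  then show ?thesis by (simp add: len_def)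
qed

section \<open>Affine reflections and strong exchange\<close>

definition swp :: "int \<Rightarrow> int \<Rightarrow> int \<Rightarrow> int" where
  "swp i j l = (if l = i then j else if l = j then i else if l = - i then - j else if l = - j then - i else l)"

text \<open>This is \<open>k\<close> times the coroot of \<open>e_i - e_j\<close>. For
  \<open>j = - i\<close> the first two conditions coincide, so the result is \<open>k e_i\<close>,
  matching the coroot \<open>e_i\<close> of \<open>2 e_i\<close>.\<close>

definition arefl_vec :: "int \<Rightarrow> int \<Rightarrow> int \<Rightarrow> int \<Rightarrow> rat" where
  "arefl_vec i j k l = (if l = i \<or> l = - j then of_int k else if l = j \<or> l = - i then - of_int k else 0)"

definition arefl :: "int \<Rightarrow> int \<Rightarrow> int \<Rightarrow> aff" where
  "arefl i j k = (arefl_vec i j k, swp i j)"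

lemma swp_swp [simp]: "i \<noteq> 0 \<Longrightarrow> j \<noteq> 0 \<Longrightarrow> swp i j (swp i j l) = l"
  by (auto simp: swp_def)

lemma inv_swp [simp]: "i \<noteq> 0 \<Longrightarrow> j \<noteq> 0 \<Longrightarrow> inv_into UNIV (swp i j) = swp i j"
  by (rule inv_equality) auto

lemma swp_weyl: assumes "i \<in> I" "j \<in> I" "i \<noteq> j" shows "swp i j \<in> weyl T n"
proof -
  have J: "i \<in> J" "j \<in> J" using assms by auto
  then have nz: "i \<noteq> 0" "j \<noteq> 0" by auto
  have "swp i j permutes J"
    unfolding permutes_def
  proof (intro conjI allI impI)
    fix x assume "x \<notin> J" then show "swp i j x = x" using J uminus_J by (auto simp: swp_def)
  next
    fix y show "\<exists>!x. swp i j x = y" using nz by (metis swp_swp)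
  qed
  moreover have "swp i j (- l) = - swp i j l" for l
    using nz assms(3) unfolding swp_def by auto
  moreover have "is_A \<longrightarrow> (\<forall>l>0. swp i j l > 0)"
    using assms unfolding swp_def I_def by auto
  ultimately show ?thesis unfolding weyl_iff by blast
qed

lemma arefl_Wa: assumes "i \<in> I" "j \<in> I" "i \<noteq> j" shows "arefl i j k \<in> Wa"
proof -
  have J: "i \<in> J" "j \<in> J" using assms by auto
  then have nz: "i \<noteq> 0" "j \<noteq> 0" by auto
  have "arefl_vec i j k (- l) = - arefl_vec i j k l" for l
    using nz assms(3) by (auto simp: arefl_vec_def)
  moreover have "arefl_vec i j k l = 0" if "l \<notin> J" for l
    using J that uminus_J by (auto simp: arefl_vec_def)
  ultimately have "arefl_vec i j k \<in> int_vecs n"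
    unfolding int_vecs_iff vecs_iff by (auto simp: arefl_vec_def)
  moreover have "(\<Sum>l = 1..int n. arefl_vec i j k l) = 0" if is_A
  proof -
    have p: "i > 0" "j > 0" "i \<le> int n" "j \<le> int n" using that assms by (auto simp: I_def J_def)
    have "(\<Sum>l = 1..int n. arefl_vec i j k l)
       = (\<Sum>l = 1..int n. (if l = i then of_int k else 0) - (if l = j then of_int k else 0))"
      using p assms(3) by (intro sum.cong) (auto simp: arefl_vec_def)
    also have "\<dots> = 0" using p by (simp add: sum_subtractf)
    finally show ?thesis .
  qed
  ultimately have "arefl_vec i j k \<in> coroot_lattice T n" unfolding coroot_lattice_iff by blast
  then show ?thesis using swp_weyl[OF assms] by (simp add: arefl_def aff_weyl_def)
qed

lemma arefl_carrier [simp]: "i \<in> I \<Longrightarrow> j \<in> I \<Longrightarrow> i \<noteq> j \<Longrightarrow> arefl i j k \<in> carrier G"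
  using arefl_Wa by simp

lemma arefl_neg: assumes "i \<noteq> j" "i \<noteq> 0" "j \<noteq> 0" shows "arefl (- j) (- i) k = arefl i j k"
  unfolding arefl_def prod_eq_iff using assms by (auto simp: fun_eq_iff swp_def arefl_vec_def)

lemma arefl_swap: "i \<noteq> j \<Longrightarrow> i \<noteq> 0 \<Longrightarrow> j \<noteq> 0 \<Longrightarrow> arefl j i (- k) = arefl i j k"
  unfolding arefl_def prod_eq_iff by (auto simp: fun_eq_iff swp_def arefl_vec_def)

lemma ap_arefl:
  assumes "odd_fun p" "i \<noteq> j" "i \<noteq> 0" "j \<noteq> 0"
  shows "ap (arefl i j k) p l = (if l = i then p j + of_int k else if l = j then p i - of_int k
    else if l = - i then - (p j + of_int k) else if l = - j then - (p i - of_int k) else p l)"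
  using assms by (auto simp: ap_def arefl_def arefl_vec_def swp_def odd_fun_def of_rat_minus)

lemma ap_arefl_fix:
  assumes "odd_fun p" "i \<in> I" "j \<in> I" "i \<noteq> j" "aroot i j k p = 0" shows "ap (arefl i j k) p = p"
proof -
  have "i \<noteq> 0" "j \<noteq> 0" using assms by (auto dest: I_J)
  then show ?thesis using assms by (auto simp: ap_arefl aroot_odd fun_eq_iff odd_funD)
qed

lemma arefl_arefl: assumes "i \<in> I" "j \<in> I" "i \<noteq> j"
  shows "arefl i j k \<cdot> arefl i j k = \<one>\<^bsub>G\<^esub>"
proof (rule ap_faithful)
  fix p assume o: "odd_fun p"
  have nz: "i \<noteq> 0" "j \<noteq> 0" using assms by (auto dest: I_J)
  have o2: "odd_fun (ap (arefl i j k) p)" using o assms by simp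
  have "ap (arefl i j k) (ap (arefl i j k) p) = p"
    unfolding fun_eq_iff ap_arefl[OF o2 assms(3) nz] ap_arefl[OF o assms(3) nz]
    using o nz assms(3) by (auto simp: odd_funD)
  then show "ap (arefl i j k \<cdot> arefl i j k) p = ap \<one>\<^bsub>G\<^esub> p"
    using assms by (simp add: ap_mult)
qed (use assms in simp_all)

lemma inv_arefl: assumes "i \<in> I" "j \<in> I" "i \<noteq> j" shows "ginv (arefl i j k) = arefl i j k"
  using arefl_arefl[OF assms] assms by (simp add: G.inv_equality)

lemma arefl_cancel: assumes "i \<in> I" "j \<in> I" "i \<noteq> j" "x \<in> carrier G"
  shows "arefl i j k \<cdot> (arefl i j k \<cdot> x) = x"
  using assms by (simp add: arefl_arefl flip: G.m_assoc)

lemma arefl_cancel': assumes "i \<in> I" "j \<in> I" "i \<noteq> j" "x \<in> carrier G"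
  shows "x \<cdot> arefl i j k \<cdot> arefl i j k = x"
  using assms by (simp add: arefl_arefl G.m_assoc)

lemma aroot_ap_arefl:
  assumes "odd_fun p" "i \<in> I" "j \<in> I" "i \<noteq> j"
  shows "aroot i j k (ap (arefl i j k) p) = - aroot i j k p"
proof -
  have nz: "i \<noteq> 0" "j \<noteq> 0" using assms by (auto dest: I_J)
  show ?thesis using assms nz by (auto simp: aroot_odd ap_arefl)
qed

lemma arefl_aroot_cong:
  assumes "aroot i j k = aroot i' j' k'" "i \<in> I" "j \<in> I" "i \<noteq> j" "i' \<in> I" "j' \<in> I" "i' \<noteq> j'"
  shows "arefl i j k = arefl i' j' k'"
proof -
  have nz: "i \<noteq> 0" "j \<noteq> 0" using assms by (auto dest: I_J)
  have "k = k' \<and> (i' = i \<and> j' = j \<or> i' = - j \<and> j' = - i)"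
    by (rule aroot_eq_D[OF assms(1,4,7)]) (use assms in auto)
  then show ?thesis using arefl_neg[OF assms(4) nz] by auto
qed

text \<open>The conjugate of a reflection is the reflection in the transformed root. The last
  conclusion describes that root by its pullback, from which its sign at \<open>a0\<close> and at
  images of \<open>a0\<close> is computed.\<close>

lemma arefl_conj:
  assumes x: "x \<in> carrier G" and ij: "i \<in> I" "j \<in> I" "i \<noteq> j"
  obtains k' where "snd x i \<in> I" "snd x j \<in> I" "snd x i \<noteq> snd x j"
    "x \<cdot> arefl i j k = arefl (snd x i) (snd x j) k' \<cdot> x"
    "\<And>p. aroot (snd x i) (snd x j) k' (ap x p) = aroot i j k p"
proof -
  let ?i = "snd x i" and ?j = "snd x j"
  have w: "snd x \<in> weyl T n" using x by simp
  have I': "?i \<in> I" "?j \<in> I" using w ij by simp_all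
  have ne: "?i \<noteq> ?j" using w ij(3) by (metis weyl_inv_f)
  have J: "?i \<in> J" "?j \<in> J" using I' by auto
  obtain c where c: "real_of_rat (fst x ?i) - real_of_rat (fst x ?j) = of_int c"
    "\<And>k p. aroot ?i ?j k (ap x p) = aroot (inv_into UNIV (snd x) ?i) (inv_into UNIV (snd x) ?j) (k - c) p"
    using aroot_ap[OF x J] by blast
  let ?k = "k + c"
  have 2: "aroot ?i ?j ?k (ap x p) = aroot i j k p" for p
    using c(2)[of ?k p] w by simp
  have "x \<cdot> arefl i j k = arefl ?i ?j ?k \<cdot> x"
  proof (rule ap_faithful)
    fix p assume o: "odd_fun p"
    have nz: "i \<noteq> 0" "j \<noteq> 0" "?i \<noteq> 0" "?j \<noteq> 0" using ij I' by (auto dest: I_J)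
    have "ap x (ap (arefl i j k) p) l = ap (arefl ?i ?j ?k) (ap x p) l" for l
    proof -
      obtain m where l: "l = snd x m" using w by (metis weyl_f_inv)
      have e: "snd x m = snd x m' \<longleftrightarrow> m = m'" for m m' using w by (metis weyl_inv_f)
      have e2: "snd x m = - snd x m' \<longleftrightarrow> m = - m'" for m m' using w e weyl_odd by metis
      have apx: "ap x q (snd x m) = of_rat (fst x (snd x m)) + q m" for q m
        using w by (simp add: ap_def)
      have m1: "m = - i \<Longrightarrow> snd x m = - snd x i" "m = - j \<Longrightarrow> snd x m = - snd x j"
        using w weyl_odd by auto
      show ?thesis unfolding l
        using o x c(1) nz ij(3) ne trans_lattice_odd[of "fst x"]
        by (auto simp: ap_arefl apx e e2 weyl_odd of_rat_minus algebra_simps m1)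
    qed
    then show "ap (x \<cdot> arefl i j k) p = ap (arefl ?i ?j ?k \<cdot> x) p"
      using x ij I' ne by (simp add: ap_mult fun_eq_iff)
  qed (use x ij I' ne in simp_all)
  then show thesis using that I' ne 2 by blast
qed

section \<open>Simple affine roots\<close>

definition simple :: "int \<Rightarrow> int \<Rightarrow> int \<Rightarrow> bool" where
  "simple i j k \<longleftrightarrow> i \<in> I \<and> j \<in> I \<and> i \<noteq> j \<and> aroot i j k a0 = 1 / of_int N"

lemma simple_I: "simple i j k \<Longrightarrow> i \<in> I" "simple i j k \<Longrightarrow> j \<in> I" "simple i j k \<Longrightarrow> i \<noteq> j"
  by (auto simp: simple_def)

lemma simple_AR: "simple i j k \<Longrightarrow> aroot i j k \<in> AR"
  using aroot_AR simple_I by blast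

lemma simple_pos: "simple i j k \<Longrightarrow> aroot i j k a0 > 0"
  using N_pos by (simp add: simple_def)

lemma simple_carrier [simp]: "simple i j k \<Longrightarrow> arefl i j k \<in> carrier G"
  by (simp add: simple_def)

text \<open>Reflection in a root of value \<open>1/N\<close> moves each coordinate of
  \<open>a0\<close> by at most \<open>1/N\<close>, so another affine root changes by at most
  \<open>2/N\<close>. An inverted one goes from at least \<open>1/N\<close> to at most
  \<open>-1/N\<close>, so it changes by exactly that much; this confines its indices to the moved
  ones, and regularity of \<open>a0\<close> does the rest.\<close>

lemma Inv_simple: assumes s: "simple i j k" shows "Inv (arefl i j k) = {aroot i j k}"
proof
  note I = simple_I[OF s]
  have nz: "i \<noteq> 0" "j \<noteq> 0" using I by (auto dest: I_J)
  show "{aroot i j k} \<subseteq> Inv (arefl i j k)"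
    using s I simple_AR simple_pos[OF s] by (auto simp: Inv_def aroot_ap_arefl)
  show "Inv (arefl i j k) \<subseteq> {aroot i j k}"
  proof
    fix \<beta> assume b: "\<beta> \<in> Inv (arefl i j k)"
    then obtain a b c where r: "\<beta> = aroot a b c" "a \<in> I" "b \<in> I" "a \<noteq> b"
      using AR_E unfolding Inv_def by blast
    define e where "e = 1 / real_of_int N"
    have e0: "e > 0" using N_pos by (simp add: e_def)
    have bAR: "\<beta> \<in> AR" "\<beta> a0 > 0" "\<beta> (ap (arefl i j k) a0) < 0" using b by (auto simp: Inv_def)
    have b1: "\<beta> a0 \<ge> e" using AR_a0_ge bAR by (simp add: e_def)
    have "(- \<beta> \<circ> ap (arefl i j k)) \<in> AR" using AR_ap[OF AR_uminus[OF bAR(1)]] I by (simp add: comp_def)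
    then have b2: "\<beta> (ap (arefl i j k) a0) \<le> - e"
      using AR_a0_ge[of "- \<beta> \<circ> ap (arefl i j k)"] bAR(3) by (simp add: e_def)
    define d where "d l = ap (arefl i j k) a0 l - a0 l" for l
    have se: "a0 i - a0 j - of_int k = e" using s by (simp add: simple_def aroot_odd e_def)
    have d: "d l = (if l = i \<or> l = - j then - e else if l = j \<or> l = - i then e else 0)" for l
      using se nz I(3) unfolding d_def by (auto simp: ap_arefl odd_funD)
    have db: "\<beta> (ap (arefl i j k) a0) = \<beta> a0 + d a - d b"
      using r I by (simp add: aroot_odd d_def)
    have "d a - d b \<le> - 2 * e" using db b1 b2 by linarith
    then have da: "a = i \<or> a = - j" and dbb: "b = j \<or> b = - i"
      using e0 I(3) nz unfolding d by (auto split: if_splits)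
    have "\<beta> a0 = e" using db b1 b2 da dbb e0 unfolding d by (auto split: if_splits)
    then have be: "a0 a - a0 b - of_int c = e" using r by (simp add: aroot_odd)
    show "\<beta> \<in> {aroot i j k}"
    proof (cases "a = i")
      case True
      have "a0 b - a0 j = of_int (k - c)" using be se True by simp
      then have bj: "b = j" using a0_inj r I by blast
      have "real_of_int c = of_int k" using be se unfolding True bj by linarith
      then show ?thesis using True bj r by simp
    next
      case False
      then have a: "a = - j" using da by simp
      then have nA: "\<not> is_A" using r I by (auto simp: I_def)
      have "- i \<in> I" using I nA by (auto simp: I_def)
      moreover have "a0 b - a0 (- i) = of_int (k - c)" using be se a by (simp add: odd_funD)
      ultimately have "b = - i" using a0_inj r by blast
      moreover have "real_of_int c = of_int k" using be se a calculation by (simp add: odd_funD)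
      ultimately show ?thesis using a r by (simp add: aroot_swap)
    qed
  qed
qed

lemma simple_ap_pos:
  assumes "simple i j k" "\<beta> \<in> AR" "\<beta> a0 > 0" "\<beta> \<noteq> aroot i j k"
  shows "\<beta> (ap (arefl i j k) a0) > 0"
  using Inv_simple[OF assms(1)] assms AR_apa0_nz[OF assms(2) simple_carrier[OF assms(1)]]
  by (force simp: Inv_def)

text \<open>Apart from its own root, which is gained, a simple reflection permutes the roots
  positive at \<open>a0\<close>, so the other inversions are pullbacks of those of
  \<open>x\<close>.\<close>

lemma len_arefl_up:
  assumes x: "x \<in> carrier G" and s: "simple i j k" and p: "aroot i j k (ap x a0) > 0"
  shows "len (arefl i j k \<cdot> x) = Suc (len x)"
proof -
  let ?s = "arefl i j k" and ?b = "aroot i j k"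
  note I = simple_I[OF s]
  have sc: "?s \<in> carrier G" using s by simp
  have ss: "ap ?s (ap ?s q) = q" for q
    using arefl_arefl[OF I, of k] ap_mult[OF sc sc, of q] by simp
  let ?f = "\<lambda>\<beta> p. \<beta> (ap ?s p) :: real"
  have "Inv (?s \<cdot> x) = insert ?b (?f ` Inv x)"
  proof (intro equalityI subsetI)
    fix \<beta> assume "\<beta> \<in> Inv (?s \<cdot> x)"
    then have b: "\<beta> \<in> AR" "\<beta> a0 > 0" "\<beta> (ap ?s (ap x a0)) < 0"
      using ap_mult[OF sc x] by (auto simp: Inv_def)
    show "\<beta> \<in> insert ?b (?f ` Inv x)"
    proof (cases "\<beta> = ?b")
      case False
      have A: "?f \<beta> \<in> Inv x"
        using b AR_ap[OF b(1) sc] simple_ap_pos[OF s b(1,2) False] by (simp add: Inv_def)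
      have B: "\<beta> = ?f (?f \<beta>)" using ss by simp
      have "\<beta> \<in> ?f ` Inv x" by (rule image_eqI, rule B, rule A)
      then show ?thesis by blast
    qed simp
  next
    fix \<beta> assume "\<beta> \<in> insert ?b (?f ` Inv x)"
    then consider "\<beta> = ?b" | \<gamma> where "\<gamma> \<in> Inv x" "\<beta> = ?f \<gamma>" by blast
    then show "\<beta> \<in> Inv (?s \<cdot> x)"
    proof cases
      case 1
      then show ?thesis using s simple_AR simple_pos p x I ap_mult[OF sc x]
        by (simp add: Inv_def aroot_ap_arefl)
    next
      case 2
      then have g: "\<gamma> \<in> AR" "\<gamma> a0 > 0" "\<gamma> (ap x a0) < 0" "\<gamma> \<noteq> ?b"
        using p by (auto simp: Inv_def)
      show ?thesis using AR_ap[OF g(1) sc] simple_ap_pos[OF s g(1,2,4)] g ap_mult[OF sc x] ss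
        unfolding 2 Inv_def by simp
    qed
  qed
  moreover have "?b \<notin> ?f ` Inv x"
  proof
    assume "?b \<in> ?f ` Inv x"
    then obtain \<gamma> where g: "\<gamma> \<in> Inv x" "?b = ?f \<gamma>" by blast
    have "\<gamma> a0 = ?b (ap ?s a0)" using g(2) ss by simp
    then show False using g(1) simple_pos[OF s] I by (simp add: Inv_def aroot_ap_arefl)
  qed
  ultimately show ?thesis unfolding len_def using x sc by (simp add: card_comp_ap)
qed

lemma len_arefl_down:
  assumes x: "x \<in> carrier G" and s: "simple i j k" and p: "aroot i j k (ap x a0) < 0"
  shows "Suc (len (arefl i j k \<cdot> x)) = len x"
proof -
  let ?s = "arefl i j k"
  note I = simple_I[OF s]
  have "len (?s \<cdot> (?s \<cdot> x)) = Suc (len (?s \<cdot> x))"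
    using x s p I by (intro len_arefl_up) (simp_all add: ap_mult aroot_ap_arefl)
  then show ?thesis using arefl_cancel[OF I x] by simp
qed

lemma len_simple: "simple i j k \<Longrightarrow> len (arefl i j k) = 1"
  by (simp add: len_def Inv_simple)

text \<open>Modulo 1 the coordinates of \<open>a0\<close> form a circle with spacing
  \<open>1/N\<close>. The index \<open>j\<close> is the neighbour below \<open>i\<close>; the lowest
  coordinate wraps round to index 1 with \<open>k = -1\<close>. For a single coordinate (type A,
  \<open>n = 1\<close>) this gives \<open>j = i\<close>.\<close>

lemma a0_pred: assumes "i \<in> I" shows "\<exists>j k. j \<in> I \<and> a0 i - a0 j - of_int k = 1 / of_int N"
proof -
  consider "i > 0" "i < int n" | "is_A" "i = int n" | "\<not> is_A" "i = int n"
    | "\<not> is_A" "i < -1" | "\<not> is_A" "i = -1"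
    using assms by (fastforce simp: I_def J_def)
  then show ?thesis
  proof cases
    case 1
    then have "i + 1 \<in> I" using assms by (auto simp: I_def J_def)
    moreover have "a0 i - a0 (i + 1) - of_int 0 = 1 / of_int N"
      using 1 assms calculation N_pos by (auto simp: a0_def field_simps dest: I_J)
    ultimately show ?thesis by blast
  next
    case 2
    then have "1 \<in> I" using n_pos by (auto simp: I_def J_def)
    moreover have "a0 i - a0 1 - of_int (-1) = 1 / of_int N"
      using 2 assms calculation N_pos n_pos by (auto simp: a0_def N_def field_simps dest: I_J)
    ultimately show ?thesis by blast
  next
    case 3
    then have "- i \<in> I" using n_pos by (auto simp: I_def J_def)
    moreover have "a0 i - a0 (- i) - of_int 0 = 1 / of_int N"
      using 3 assms calculation N_pos n_pos by (auto simp: a0_def N_def field_simps dest: I_J)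
    ultimately show ?thesis by blast
  next
    case 4
    then have "i + 1 \<in> I" using assms by (auto simp: I_def J_def)
    moreover have "a0 i - a0 (i + 1) - of_int 0 = 1 / of_int N"
      using 4 assms calculation N_pos by (auto simp: a0_def field_simps dest: I_J)
    ultimately show ?thesis by blast
  next
    case 5
    then have "1 \<in> I" using n_pos by (auto simp: I_def J_def)
    moreover have "a0 i - a0 1 - of_int (-1) = 1 / of_int N"
      using 5 assms calculation N_pos n_pos by (auto simp: a0_def N_def field_simps dest: I_J)
    ultimately show ?thesis by blast
  qed
qed

text \<open>A root of value \<open>m / N\<close> at \<open>a0\<close> is a sum of \<open>m\<close>
  simple affine roots, found by walking down the circle of \<open>a0_pred\<close>, and each
  contributes at least \<open>e\<close>. Type A with \<open>n = 1\<close> is excluded because there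
  the walk stays at one index, which names no root. The bound \<open>e = 0\<close> describes the
  closed alcove, and \<open>e = 1 / N\<close> serves for elements of length zero.\<close>

lemma simple_pos_imp:
  assumes o: "odd_fun y" and nn: "\<And>i j k. simple i j k \<Longrightarrow> aroot i j k y \<ge> e"
    and n1: "is_A \<Longrightarrow> n \<noteq> 1"
  shows "i \<in> I \<Longrightarrow> j \<in> I \<Longrightarrow> a0 i - a0 j - of_int k = of_nat m / of_int N \<Longrightarrow> y i - y j - of_int k \<ge> of_nat m * e"
proof (induction m arbitrary: i k)
  case 0
  then have "a0 i - a0 j = of_int k" by simp
  then have "i = j" using a0_inj 0 by blast
  then show ?case using 0 by simp
next
  case (Suc m)
  obtain c k' where c: "c \<in> I" "a0 i - a0 c - of_int k' = 1 / of_int N"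
    using a0_pred Suc.prems by blast
  have ic: "i \<noteq> c"
  proof
    assume "i = c"
    then have "- real_of_int k' * of_int N = 1" using c N_pos by (simp add: field_simps)
    then have "- k' * N = 1" by (metis of_int_1 of_int_eq_iff of_int_minus of_int_mult)
    then have "N = 1" using N_pos by (metis zmult_eq_1_iff less_numeral_extra(3) neg_equal_0_iff_equal not_numeral_less_zero zero_less_one  linorder_not_less  order_less_imp_le neg_0_less_iff_less)
    then show False using n1 n_pos by (auto simp: N_def split: if_splits) presburger
  qed
  have s: "simple i c k'" using c ic Suc.prems by (simp add: simple_def aroot_odd)
  have "a0 c - a0 j - of_int (k - k') = of_nat m / of_int N"
    using c Suc.prems(3) by (simp add: add_divide_distrib)
  then have "y c - y j - of_int (k - k') \<ge> of_nat m * e" using Suc.IH c Suc.prems by blast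
  moreover have "y i - y c - of_int k' \<ge> e" using nn[OF s] o by (simp add: aroot_odd)
  ultimately show ?case by (simp add: algebra_simps)
qed

lemma AR_nonneg:
  assumes o: "odd_fun y" and nn: "\<And>i j k. simple i j k \<Longrightarrow> aroot i j k y \<ge> 0"
    and b: "\<beta> \<in> AR" "\<beta> a0 > 0"
  shows "\<beta> y \<ge> 0"
proof -
  obtain i j k where r: "\<beta> = aroot i j k" "i \<in> I" "j \<in> I" "i \<noteq> j" using AR_E b by metis
  have n1: "n \<noteq> 1" if "is_A"
  proof
    assume "n = 1"
    then have "i = 1" "j = 1" using r(2,3) that unfolding I_def J_def by (simp; linarith)+
    then show False using r(4) by simp
  qed
  obtain m :: int where m: "\<beta> a0 = of_int m / of_int N" using AR_a0 b by blast
  then have "m > 0" using b N_pos by (simp add: zero_less_divide_iff)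
  then have "\<beta> a0 = of_nat (nat m) / of_int N" using m by simp
  then have "a0 i - a0 j - of_int k = of_nat (nat m) / of_int N" using r by (simp add: aroot_odd)
  then have "y i - y j - of_int k \<ge> 0" using simple_pos_imp[OF o nn n1, of i j k "nat m"] r by simp
  then show ?thesis using r o by (simp add: aroot_odd)
qed

section \<open>Descents and strong exchange\<close>

lemma simple_descent:
  assumes x: "x \<in> carrier G" and "len x > 0"
  obtains i j k where "simple i j k" "aroot i j k (ap x a0) < 0"
proof (rule ccontr)
  assume "\<not> thesis"
  then have nn: "aroot i j k (ap x a0) \<ge> 0" if "simple i j k" for i j k
    using that \<open>\<And>k j i. \<lbrakk>simple i j k; aroot i j k (ap x a0) < 0\<rbrakk> \<Longrightarrow> thesis\<close> by force
  have "Inv x \<noteq> {}" using assms(2) by (auto simp: len_def)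
  then obtain \<beta> where "\<beta> \<in> AR" "\<beta> a0 > 0" "\<beta> (ap x a0) < 0" by (auto simp: Inv_def)
  moreover have "\<beta> (ap x a0) \<ge> 0" using AR_nonneg[OF _ nn] calculation x by simp
  ultimately show False by simp
qed

text \<open>Conjugating by a simple descent of \<open>x\<close> shortens \<open>x\<close> and keeps
  the root positive at \<open>a0\<close>, unless the root is that simple root. The same induction
  shows that the reflection is conjugate to a simple one; every reflection is reached by taking
  \<open>x\<close> to be the reflection itself.\<close>

lemma strong_exchange:
  assumes "x \<in> carrier G" "i \<in> I" "j \<in> I" "i \<noteq> j" "aroot i j k a0 > 0" "aroot i j k (ap x a0) < 0"
  shows "len (arefl i j k \<cdot> x) < len x \<and>
    (\<exists>g a b c. g \<in> Wa \<and> simple a b c \<and> arefl i j k = g \<cdot> arefl a b c \<cdot> ginv g)"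
  using assms
proof (induction "len x" arbitrary: x i j k rule: less_induct)
  case less
  note x = less.prems(1) and ij = less.prems(2-4)
  have "aroot i j k \<in> Inv x" using less.prems aroot_AR by (simp add: Inv_def)
  then have "len x > 0" using x by (auto simp: len_def card_gt_0_iff)
  then obtain a b c where s: "simple a b c" "aroot a b c (ap x a0) < 0"
    using simple_descent x by metis
  let ?s = "arefl a b c"
  note I = simple_I[OF s(1)]
  have sW: "?s \<in> Wa" using arefl_Wa I by blast
  have sc: "?s \<in> carrier G" using sW by simp
  have down: "Suc (len (?s \<cdot> x)) = len x" by (rule len_arefl_down[OF x s])
  show ?case
  proof (cases "aroot i j k = aroot a b c")
    case True
    then have e: "arefl i j k = ?s" using arefl_aroot_cong ij I by blast
    have "?s = \<one>\<^bsub>G\<^esub> \<cdot> ?s \<cdot> ginv \<one>\<^bsub>G\<^esub>" using sc by simp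
    then show ?thesis using down e s(1) Wa_one by fastforce
  next
    case False
    obtain k' where k': "snd ?s i \<in> I" "snd ?s j \<in> I" "snd ?s i \<noteq> snd ?s j"
      "?s \<cdot> arefl i j k = arefl (snd ?s i) (snd ?s j) k' \<cdot> ?s"
      "\<And>p. aroot (snd ?s i) (snd ?s j) k' (ap ?s p) = aroot i j k p"
      using arefl_conj[OF sc ij] by metis
    let ?r = "arefl (snd ?s i) (snd ?s j) k'" and ?x = "?s \<cdot> x"
    have rc: "?r \<in> carrier G" "arefl i j k \<in> carrier G" using k' ij by simp_all
    have "aroot (snd ?s i) (snd ?s j) k' a0 = aroot i j k (ap ?s a0)"
      using k'(5)[of "ap ?s a0"] sc arefl_arefl[OF I] by (simp flip: ap_mult)
    then have 1: "aroot (snd ?s i) (snd ?s j) k' a0 > 0"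
      using simple_ap_pos[OF s(1) aroot_AR[OF ij] less.prems(5) False] by simp
    have 2: "aroot (snd ?s i) (snd ?s j) k' (ap ?x a0) < 0"
      using k'(5)[of "ap x a0"] less.prems(6) sc x by (simp add: ap_mult)
    have IH: "len (?r \<cdot> ?x) < len ?x"
      "\<exists>g a b c. g \<in> Wa \<and> simple a b c \<and> ?r = g \<cdot> arefl a b c \<cdot> ginv g"
      using less.hyps[of ?x, OF _ _ k'(1-3) 1 2] down x sc by auto
    have e: "arefl i j k = ?s \<cdot> ?r \<cdot> ?s"
      using arg_cong[OF k'(4), of "\<lambda>y. ?s \<cdot> y"] arefl_cancel[OF I rc(2)] sc rc by (simp add: G.m_assoc)
    then have "arefl i j k \<cdot> x = ?s \<cdot> (?r \<cdot> ?x)"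
      using sc rc x by (simp add: G.m_assoc)
    then have "len (arefl i j k \<cdot> x) \<le> 1 + len (?r \<cdot> ?x)"
      using len_subadd[of ?s "?r \<cdot> ?x"] len_simple[OF s(1)] sc rc x by simp
    moreover obtain g a' b' c' where g: "g \<in> Wa" "simple a' b' c'"
      "?r = g \<cdot> arefl a' b' c' \<cdot> ginv g" using IH(2) by blast
    have "arefl i j k = (?s \<cdot> g) \<cdot> arefl a' b' c' \<cdot> ginv (?s \<cdot> g)"
      unfolding e g(3) using sc g(1,2) inv_arefl[OF I] by (simp add: G.m_assoc G.inv_mult_group)
    then have "\<exists>g a b c. g \<in> Wa \<and> simple a b c \<and> arefl i j k = g \<cdot> arefl a b c \<cdot> ginv g"
      using Wa_mult[OF sW g(1)] g(2) by blast
    ultimately show ?thesis using IH(1) down by (intro conjI, linarith, blast)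
  qed
qed

lemma arefl_conj_simple:
  assumes ij: "i \<in> I" "j \<in> I" "i \<noteq> j"
  shows "\<exists>g a b c. g \<in> Wa \<and> simple a b c \<and> arefl i j k = g \<cdot> arefl a b c \<cdot> ginv g"
proof -
  have nz: "i \<noteq> 0" "j \<noteq> 0" using ij by (auto dest: I_J)
  show ?thesis
  proof (cases "aroot i j k a0 > 0")
    case True
    then show ?thesis using strong_exchange[of "arefl i j k" i j k] ij by (simp add: aroot_ap_arefl)
  next
    case False
    then have "aroot j i (- k) a0 > 0"
      using AR_a0_nz[OF aroot_AR[OF ij]] by (simp add: aroot_minus) (metis less_eq_real_def not_less)
    moreover have "aroot j i (- k) (ap (arefl i j k) a0) = - aroot j i (- k) a0"
      using aroot_ap_arefl[of a0 j i "- k"] ij arefl_swap[OF ij(3) nz] by simp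
    ultimately show ?thesis
      using strong_exchange[of "arefl i j k" j i "- k"] ij arefl_swap[OF ij(3) nz] by simp
  qed
qed

text \<open>Strong exchange is applied to \<open>x\<close> for one implication and to the reflected
  element for the other.\<close>

lemma len_arefl_gt:
  assumes x: "x \<in> carrier G" and ij: "i \<in> I" "j \<in> I" "i \<noteq> j" and "aroot i j k a0 > 0"
  shows "len x < len (arefl i j k \<cdot> x) \<longleftrightarrow> aroot i j k (ap x a0) > 0"
proof
  assume a: "len x < len (arefl i j k \<cdot> x)"
  show "aroot i j k (ap x a0) > 0"
  proof (rule ccontr)
    assume "\<not> aroot i j k (ap x a0) > 0"
    then have "aroot i j k (ap x a0) < 0" using AR_apa0_nz[OF aroot_AR[OF ij] x, of k] by linarith
    then show False using strong_exchange[OF x ij assms(5)] a by simp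
  qed
next
  assume p: "aroot i j k (ap x a0) > 0"
  have "len (arefl i j k \<cdot> (arefl i j k \<cdot> x)) < len (arefl i j k \<cdot> x)"
    using strong_exchange[of "arefl i j k \<cdot> x" i j k] x ij assms(5) p
    by (simp add: ap_mult aroot_ap_arefl)
  then show "len x < len (arefl i j k \<cdot> x)" using arefl_cancel[OF ij x] by simp
qed

lemma arefl_pos_rep:
  assumes ij: "i \<in> I" "j \<in> I" "i \<noteq> j"
  obtains i' j' k' where "i' \<in> I" "j' \<in> I" "i' \<noteq> j'" "arefl i' j' k' = arefl i j k"
    "aroot i' j' k' a0 > 0" "aroot i' j' k' = aroot i j k \<or> aroot i' j' k' = - aroot i j k"
proof -
  have nz: "i \<noteq> 0" "j \<noteq> 0" using ij by (auto dest: I_J)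
  show thesis
  proof (cases "aroot i j k a0 > 0")
    case True then show ?thesis using that ij by blast
  next
    case False
    then have "aroot j i (- k) a0 > 0"
      using AR_a0_nz[OF aroot_AR[OF ij]] by (simp add: aroot_minus) (metis less_eq_real_def not_less)
    then show ?thesis using that[of j i "-k"] ij arefl_swap[OF ij(3) nz] aroot_minus by metis
  qed
qed

section \<open>The length formula counts inversions\<close>

abbreviation uv :: "int \<Rightarrow> int \<Rightarrow> vec" where "uv i j \<equiv> unit_vec i - unit_vec j"

lemma unit_vec_uminus: "i \<noteq> 0 \<Longrightarrow> unit_vec (- i) = - unit_vec i"
  by (auto simp: unit_vec_def fun_eq_iff)

lemma unit_vec_vecs: "i \<in> J \<Longrightarrow> unit_vec i \<in> vecs n"
proof -
  assume i: "i \<in> J"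
  then have "i \<noteq> 0" by auto
  then show ?thesis using i unfolding vecs_iff unit_vec_def by auto
qed

lemma unit_vec_inj: "unit_vec i = unit_vec j \<Longrightarrow> i \<noteq> 0 \<Longrightarrow> i = j"
  by (drule fun_cong[of _ _ i]) (auto simp: unit_vec_def split: if_splits)

lemma act_unit_vec: assumes "\<sigma> \<in> weyl T n" shows "act \<sigma> (unit_vec i) = unit_vec (\<sigma> i)"
proof -
  have "inv_into UNIV \<sigma> l = m \<longleftrightarrow> l = \<sigma> m" for l m using assms by (metis weyl_f_inv weyl_inv_f)
  then show ?thesis using assms by (auto simp: act_def unit_vec_def fun_eq_iff weyl_odd)
qed

lemma act_uv: "\<sigma> \<in> weyl T n \<Longrightarrow> act \<sigma> (uv i j) = uv (\<sigma> i) (\<sigma> j)"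
  by (simp add: act_diff act_unit_vec)

lemma a0_less:
  assumes "i \<in> J" "j \<in> J" "\<not> is_A"
  shows "a0 j < a0 i \<longleftrightarrow> (i > 0 \<and> j < 0) \<or> (i > 0 \<and> j > 0 \<and> i < j) \<or> (i < 0 \<and> j < 0 \<and> i < j)"
proof -
  have N: "N = 2 * int n" using assms(3) by (simp add: N_def)
  define h where "h l = (if l > 0 then - l else - l - N - 1)" for l :: int
  have "a0 j < a0 i \<longleftrightarrow> real_of_int (h j) < real_of_int (h i)"
    using assms N_pos unfolding a0_def h_def by (auto simp: divide_simps)
  then have "a0 j < a0 i \<longleftrightarrow> h j < h i" by simp
  then show ?thesis using assms unfolding h_def N J_def by auto
qed

text \<open>In type C, \<open>2 e_i = e_i - e_(-i)\<close> and
  \<open>e_i + e_j = e_i - e_(-j)\<close>, and the coordinates of \<open>a0\<close> decrease along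
  \<open>1, ..., n, -n, ..., -1\<close>. So positivity at \<open>a0\<close> selects exactly the
  listed positive roots.\<close>

lemma pos_roots_eq: "pos_roots T n = {uv i j | i j. i \<in> I \<and> j \<in> I \<and> a0 j < a0 i}"
proof (cases is_A)
  case True
  have lt: "a0 j < a0 i \<longleftrightarrow> i < j" if "i \<in> I" "j \<in> I" for i j
    using that N_pos True unfolding a0_def I_def by (auto simp: divide_simps)
  have "pos_roots T n = {uv i j | i j. 1 \<le> i \<and> i < j \<and> j \<le> int n}"
    using True unfolding is_A_def by simp
  also have "\<dots> = {uv i j | i j. i \<in> I \<and> j \<in> I \<and> i < j}"
  proof -
    have "1 \<le> i \<and> i < j \<and> j \<le> int n \<longleftrightarrow> i \<in> I \<and> j \<in> I \<and> i < j" for i j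
      using True unfolding I_def J_def by auto
    then show ?thesis by simp
  qed
  also have "\<dots> = {uv i j | i j. i \<in> I \<and> j \<in> I \<and> a0 j < a0 i}" using lt by blast
  finally show ?thesis .
next
  case False
  have IJ: "I = J" using False by (auto simp: I_def)
  have lt: "a0 j < a0 i \<longleftrightarrow> (i > 0 \<and> j < 0) \<or> (i > 0 \<and> j > 0 \<and> i < j) \<or> (i < 0 \<and> j < 0 \<and> i < j)"
    if "i \<in> J" "j \<in> J" for i j
    using a0_less[OF that False] .
  have P: "pos_roots T n = {Defs.scale 2 (unit_vec i) | i. 1 \<le> i \<and> i \<le> int n}
     \<union> {unit_vec i + unit_vec j | i j. 1 \<le> i \<and> i < j \<and> j \<le> int n}
     \<union> {unit_vec i - unit_vec j | i j. 1 \<le> i \<and> i < j \<and> j \<le> int n}"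
  proof -
    have "T = TypeC" using False unfolding is_A_def by (cases T) simp_all
    then show ?thesis by simp
  qed
  have two: "Defs.scale 2 (unit_vec i) = uv i (- i)" if "i \<noteq> 0" for i
    using that by (simp add: unit_vec_uminus) (simp add: Defs.scale_def fun_eq_iff)
  have pl: "unit_vec i + unit_vec j = uv i (- j)" if "j \<noteq> 0" for i j
    using that by (simp add: unit_vec_uminus)
  have mi: "uv (- j) (- i) = uv i j" if "j \<noteq> 0" "i \<noteq> 0" for i j
    using that by (simp add: unit_vec_uminus)
  show ?thesis
  proof (intro equalityI subsetI)
    fix \<alpha> assume "\<alpha> \<in> pos_roots T n"
    then consider i where "1 \<le> i" "i \<le> int n" "\<alpha> = Defs.scale 2 (unit_vec i)"
      | i j where "1 \<le> i" "i < j" "j \<le> int n" "\<alpha> = unit_vec i + unit_vec j"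
      | i j where "1 \<le> i" "i < j" "j \<le> int n" "\<alpha> = uv i j"
      unfolding P by blast
    then show "\<alpha> \<in> {uv i j | i j. i \<in> I \<and> j \<in> I \<and> a0 j < a0 i}"
    proof cases
      case (1 i) then have i: "i \<in> J" "- i \<in> J" by (auto simp: J_def)
      then have "a0 (- i) < a0 i" using 1 lt[of i "-i"] by simp
      moreover have "\<alpha> = uv i (- i)" using 1 two[of i] by simp
      ultimately show ?thesis using i IJ by blast
    next
      case (2 i j) then have i: "i \<in> J" "- j \<in> J" by (auto simp: J_def)
      then have "a0 (- j) < a0 i" using 2 lt[of i "-j"] by simp
      moreover have "\<alpha> = uv i (- j)" using 2 pl[of j i] by simp
      ultimately show ?thesis using i IJ by blast
    next
      case (3 i j) then have i: "i \<in> J" "j \<in> J" by (auto simp: J_def)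
      then have "a0 j < a0 i" using 3 lt[of i j] by simp
      then show ?thesis using i IJ 3(4) by blast
    qed
  next
    fix \<alpha> assume "\<alpha> \<in> {uv i j | i j. i \<in> I \<and> j \<in> I \<and> a0 j < a0 i}"
    then obtain i j where ij: "\<alpha> = uv i j" "i \<in> J" "j \<in> J" "a0 j < a0 i" using IJ by blast
    then consider "i > 0" "j = - i" | "i > 0" "j < 0" "- j > i" | "i > 0" "j < 0" "- j < i"
      | "i > 0" "j > 0" "i < j" | "i < 0" "j < 0" "i < j"
      using lt[OF ij(2,3)] by linarith
    then show "\<alpha> \<in> pos_roots T n"
    proof cases
      case 1
      then have "\<alpha> = Defs.scale 2 (unit_vec i)" using ij two[of i] by simp
      moreover have "1 \<le> i" "i \<le> int n" using 1 ij by (auto simp: J_def)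
      ultimately show ?thesis unfolding P by blast
    next
      case 2
      then have "\<alpha> = unit_vec i + unit_vec (- j)" using ij pl[of "-j" i] by simp
      moreover have "1 \<le> i" "i < - j" "- j \<le> int n" using 2 ij by (auto simp: J_def)
      ultimately show ?thesis unfolding P by blast
    next
      case 3
      then have "\<alpha> = unit_vec (- j) + unit_vec i" using ij pl[of "-j" i] by (simp add: add.commute)
      moreover have "1 \<le> - j" "- j < i" "i \<le> int n" using 3 ij by (auto simp: J_def)
      ultimately show ?thesis unfolding P by blast
    next
      case 4
      then have "1 \<le> i" "j \<le> int n" using ij by (auto simp: J_def)
      then show ?thesis unfolding P using ij 4 by blast
    next
      case 5
      then have "\<alpha> = uv (- j) (- i)" "1 \<le> - j" "- j < - i" "- i \<le> int n" using ij mi[of j i] by (auto simp: J_def)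
      then show ?thesis unfolding P by blast
    qed
  qed
qed

lemma neg_roots_eq: "neg_roots T n = {uv i j | i j. i \<in> I \<and> j \<in> I \<and> a0 i < a0 j}"
proof -
  have "uv i j \<in> uminus ` {uv i j | i j. i \<in> I \<and> j \<in> I \<and> a0 j < a0 i}"
    if "i \<in> I" "j \<in> I" "a0 i < a0 j" for i j
    by (rule image_eqI[of _ _ "uv j i"]) (use that in auto)
  moreover have "- uv i j \<in> {uv i j | i j. i \<in> I \<and> j \<in> I \<and> a0 i < a0 j}"
    if "i \<in> I" "j \<in> I" "a0 j < a0 i" for i j
    using that minus_diff_eq by blast
  ultimately show ?thesis unfolding neg_roots_def pos_roots_eq by blast
qed

text \<open>Symmetrised like \<open>aroot\<close>, so that \<open>pair_uv\<close> holds at all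
  points, not only at odd ones.\<close>

definition pair :: "vec \<Rightarrow> (int \<Rightarrow> real) \<Rightarrow> real" where
  "pair \<alpha> p = (\<Sum>l = 1..int n. of_rat (\<alpha> l) * (p l - p (- l)) / 2)"

lemma sum_unit_vec:
  assumes "i \<in> J" "\<And>l. f (- l) = - f l"
  shows "(\<Sum>l = 1..int n. f l * unit_vec i l) = f i"
proof -
  have "(\<Sum>l = 1..int n. f l * unit_vec i l) =
    (\<Sum>l = 1..int n. (if l = i then f i else 0) + (if l = - i then f i else 0))"
    using assms by (intro sum.cong) (auto simp: unit_vec_def)
  also have "\<dots> = f i" using assms(1) by (auto simp: sum.distrib J_def)
  finally show ?thesis .
qed

lemma sum_unit_vec_real:
  assumes "i \<in> J" "\<And>l. f (- l) = - f l"
  shows "(\<Sum>l = 1..int n. f l * real_of_rat (unit_vec i l)) = f i"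
proof -
  have "(\<Sum>l = 1..int n. f l * real_of_rat (unit_vec i l)) =
    (\<Sum>l = 1..int n. (if l = i then f i else 0) + (if l = - i then f i else 0))"
    using assms by (intro sum.cong) (auto simp: unit_vec_def)
  also have "\<dots> = f i" using assms(1) by (auto simp: sum.distrib J_def)
  finally show ?thesis .
qed

lemma pair_unit_vec: "i \<in> J \<Longrightarrow> pair (unit_vec i) p = (p i - p (- i)) / 2"
  using sum_unit_vec_real[of i "\<lambda>l. (p l - p (- l)) / 2"]
  by (simp add: pair_def mult.commute field_simps)

lemma pair_diff: "pair (\<alpha> - \<beta>) p = pair \<alpha> p - pair \<beta> p"
  by (simp add: pair_def of_rat_diff left_diff_distrib diff_divide_distrib sum_subtractf)

lemma pair_add: "pair (\<alpha> + \<beta>) p = pair \<alpha> p + pair \<beta> p"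
  by (simp add: pair_def of_rat_add distrib_right add_divide_distrib sum.distrib)

lemma pair_uv: "i \<in> J \<Longrightarrow> j \<in> J \<Longrightarrow> pair (uv i j) p = aroot i j 0 p"
  by (simp add: pair_diff pair_unit_vec aroot_def field_simps)

lemma pair_inj:
  assumes "\<alpha> \<in> vecs n" "\<beta> \<in> vecs n" "\<And>p. pair \<alpha> p = pair \<beta> p" shows "\<alpha> = \<beta>"
proof
  have *: "\<alpha> l = \<beta> l" if "l \<in> {1..int n}" for l
  proof -
    \<comment> \<open>The value 2 compensates the halving in \<open>pair\<close>.\<close>
    have "pair \<gamma> (\<lambda>m. if m = l then 2 else 0) = of_rat (\<gamma> l)" for \<gamma>
    proof -
      have "pair \<gamma> (\<lambda>m. if m = l then 2 else 0) = (\<Sum>m = 1..int n. if m = l then of_rat (\<gamma> l) else 0)"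
        unfolding pair_def using that by (intro sum.cong) auto
      then show ?thesis using that by simp
    qed
    then show ?thesis using assms(3) by (metis of_rat_eq_iff)
  qed
  fix l show "\<alpha> l = \<beta> l"
  proof (cases "l \<in> J")
    case True
    then show ?thesis using J_cases[OF True] *[of l] *[of "-l"] assms(1,2) unfolding vecs_iff
      by (metis add.inverse_inverse)
  next
    case False then show ?thesis using assms(1,2) unfolding vecs_iff by simp
  qed
qed

lemma ip_uv: "\<chi> \<in> vecs n \<Longrightarrow> i \<in> J \<Longrightarrow> j \<in> J \<Longrightarrow> ip n \<chi> (uv i j) = \<chi> i - \<chi> j"
  using sum_unit_vec[of i \<chi>] sum_unit_vec[of j \<chi>]
  by (simp add: ip_def vecs_iff right_diff_distrib sum_subtractf)

lemma pos_roots_E: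
  assumes "\<alpha> \<in> pos_roots T n"
  obtains i j where "\<alpha> = uv i j" "i \<in> I" "j \<in> I" "i \<noteq> j" "i \<in> J" "j \<in> J" "a0 j < a0 i"
  using assms unfolding pos_roots_eq by blast

lemma finite_pos_roots: "finite (pos_roots T n)"
proof -
  have "pos_roots T n \<subseteq> (\<lambda>(i,j). uv i j) ` (I \<times> I)" unfolding pos_roots_eq by auto
  then show ?thesis by (rule finite_subset) simp
qed

lemma a0_bound: "i \<in> I \<Longrightarrow> \<bar>a0 i\<bar> \<le> (of_int N - 1) / (2 * of_int N)"
proof -
  assume i: "i \<in> I"
  have *: "\<bar>(of_int N + 1 - 2 * x) / (2 * of_int N)\<bar> \<le> (of_int N - 1) / (2 * of_int N)"
    if "1 \<le> x" "x \<le> of_int N" for x :: real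
    using that N_pos by (auto simp: divide_simps abs_le_iff)
  show ?thesis
  proof (cases "i > 0")
    case True
    then have "1 \<le> real_of_int i" "real_of_int i \<le> of_int N"
      using i n_pos by (auto simp: I_def J_def N_def split: if_splits)
    then show ?thesis using *[of i] i True by (simp add: a0_def I_J)
  next
    case False
    then have "1 \<le> real_of_int (- i)" "real_of_int (- i) \<le> of_int N"
      using i n_pos by (auto simp: I_def J_def N_def split: if_splits)
    moreover have "\<bar>- real_of_int N - 1 - 2 * real_of_int i\<bar> = \<bar>real_of_int N + 1 + 2 * real_of_int i\<bar>" by arith
    ultimately show ?thesis using *[of "- i"] i False by (simp add: a0_def I_J)
  qed
qed

lemma a0_diff_bound: assumes "i \<in> I" "j \<in> I" shows "\<bar>a0 i - a0 j\<bar> \<le> (of_int N - 1) / of_int N"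
proof -
  have "\<bar>a0 i - a0 j\<bar> \<le> 2 * ((of_int N - 1) / (2 * of_int N))"
    using a0_bound[OF assms(1)] a0_bound[OF assms(2)] by linarith
  also have "\<dots> = (of_int N - 1) / of_int N" using N_pos by (simp add: field_simps)
  finally show ?thesis .
qed

lemma a0_diff_lt_1: "i \<in> I \<Longrightarrow> j \<in> I \<Longrightarrow> \<bar>a0 i - a0 j\<bar> < 1"
  using a0_diff_bound[of i j] N_pos
  by (smt (verit, ccfv_SIG) divide_less_eq_1_pos of_int_0_less_iff)

lemma pair_a0_pos: "\<alpha> \<in> pos_roots T n \<Longrightarrow> 0 < pair \<alpha> a0 \<and> pair \<alpha> a0 < 1"
  by (erule pos_roots_E) (use a0_diff_lt_1 in \<open>simp add: pair_uv aroot_odd, smt (verit)\<close>)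

lemma pos_roots_vecs: "\<alpha> \<in> pos_roots T n \<Longrightarrow> \<alpha> \<in> vecs n"
  by (erule pos_roots_E) (simp add: vecs_diff unit_vec_vecs)

lemma pos_neg_disjoint: "pos_roots T n \<inter> neg_roots T n = {}"
proof -
  have "pair (- \<alpha>) p = - pair \<alpha> p" for \<alpha> p using pair_diff[of 0 \<alpha> p] by (simp add: pair_def)
  then have "- \<alpha> \<notin> pos_roots T n" if "\<alpha> \<in> pos_roots T n" for \<alpha>
    using pair_a0_pos[OF that] pair_a0_pos[of "- \<alpha>"] by auto
  then show ?thesis unfolding neg_roots_def by blast
qed

text \<open>The set lists the integers \<open>k\<close> for which the hyperplane of value
  \<open>k\<close> separates the interval from 0 to 1 from the value \<open>c + d\<close>. The sign
  of \<open>d\<close> decides between the two kinds of summand in the length formula.\<close>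

lemma int_interval_card:
  fixes c :: int and d :: real
  assumes "0 < \<bar>d\<bar>" "\<bar>d\<bar> < 1"
  shows "card {k::int. (k \<le> 0 \<and> of_int c + d < of_int k) \<or> (k \<ge> 1 \<and> of_int k < of_int c + d)}
    = nat (if d > 0 then \<bar>c\<bar> else \<bar>c - 1\<bar>)"
    and "finite {k::int. (k \<le> 0 \<and> of_int c + d < of_int k) \<or> (k \<ge> 1 \<and> of_int k < of_int c + d)}"
proof -
  have "{k::int. (k \<le> 0 \<and> of_int c + d < of_int k) \<or> (k \<ge> 1 \<and> of_int k < of_int c + d)}
    = (if d > 0 then {c + 1..0} \<union> {1..c} else {c..0} \<union> {1..c - 1})"
  proof -
    have 1: "of_int c + d < of_int k \<longleftrightarrow> (if d > 0 then c < k else c \<le> k)" for k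
    proof -
      have "real_of_int k \<le> of_int c \<or> real_of_int c + 1 \<le> of_int k"
        by (metis of_int_1 of_int_add of_int_le_iff not_le zless_imp_add1_zle)
      moreover have "c < k \<longleftrightarrow> real_of_int c < of_int k" "c \<le> k \<longleftrightarrow> real_of_int c \<le> of_int k" by simp_all
      moreover have "real_of_int k \<le> of_int c - 1 \<or> real_of_int c \<le> of_int k"
        by (metis of_int_1 of_int_diff of_int_le_iff not_le zle_diff1_eq)
      ultimately show ?thesis using assms by (auto split: if_splits)
    qed
    have 2: "of_int k < of_int c + d \<longleftrightarrow> \<not> (of_int c + d < of_int k)" for k
    proof -
      have "of_int k \<noteq> of_int c + d"
      proof
        assume "real_of_int k = of_int c + d"
        then have "d = of_int (k - c)" by simp
        then show False using assms by simp
      qed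
      then show ?thesis by linarith
    qed
    show ?thesis unfolding 2 1 by auto
  qed
  moreover have "card ({c + 1..0} \<union> {1..c}) = nat \<bar>c\<bar>" "card ({c..0} \<union> {1..c - 1}) = nat \<bar>c - 1\<bar>"
    by (subst card_Un_disjoint; auto)+
  ultimately show "card {k::int. (k \<le> 0 \<and> of_int c + d < of_int k) \<or> (k \<ge> 1 \<and> of_int k < of_int c + d)}
    = nat (if d > 0 then \<bar>c\<bar> else \<bar>c - 1\<bar>)"
    "finite {k::int. (k \<le> 0 \<and> of_int c + d < of_int k) \<or> (k \<ge> 1 \<and> of_int k < of_int c + d)}" by auto
qed

text \<open>The pair \<open>(\<alpha>, k)\<close> with \<open>\<alpha>\<close> positive names the hyperplane \<open>\<alpha> = k\<close>; the corresponding element of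
  \<open>Inv x\<close> is the affine root vanishing there that is positive at \<open>a0\<close>, where \<open>0 < \<alpha> < 1\<close>.\<close>

lemma aff_length_len:
  assumes x: "x \<in> carrier G" shows "aff_length T n x = of_nat (len x)"
proof -
  obtain \<chi> w where xw: "x = (\<chi>, w)" by fastforce
  have w: "w \<in> weyl T n" and \<chi>: "\<chi> \<in> trans_lattice T n" using x xw by (auto simp: carrier_G)
  define u where "u = inv_into UNIV w"
  have u: "u \<in> weyl T n" using w weyl_inv by (simp add: u_def)
  define S where "S \<alpha> = {k::int. (k \<le> 0 \<and> pair \<alpha> (ap x a0) < of_int k) \<or> (k \<ge> 1 \<and> of_int k < pair \<alpha> (ap x a0))}" for \<alpha>
  define F where "F = (\<lambda>(\<alpha>, k::int) p. if k \<le> 0 then pair \<alpha> p - of_int k else of_int k - pair \<alpha> p)"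
  \<comment> \<open>The value of \<open>\<alpha>\<close> at \<open>x a0\<close> is the integer
    \<open>\<langle>\<chi>, \<alpha>\<rangle>\<close> plus the value at \<open>a0\<close> of the
    root moved by the inverse of \<open>w\<close>. The latter is nonzero and less than 1 in absolute
    value, and its sign tells whether the moved root is positive.\<close>
  have pa: "pair \<alpha> (ap x a0) = of_rat (ip n \<chi> \<alpha>) + pair (act u \<alpha>) a0 \<and> ip n \<chi> \<alpha> \<in> \<int> \<and>
     0 < \<bar>pair (act u \<alpha>) a0\<bar> \<and> \<bar>pair (act u \<alpha>) a0\<bar> < 1 \<and>
     (act u \<alpha> \<in> pos_roots T n \<longleftrightarrow> pair (act u \<alpha>) a0 > 0) \<and>
     (act u \<alpha> \<in> neg_roots T n \<longleftrightarrow> \<not> pair (act u \<alpha>) a0 > 0)" if "\<alpha> \<in> pos_roots T n" for \<alpha>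
  proof -
    obtain i j where ij: "\<alpha> = uv i j" "i \<in> I" "j \<in> I" "i \<noteq> j" "i \<in> J" "j \<in> J"
      using pos_roots_E \<open>\<alpha> \<in> pos_roots T n\<close> by metis
    have uij: "u i \<in> I" "u j \<in> I" "u i \<in> J" "u j \<in> J" "u i \<noteq> u j"
      using ij u by (auto simp: u_def) (metis w weyl_f_inv)
    have 0: "act u \<alpha> = uv (u i) (u j)" using u ij by (simp add: act_uv)
    have 1: "pair (act u \<alpha>) a0 = a0 (u i) - a0 (u j)" using uij 0 by (simp add: pair_uv aroot_odd)
    have 2: "pair \<alpha> (ap x a0) = ap x a0 i - ap x a0 j" using ij x by (simp add: pair_uv aroot_odd)
    have 3: "ip n \<chi> \<alpha> = \<chi> i - \<chi> j" using ij \<chi> by (simp add: ip_uv trans_lattice_vecs)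
    have 4: "a0 (u i) \<noteq> a0 (u j)" using a0_inj[of "u i" "u j" 0] uij by auto
    have 5: "act u \<alpha> \<in> pos_roots T n" if "pair (act u \<alpha>) a0 > 0"
      using that 0 1 uij unfolding pos_roots_eq by auto
    have 6: "act u \<alpha> \<in> neg_roots T n" if "\<not> pair (act u \<alpha>) a0 > 0"
    proof -
      have "a0 (u i) < a0 (u j)" using that 1 4 by simp
      then show ?thesis unfolding neg_roots_eq 0 using uij by blast
    qed
    have 7: "\<chi> i - \<chi> j \<in> \<int>" using trans_lattice_diff_Ints \<chi> ij by simp
    have 8: "\<bar>a0 (u i) - a0 (u j)\<bar> < 1" using a0_diff_lt_1 uij by blast
    have "pair \<alpha> (ap x a0) = of_rat (ip n \<chi> \<alpha>) + pair (act u \<alpha>) a0"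
      unfolding 1 2 3 by (simp add: ap_def xw u_def of_rat_diff)
    then show ?thesis using 1 3 4 5 6 7 8 pos_neg_disjoint by auto
  qed
  define c where "c \<alpha> = \<lfloor>ip n \<chi> \<alpha>\<rfloor>" for \<alpha>
  have c: "of_int (c \<alpha>) = ip n \<chi> \<alpha>" "real_of_int (c \<alpha>) = of_rat (ip n \<chi> \<alpha>)" if "\<alpha> \<in> pos_roots T n" for \<alpha>
  proof -
    have "ip n \<chi> \<alpha> \<in> \<int>" using pa[OF that] by blast
    then show "of_int (c \<alpha>) = ip n \<chi> \<alpha>" by (auto simp: c_def elim: Ints_cases)
    then show "real_of_int (c \<alpha>) = of_rat (ip n \<chi> \<alpha>)" by (metis of_rat_of_int_eq)
  qed
  have S_eq: "S \<alpha> = {k::int. (k \<le> 0 \<and> of_int (c \<alpha>) + pair (act u \<alpha>) a0 < of_int k) \<or> (k \<ge> 1 \<and> of_int k < of_int (c \<alpha>) + pair (act u \<alpha>) a0)}"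
    if "\<alpha> \<in> pos_roots T n" for \<alpha>
    unfolding S_def using pa[OF that] c[OF that] by simp
  have cardS: "card (S \<alpha>) = nat (if act u \<alpha> \<in> pos_roots T n then \<bar>c \<alpha>\<bar> else \<bar>c \<alpha> - 1\<bar>)"
    and finS: "finite (S \<alpha>)" if "\<alpha> \<in> pos_roots T n" for \<alpha>
    unfolding S_eq[OF that] using int_interval_card[of "pair (act u \<alpha>) a0" "c \<alpha>"] pa[OF that] by auto
  have "bij_betw F (Sigma (pos_roots T n) S) (Inv x)"
    unfolding bij_betw_def
  proof
    show "inj_on F (Sigma (pos_roots T n) S)"
    proof (rule inj_onI)
      fix z z' assume z: "z \<in> Sigma (pos_roots T n) S" "z' \<in> Sigma (pos_roots T n) S" and e: "F z = F z'"
      obtain \<alpha> k \<alpha>' k' where zz: "z = (\<alpha>, k)" "z' = (\<alpha>', k')" by fastforce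
      have P: "\<alpha> \<in> pos_roots T n" "\<alpha>' \<in> pos_roots T n" using z zz by auto
      have e': "F (\<alpha>, k) p = F (\<alpha>', k') p" for p using e zz by simp
      have p0: "pair \<gamma> (\<lambda>_. 0) = 0" for \<gamma> by (simp add: pair_def)
      show "z = z'"
      proof (cases "k \<le> 0 \<longleftrightarrow> k' \<le> 0")
        case True
        then have kk: "k = k'" using e'[of "\<lambda>_. 0"] by (auto simp: F_def p0 split: if_splits)
        then have "pair \<alpha> p = pair \<alpha>' p" for p using e'[of p] by (auto simp: F_def split: if_splits)
        then have "\<alpha> = \<alpha>'" using pair_inj P pos_roots_vecs by blast
        then show ?thesis using kk zz by simp
      next
        case False
        then have "k = - k'" using e'[of "\<lambda>_. 0"] by (auto simp: F_def p0 split: if_splits)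
        then have "pair \<alpha> a0 = - pair \<alpha>' a0" using e'[of a0] False by (auto simp: F_def split: if_splits)
        then show ?thesis using pair_a0_pos[OF P(1)] pair_a0_pos[OF P(2)] by linarith
      qed
    qed
  next
    show "F ` Sigma (pos_roots T n) S = Inv x"
    proof (intro equalityI subsetI)
      fix \<beta> assume "\<beta> \<in> F ` Sigma (pos_roots T n) S"
      then obtain \<alpha> k where ak: "\<alpha> \<in> pos_roots T n" "k \<in> S \<alpha>" "\<beta> = F (\<alpha>, k)" by auto
      obtain i j where ij: "\<alpha> = uv i j" "i \<in> I" "j \<in> I" "i \<noteq> j" "i \<in> J" "j \<in> J"
        using pos_roots_E ak(1) by metis
      have h: "0 < pair \<alpha> a0" "pair \<alpha> a0 < 1" using pair_a0_pos[OF ak(1)] by auto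
      show "\<beta> \<in> Inv x"
      proof (cases "k \<le> 0")
        case True
        have "\<beta> = aroot i j k" unfolding ak(3) F_def using True ij by (auto simp: pair_uv aroot_def)
        then have "\<beta> \<in> AR" using aroot_AR ij by simp
        moreover have "\<beta> p = pair \<alpha> p - of_int k" for p using ak(3) True by (simp add: F_def)
        moreover have "pair \<alpha> (ap x a0) < of_int k" using ak(2) True by (simp add: S_def)
        moreover have "real_of_int k \<le> 0" using True by simp
        ultimately show ?thesis using h unfolding Inv_def by auto
      next
        case False
        have "\<beta> = aroot j i (- k)" unfolding ak(3) F_def using False ij by (auto simp: pair_uv aroot_minus) (auto simp: aroot_def fun_eq_iff)
        then have "\<beta> \<in> AR" using aroot_AR ij by simp
        moreover have "\<beta> p = of_int k - pair \<alpha> p" for p using ak(3) False by (simp add: F_def)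
        moreover have "of_int k < pair \<alpha> (ap x a0)" using ak(2) False by (simp add: S_def)
        moreover have "real_of_int k \<ge> 1" using False by simp
        ultimately show ?thesis using h unfolding Inv_def by auto
      qed
    next
      fix \<beta> assume b: "\<beta> \<in> Inv x"
      then obtain i j k where r: "\<beta> = aroot i j k" "i \<in> I" "j \<in> I" "i \<noteq> j"
        using AR_E unfolding Inv_def by blast
      have J: "i \<in> J" "j \<in> J" using r by auto
      have b0: "\<beta> a0 > 0" "\<beta> (ap x a0) < 0" using b by (auto simp: Inv_def)
      have ne: "a0 i \<noteq> a0 j" using a0_inj[of i j 0] r by auto
      have lt1: "\<bar>a0 i - a0 j\<bar> < 1" using a0_diff_lt_1 r by blast
      show "\<beta> \<in> F ` Sigma (pos_roots T n) S"
      proof (cases "a0 j < a0 i")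
        case True
        have "real_of_int k < 1" using b0(1) r lt1 by (simp add: aroot_odd)
        then have k: "k \<le> 0" by simp
        have "\<beta> = F (uv i j, k)" unfolding F_def r(1) using k J by (auto simp: pair_uv aroot_def)
        moreover have "uv i j \<in> pos_roots T n" using True r unfolding pos_roots_eq by blast
        moreover have "k \<in> S (uv i j)" using k b0 r J by (simp add: S_def pair_uv aroot_def)
        ultimately show ?thesis by blast
      next
        case False
        have "real_of_int k < 0" using b0(1) r False by (simp add: aroot_odd)
        then have k: "- k \<ge> 1" by simp
        have "\<beta> = F (uv j i, - k)" unfolding F_def r(1) using k J by (auto simp: pair_uv aroot_def fun_eq_iff field_simps)
        moreover have "uv j i \<in> pos_roots T n" using False ne r unfolding pos_roots_eq by force
        moreover have "- k \<in> S (uv j i)" using k b0 r J by (simp add: S_def pair_uv aroot_def field_simps)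
        ultimately show ?thesis by blast
      qed
    qed
  qed
  then have "len x = card (Sigma (pos_roots T n) S)" unfolding len_def by (simp add: bij_betw_same_card)
  also have "\<dots> = (\<Sum>\<alpha>\<in>pos_roots T n. card (S \<alpha>))"
    using finite_pos_roots finS by (subst card_SigmaI) auto
  finally have "(of_nat (len x) :: rat) = (\<Sum>\<alpha>\<in>pos_roots T n. of_nat (card (S \<alpha>)))" by simp
  also have "\<dots> = (\<Sum>\<alpha>\<in>pos_roots T n. if act u \<alpha> \<in> pos_roots T n then \<bar>ip n \<chi> \<alpha>\<bar> else \<bar>ip n \<chi> \<alpha> - 1\<bar>)"
    using cardS c(1) by (intro sum.cong) (auto simp: of_nat_nat simp flip: c(1) )
  also have "\<dots> = (\<Sum>\<alpha> | \<alpha> \<in> pos_roots T n \<and> act u \<alpha> \<in> pos_roots T n. \<bar>ip n \<chi> \<alpha>\<bar>)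
     + (\<Sum>\<alpha> | \<alpha> \<in> pos_roots T n \<and> \<not> act u \<alpha> \<in> pos_roots T n. \<bar>ip n \<chi> \<alpha> - 1\<bar>)"
    using finite_pos_roots by (subst sum.If_cases) (auto simp: Int_def Collect_neg_eq)
  also have "{\<alpha>. \<alpha> \<in> pos_roots T n \<and> \<not> act u \<alpha> \<in> pos_roots T n} = {\<alpha>. \<alpha> \<in> pos_roots T n \<and> act u \<alpha> \<in> neg_roots T n}"
    using pa by blast
  finally show ?thesis unfolding xw by (simp add: u_def)
qed

section \<open>Simple reflections and word length\<close>

lemma finite_simple_roots: "finite (simple_roots T n)"
  using finite_pos_roots by (simp add: simple_roots_def)

lemma pair_a0_ge: assumes "\<alpha> \<in> pos_roots T n" shows "pair \<alpha> a0 \<ge> 1 / of_int N"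
proof -
  obtain i j where ij: "\<alpha> = uv i j" "i \<in> I" "j \<in> I" "i \<noteq> j" "i \<in> J" "j \<in> J"
    using pos_roots_E assms by metis
  have "aroot i j 0 a0 > 0" using pair_a0_pos[OF assms] ij by (simp add: pair_uv)
  then have "aroot i j 0 a0 \<ge> 1 / of_int N" using AR_a0_ge aroot_AR ij by blast
  then show ?thesis using ij by (simp add: pair_uv)
qed

text \<open>The wrap-around in \<open>a0_pred\<close> happens only at the lowest coordinate, which
  \<open>i\<close> is not; hence the integer there is zero.\<close>

lemma a0_pred_between:
  assumes ij: "i \<in> I" "j \<in> I" "a0 i - a0 j > 0"
  obtains c where "c \<in> I" "a0 i - a0 c = 1 / of_int N" "a0 c \<ge> a0 j"
proof -
  obtain c k where c: "c \<in> I" "a0 i - a0 c - of_int k = 1 / of_int N" using a0_pred ij(1) by blast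
  have ne: "i \<noteq> j" using ij by auto
  then obtain m where m: "a0 i - a0 j = real_of_int m / of_int N" using a0_diff ij by blast
  then have "m \<ge> 1" using ij(3) N_pos by (simp add: zero_less_divide_iff)
  then have ge: "a0 i - a0 j \<ge> 1 / of_int N" unfolding m using N_pos by (simp add: divide_right_mono)
  have i1: "a0 i \<le> (of_int N - 1) / (2 * of_int N)" "a0 j \<ge> - ((of_int N - 1) / (2 * of_int N))"
    "\<bar>a0 c\<bar> \<le> (of_int N - 1) / (2 * of_int N)"
    using a0_bound[OF ij(1)] a0_bound[OF ij(2)] a0_bound[OF c(1)] by linarith+
  have half: "(of_int N - 1) / (2 * of_int N) < (1/2::real)" using N_pos by (simp add: field_simps)
  have npos: "1 / real_of_int N > 0" using N_pos by simp
  have "real_of_int k < 1" "real_of_int k > -1"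
    using c(2) i1 half ge npos by linarith+
  then have "k = 0" by linarith
  then show thesis using that c ge by simp
qed

lemma pos_roots_uv: "i \<in> I \<Longrightarrow> j \<in> I \<Longrightarrow> a0 j < a0 i \<Longrightarrow> uv i j \<in> pos_roots T n"
  unfolding pos_roots_eq by blast

text \<open>\<open>N\<close> times the value at \<open>a0\<close> is the height. A root of larger
  height splits at the coordinate just below its first index, while two positive roots already add
  up to height at least two.\<close>

lemma simple_roots_eq: "simple_roots T n = {\<alpha> \<in> pos_roots T n. pair \<alpha> a0 = 1 / of_int N}"
proof (intro equalityI subsetI)
  fix \<alpha> assume a: "\<alpha> \<in> simple_roots T n"
  then have P: "\<alpha> \<in> pos_roots T n" by (simp add: simple_roots_def)
  obtain i j where ij: "\<alpha> = uv i j" "i \<in> I" "j \<in> I" "i \<noteq> j" "i \<in> J" "j \<in> J" "a0 j < a0 i"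
    using pos_roots_E P by metis
  obtain c where c: "c \<in> I" "a0 i - a0 c = 1 / of_int N" "a0 c \<ge> a0 j"
    using a0_pred_between[of i j] ij by auto
  have "a0 c = a0 j"
  proof (rule ccontr)
    assume "a0 c \<noteq> a0 j"
    then have "uv c j \<in> pos_roots T n" using c ij pos_roots_uv by simp
    moreover have "uv i c \<in> pos_roots T n"
    proof -
      have "1 / real_of_int N > 0" using N_pos by simp
      then have "a0 c < a0 i" using c by linarith
      then show ?thesis using c ij pos_roots_uv by simp
    qed
    moreover have "\<alpha> = uv i c + uv c j" using ij by simp
    ultimately show False using a unfolding simple_roots_def by blast
  qed
  then have "pair \<alpha> a0 = 1 / of_int N" using c ij by (simp add: pair_uv aroot_odd)
  then show "\<alpha> \<in> {\<alpha> \<in> pos_roots T n. pair \<alpha> a0 = 1 / of_int N}" using P by blast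
next
  fix \<alpha> assume a: "\<alpha> \<in> {\<alpha> \<in> pos_roots T n. pair \<alpha> a0 = 1 / of_int N}"
  have "\<not> (\<exists>\<beta> \<in> pos_roots T n. \<exists>\<gamma> \<in> pos_roots T n. \<alpha> = \<beta> + \<gamma>)"
  proof
    assume "\<exists>\<beta> \<in> pos_roots T n. \<exists>\<gamma> \<in> pos_roots T n. \<alpha> = \<beta> + \<gamma>"
    then obtain \<beta> \<gamma> where bg: "\<beta> \<in> pos_roots T n" "\<gamma> \<in> pos_roots T n" "\<alpha> = \<beta> + \<gamma>" by blast
    have "1 / real_of_int N > 0" using N_pos by simp
    moreover have "1 / real_of_int N = pair \<beta> a0 + pair \<gamma> a0" using a bg by (simp add: pair_add)
    ultimately show False using pair_a0_ge[OF bg(1)] pair_a0_ge[OF bg(2)] by linarith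
  qed
  then show "\<alpha> \<in> simple_roots T n" using a by (simp add: simple_roots_def)
qed

section \<open>Nonnegative combinations of simple roots and the highest root\<close>

definition comb :: "(vec \<Rightarrow> nat) \<Rightarrow> vec" where
  "comb c = (\<Sum>\<beta> \<in> simple_roots T n. Defs.scale (of_nat (c \<beta>)) \<beta>)"

lemma sum_fun_apply: "(\<Sum>x\<in>A. f x) l = (\<Sum>x\<in>A. f x l :: 'b :: comm_monoid_add)"
  by (induction A rule: infinite_finite_induct) auto

lemma comb_apply: "comb c l = (\<Sum>\<beta> \<in> simple_roots T n. of_nat (c \<beta>) * \<beta> l)"
  by (simp add: comb_def sum_fun_apply Defs.scale_def)

lemma comb_add: "comb (\<lambda>\<beta>. c \<beta> + d \<beta>) = comb c + comb d"
  by (rule ext) (simp add: comb_apply distrib_right sum.distrib)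

lemma comb_zero: "comb (\<lambda>\<beta>. 0) = 0"
  by (rule ext) (simp add: comb_apply)

lemma comb_single: assumes "\<alpha> \<in> simple_roots T n" shows "comb (\<lambda>\<beta>. if \<beta> = \<alpha> then 1 else 0) = \<alpha>"
proof (rule ext)
  fix l
  have "comb (\<lambda>\<beta>. if \<beta> = \<alpha> then 1 else 0) l = (\<Sum>\<beta> \<in> simple_roots T n. if \<beta> = \<alpha> then \<alpha> l else 0)"
    unfolding comb_apply by (intro sum.cong) auto
  then show "comb (\<lambda>\<beta>. if \<beta> = \<alpha> then 1 else 0) l = \<alpha> l" using assms finite_simple_roots by simp
qed

lemma pair_comb: "pair (comb c) p = (\<Sum>\<beta> \<in> simple_roots T n. of_nat (c \<beta>) * pair \<beta> p)"
proof -
  have "pair (comb c) p = (\<Sum>l = 1..int n. \<Sum>\<beta> \<in> simple_roots T n. of_nat (c \<beta>) * (of_rat (\<beta> l) * (p l - p (- l)) / 2))"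
    by (simp add: pair_def comb_apply of_rat_sum of_rat_mult sum_distrib_right sum_divide_distrib mult.assoc)
  also have "\<dots> = (\<Sum>\<beta> \<in> simple_roots T n. of_nat (c \<beta>) * pair \<beta> p)"
    by (subst sum.swap) (simp add: pair_def sum_distrib_left)
  finally show ?thesis .
qed

lemma pair_comb_ge: "pair (comb c) a0 \<ge> 0"
  unfolding pair_comb using pair_a0_pos N_pos by (intro sum_nonneg mult_nonneg_nonneg) (auto simp: simple_roots_eq less_imp_le)

text \<open>Descending from \<open>i\<close> to \<open>j\<close> through neighbouring coordinates of
  \<open>a0\<close> adds one simple root per step.\<close>

lemma uv_comb:
  assumes "i \<in> I" "j \<in> I" "a0 j \<le> a0 i" shows "\<exists>c. uv i j = comb c"
proof -
  have "\<exists>c. uv i j = comb c" if "i \<in> I" "a0 i - a0 j = of_nat m / of_int N" for m i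
    using that
  proof (induction m arbitrary: i)
    case 0
    then have "i = j" using a0_inj[of i j 0] assms by simp
    then show ?case using comb_zero by (metis diff_self)
  next
    case (Suc m)
    have "a0 i - a0 j > 0" unfolding Suc.prems using N_pos by simp
    then obtain c where c: "c \<in> I" "a0 i - a0 c = 1 / of_int N" using a0_pred_between assms Suc by metis
    have "a0 c - a0 j = of_nat m / of_int N" using c Suc.prems by (simp add: add_divide_distrib)
    then obtain d where d: "uv c j = comb d" using Suc.IH c by blast
    have "a0 c < a0 i" using c(2) N_pos by (smt (verit) divide_pos_pos of_int_0_less_iff)
    then have "uv i c \<in> simple_roots T n"
      using c Suc.prems pos_roots_uv unfolding simple_roots_eq by (auto simp: pair_uv aroot_odd I_J)
    then have "uv i c + uv c j = comb (\<lambda>\<beta>. (if \<beta> = uv i c then 1 else 0) + d \<beta>)"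
      using comb_single d comb_add by simp
    then show ?case by (metis diff_add_cancel add_diff_eq)
  qed
  moreover obtain m :: nat where "a0 i - a0 j = of_nat m / of_int N"
  proof (cases "i = j")
    case False
    then obtain m where m: "a0 i - a0 j = real_of_int m / of_int N" using a0_diff assms by blast
    then have "real_of_int m \<ge> 0" using assms(3) N_pos by (metis diff_ge_0_iff_ge divide_less_0_iff not_less of_int_0_less_iff)
    then show thesis using that[of "nat m"] m by simp
  qed (use that[of 0] in simp)
  ultimately show ?thesis using assms by blast
qed

lemma highest_exists:
  assumes "pos_roots T n \<noteq> {}"
  shows "\<exists>\<theta> \<in> pos_roots T n. pair \<theta> a0 = (of_int N - 1) / of_int N"
proof -
  have N1: "N > 1"
  proof (rule ccontr)
    assume "\<not> N > 1"
    then have "N = 1" using N_pos by simp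
    moreover obtain \<alpha> where "\<alpha> \<in> pos_roots T n" using assms by blast
    ultimately show False using pair_a0_pos[of \<alpha>] pair_a0_ge[of \<alpha>] by simp
  qed
  \<comment> \<open>The root is \<open>e_1 - e_n\<close> in type A and
    \<open>e_1 - e_(-1) = 2 e_1\<close> in type C; its indices carry the extreme coordinates of
    \<open>a0\<close>.\<close>
  define b where "b = (if is_A then int n else - 1)"
  have I: "1 \<in> I" "b \<in> I" using n_pos by (auto simp: b_def I_def J_def)
  have 1: "a0 1 = (of_int N - 1) / (2 * of_int N)" using I by (simp add: a0_def I_J)
  have 2: "a0 b = - ((of_int N - 1) / (2 * of_int N))"
    using I I_J[OF I(2)] n_pos N_pos unfolding b_def a0_def N_def by (auto simp: field_simps)
  have d: "a0 1 - a0 b = (of_int N - 1) / of_int N" unfolding 1 2 using N_pos by (simp add: field_simps)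
  have "0 < (real_of_int N - 1) / of_int N" using N1 by simp
  then have "a0 b < a0 1" using d by linarith
  then have "uv 1 b \<in> pos_roots T n" using pos_roots_uv I by blast
  moreover have "pair (uv 1 b) a0 = (of_int N - 1) / of_int N" using d I by (simp add: pair_uv aroot_odd I_J)
  ultimately show ?thesis by blast
qed

text \<open>The height \<open>N - 1\<close> is the largest possible, and it is attained. A root of
  this height has the extreme coordinates as indices, so \<open>e_a - e_b\<close> exceeds
  \<open>e_i - e_j\<close> by \<open>(e_a - e_i) + (e_j - e_b)\<close>, where both summands are
  combinations of simple roots.\<close>

lemma highest_root_iff:
  "highest_root T n \<theta> \<longleftrightarrow> \<theta> \<in> pos_roots T n \<and> pair \<theta> a0 = (of_int N - 1) / of_int N"
proof
  assume h: "highest_root T n \<theta>"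
  then have P: "\<theta> \<in> pos_roots T n" by (simp add: highest_root_def)
  then obtain \<theta>0 where t: "\<theta>0 \<in> pos_roots T n" "pair \<theta>0 a0 = (of_int N - 1) / of_int N"
    using highest_exists by blast
  then obtain c where "\<theta> = \<theta>0 + comb c" using h unfolding highest_root_def comb_def by blast
  then have "pair \<theta> a0 \<ge> (of_int N - 1) / of_int N" using t pair_comb_ge by (simp add: pair_add)
  moreover obtain i j where ij: "\<theta> = uv i j" "i \<in> I" "j \<in> I" "i \<noteq> j" "i \<in> J" "j \<in> J"
    using pos_roots_E P by metis
  have "pair \<theta> a0 \<le> (of_int N - 1) / of_int N" using a0_diff_bound[OF ij(2,3)] ij by (simp add: pair_uv aroot_odd)
  ultimately show "\<theta> \<in> pos_roots T n \<and> pair \<theta> a0 = (of_int N - 1) / of_int N" using P by simp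
next
  assume t: "\<theta> \<in> pos_roots T n \<and> pair \<theta> a0 = (of_int N - 1) / of_int N"
  then obtain a b where ab: "\<theta> = uv a b" "a \<in> I" "b \<in> I" "a \<noteq> b" "a \<in> J" "b \<in> J"
    using pos_roots_E by metis
  have d: "a0 a - a0 b = (of_int N - 1) / of_int N" using t ab by (simp add: pair_uv aroot_odd)
  have "(of_int N - 1) / of_int N = 2 * ((of_int N - 1) / (2 * real_of_int N))" using N_pos by (simp add: field_simps)
  then have ext: "a0 i \<le> a0 a" "a0 b \<le> a0 i" if "i \<in> I" for i
    using a0_bound[OF ab(2)] a0_bound[OF ab(3)] a0_bound[OF that] d by linarith+
  show "highest_root T n \<theta>"
    unfolding highest_root_def
  proof (intro conjI ballI)
    fix \<alpha> assume "\<alpha> \<in> pos_roots T n"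
    then obtain i j where ij: "\<alpha> = uv i j" "i \<in> I" "j \<in> I" using pos_roots_E by metis
    obtain c where c: "uv a i = comb c" using uv_comb ext ab ij by blast
    obtain d where d: "uv j b = comb d" using uv_comb ext ab ij by blast
    have "\<theta> = \<alpha> + (uv a i + uv j b)" using ab ij by simp
    also have "\<dots> = \<alpha> + comb (\<lambda>\<beta>. c \<beta> + d \<beta>)" using c d comb_add by simp
    finally show "\<exists>c. \<theta> = \<alpha> + (\<Sum>\<beta>\<in>simple_roots T n. Defs.scale (rat_of_nat (c \<beta>)) \<beta>)"
      unfolding comb_def by (rule exI[of _ "\<lambda>\<beta>. c \<beta> + d \<beta>"])
  qed (use t in blast)
qed

section \<open>The Coxeter generators as affine reflections\<close>

lemma coroot_uv:
  assumes "i \<in> J" "j \<in> J" "i \<noteq> j" shows "coroot n (uv i j) = arefl_vec i j 1"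
proof -
  have nz: "i \<noteq> 0" "j \<noteq> 0" using assms by auto
  have "ip n (uv i j) (uv i j) = uv i j i - uv i j j"
    using ip_uv[of "uv i j" i j] assms by (simp add: vecs_diff unit_vec_vecs)
  also have "\<dots> = (if j = - i then 4 else 2)" using nz assms(3) by (auto simp: unit_vec_def)
  finally show ?thesis
    using nz assms(3) by (auto simp: coroot_def Defs.scale_def arefl_vec_def unit_vec_def fun_eq_iff)
qed

lemma is_reflection_iff:
  assumes "i \<in> I" "j \<in> I" "i \<noteq> j" "s \<in> weyl T n"
  shows "is_reflection n (uv i j) s \<longleftrightarrow> s = swp i j"
proof -
  have J: "i \<in> J" "j \<in> J" and nz: "i \<noteq> 0" "j \<noteq> 0" using assms by (auto dest: I_J)
  have r: "act (swp i j) x = x - Defs.scale (ip n x (coroot n (uv i j))) (uv i j)" if x: "x \<in> vecs n" for x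
  proof -
    have xo: "x (- l) = - x l" for l using x by (simp add: vecs_iff)
    \<comment> \<open>For \<open>j = - i\<close> the root is \<open>2 e_i\<close> with coroot
      \<open>e_i\<close>, so the coefficient is \<open>x i\<close> and not the difference of the two
      coordinates.\<close>
    have ip: "ip n x (coroot n (uv i j)) = (if j = - i then x i else x i - x j)"
    proof (cases "j = - i")
      case True
      have "arefl_vec i j 1 = unit_vec i" using True nz by (auto simp: arefl_vec_def unit_vec_def fun_eq_iff)
      then show ?thesis using True coroot_uv[OF J assms(3)] sum_unit_vec[of i x] J xo by (simp add: ip_def)
    next
      case False
      have "arefl_vec i j 1 = uv i j" using False nz assms(3) by (auto simp: arefl_vec_def unit_vec_def fun_eq_iff)
      then show ?thesis using False coroot_uv[OF J assms(3)] ip_uv[OF x J] by simp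
    qed
    show ?thesis unfolding ip using nz assms(3) xo
      by (auto simp: act_def fun_eq_iff Defs.scale_def unit_vec_def swp_def)
  qed
  show ?thesis
  proof
    assume R: "is_reflection n (uv i j) s"
    show "s = swp i j"
    proof
      fix l
      show "s l = swp i j l"
      proof (cases "l \<in> J")
        case True
        have w: "swp i j \<in> weyl T n" using swp_weyl assms by blast
        have "act s (unit_vec l) = act (swp i j) (unit_vec l)"
          using R r unit_vec_vecs[OF True] unfolding is_reflection_def by simp
        then have "unit_vec (s l) = unit_vec (swp i j l)" using assms w by (simp add: act_unit_vec)
        moreover have "s l \<in> J" using True assms by simp
        then have "s l \<noteq> 0" by auto
        ultimately show ?thesis using unit_vec_inj by blast
      next
        case False
        then show ?thesis using weyl_notin[OF assms(4) False] weyl_notin[OF swp_weyl[OF assms(1-3)] False] by simp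
      qed
    qed
  next
    assume "s = swp i j"
    then show "is_reflection n (uv i j) s" using r by (simp add: is_reflection_def)
  qed
qed

text \<open>The generator \<open>s_0\<close> reflects in the affine root
  \<open>1 - \<theta>\<close>, whose value at \<open>a0\<close> is
  \<open>1 - (N - 1) / N = 1 / N\<close>. Conversely that value leaves only the constants
  \<open>0\<close> and \<open>-1\<close>, giving the finite simple reflections and
  \<open>s_0\<close>.\<close>

lemma aff_simple_refls_eq: "aff_simple_refls T n = {arefl i j k | i j k. simple i j k}"
proof (intro equalityI subsetI)
  fix x assume "x \<in> aff_simple_refls T n"
  then consider s \<alpha> where "x = (0, s)" "s \<in> weyl T n" "\<alpha> \<in> simple_roots T n" "is_reflection n \<alpha> s"
    | s \<theta> where "x = (coroot n \<theta>, s)" "s \<in> weyl T n" "highest_root T n \<theta>" "is_reflection n \<theta> s"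
    unfolding aff_simple_refls_def by blast
  then show "x \<in> {arefl i j k | i j k. simple i j k}"
  proof cases
    case 1
    then have P: "\<alpha> \<in> pos_roots T n" "pair \<alpha> a0 = 1 / of_int N" by (auto simp: simple_roots_eq)
    obtain i j where ij: "\<alpha> = uv i j" "i \<in> I" "j \<in> I" "i \<noteq> j" "i \<in> J" "j \<in> J"
      using pos_roots_E P by metis
    have "s = swp i j" using is_reflection_iff ij 1 by simp
    moreover have "arefl_vec i j 0 = 0" by (simp add: arefl_vec_def fun_eq_iff)
    moreover have "simple i j 0" using P(2) ij by (simp add: simple_def pair_uv)
    ultimately show ?thesis using 1 unfolding arefl_def by auto
  next
    case 2
    then have P: "\<theta> \<in> pos_roots T n" "pair \<theta> a0 = (of_int N - 1) / of_int N" by (auto simp: highest_root_iff)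
    obtain i j where ij: "\<theta> = uv i j" "i \<in> I" "j \<in> I" "i \<noteq> j" "i \<in> J" "j \<in> J"
      using pos_roots_E P by metis
    have nz: "i \<noteq> 0" "j \<noteq> 0" using ij by auto
    have "s = swp i j" using is_reflection_iff ij 2 by simp
    then have "x = arefl i j 1" using 2 coroot_uv ij by (simp add: arefl_def)
    then have "x = arefl j i (-1)" using arefl_swap[of i j 1] ij nz by simp
    moreover have "simple j i (-1)"
      using P(2) ij N_pos by (simp add: simple_def pair_uv aroot_odd field_simps)
    ultimately show ?thesis by blast
  qed
next
  fix x assume "x \<in> {arefl i j k | i j k. simple i j k}"
  then obtain i j k where s: "x = arefl i j k" "simple i j k" by blast
  note ij = simple_I[OF s(2)]
  have J: "i \<in> J" "j \<in> J" and nz: "i \<noteq> 0" "j \<noteq> 0" using ij by (auto dest: I_J)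
  have e: "a0 i - a0 j - of_int k = 1 / of_int N" using s(2) by (simp add: simple_def aroot_odd)
  have b: "\<bar>a0 i - a0 j\<bar> \<le> (of_int N - 1) / of_int N" using a0_diff_bound ij by blast
  have f: "(of_int N - 1) / real_of_int N = 1 - 1 / of_int N" using N_pos by (simp add: field_simps)
  have np: "1 / real_of_int N > 0" using N_pos by simp
  have "real_of_int k < 1" "real_of_int k \<ge> -1" using e b f np by linarith+
  then have "k = 0 \<or> k = -1" by linarith
  then show "x \<in> aff_simple_refls T n"
  proof
    assume k: "k = 0"
    have "a0 j < a0 i" using e np unfolding k by linarith
    then have "uv i j \<in> simple_roots T n"
      using pos_roots_uv ij e k J by (simp add: simple_roots_eq pair_uv aroot_odd)
    moreover have "arefl_vec i j 0 = 0" by (simp add: arefl_vec_def fun_eq_iff)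
    moreover have "is_reflection n (uv i j) (swp i j)" using is_reflection_iff swp_weyl ij by blast
    ultimately show ?thesis unfolding s(1) k arefl_def aff_simple_refls_def using swp_weyl[OF ij] by auto
  next
    assume k: "k = -1"
    have d: "a0 j - a0 i = (of_int N - 1) / of_int N" using e k f by simp
    have ne: "a0 i \<noteq> a0 j" using a0_inj[of i j 0] ij by auto
    moreover have "a0 j - a0 i \<ge> 0" unfolding d using N_pos by simp
    ultimately have "a0 i < a0 j" by simp
    then have "highest_root T n (uv j i)"
      using pos_roots_uv ij d J by (simp add: highest_root_iff pair_uv aroot_odd)
    moreover have "is_reflection n (uv j i) (swp j i)" using is_reflection_iff swp_weyl ij by metis
    moreover have "x = (coroot n (uv j i), swp j i)"
      using arefl_swap[of j i 1] ij nz J coroot_uv[of j i] unfolding s(1) k by (simp add: arefl_def)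
    moreover have "swp j i \<in> weyl T n" using swp_weyl ij by metis
    ultimately show ?thesis unfolding aff_simple_refls_def by blast
  qed
qed

text \<open>At \<open>y = x a0\<close> all simple roots are at least \<open>1/N\<close>, and summing
  along the circle gives \<open>y i - y j \<ge> a0 i - a0 j\<close> for every pair, hence equality
  by symmetry. So \<open>y - a0\<close> is constant on \<open>I\<close>, and the constant vanishes
  by oddness in type C and by the zero coordinate sum of coroots in type A. Regularity of
  \<open>a0\<close> leaves only the identity.\<close>

lemma Wa_len_zero:
  assumes x: "x \<in> Wa" and l: "len x = 0" shows "x = \<one>\<^bsub>G\<^esub>"
proof -
  have xc: "x \<in> carrier G" using x by simp
  let ?y = "ap x a0" and ?u = "inv_into UNIV (snd x)"
  have w: "snd x \<in> weyl T n" "?u \<in> weyl T n" using xc weyl_inv by auto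
  have o: "odd_fun ?y" using xc by simp
  have nn: "aroot i j k ?y \<ge> 1 / of_int N" if "simple i j k" for i j k
  proof -
    have "aroot i j k ?y > 0" using len_zero_sign[OF xc l simple_AR[OF that]] simple_pos[OF that] by simp
    then show ?thesis using AR_a0_ge[OF AR_ap[OF simple_AR[OF that] xc]] by simp
  qed
  have ge: "?y i - ?y j \<ge> a0 i - a0 j" if ij: "i \<in> I" "j \<in> I" "i \<noteq> j" for i j
  proof -
    obtain m where m: "m \<noteq> 0" "\<bar>m\<bar> < N" "a0 i - a0 j = real_of_int m / of_int N" using a0_diff ij by blast
    have n1: "n \<noteq> 1" if "is_A"
    proof -
      have "N = int n" using that by (simp add: N_def)
      then show ?thesis using m(1,2) by linarith
    qed
    \<comment> \<open>The integer \<open>m\<close> may be negative but exceeds \<open>- N\<close>;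
      the constant \<open>-1\<close> adds \<open>N\<close> to it, so that the number of simple roots
      is a natural number.\<close>
    have "a0 i - a0 j - of_int (-1) = of_nat (nat (m + N)) / of_int N"
      using m N_pos by (simp add: field_simps)
    then have "?y i - ?y j - of_int (-1) \<ge> of_nat (nat (m + N)) * (1 / of_int N)"
      using simple_pos_imp[OF o nn n1, of i j "-1" "nat (m + N)"] ij by blast
    also have "of_nat (nat (m + N)) * (1 / of_int N) = a0 i - a0 j + 1"
      using m N_pos by (simp add: field_simps)
    finally show ?thesis by simp
  qed
  have eq: "?y i - a0 i = ?y j - a0 j" if "i \<in> I" "j \<in> I" for i j
    using ge[OF that] ge[OF that(2,1)] by (cases "i = j") auto
  have y: "?y i = a0 i" if i: "i \<in> I" for i
  proof (cases is_A)
    case False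
    then have "- i \<in> I" using i by (simp add: I_def)
    then show ?thesis using eq[OF i, of "- i"] o by (simp add: odd_funD)
  next
    case True
    have "bij_betw ?u I I"
      using w by (intro bij_betwI[where g = "snd x"]) auto
    then have 1: "(\<Sum>i\<in>I. a0 (?u i)) = (\<Sum>i\<in>I. a0 i)" by (rule sum.reindex_bij_betw)
    have "I = {1..int n}" using True by (auto simp: I_def J_def)
    moreover have "fst x \<in> coroot_lattice T n" using x by (auto simp: aff_weyl_def)
    ultimately have "(\<Sum>i\<in>I. fst x i) = 0" using True by (simp add: coroot_lattice_iff)
    then have "(\<Sum>i\<in>I. real_of_rat (fst x i)) = 0" by (metis of_rat_sum of_rat_0)
    then have "(\<Sum>i\<in>I. ?y i - a0 i) = 0" using 1 by (simp add: ap_def sum.distrib sum_subtractf del: of_rat_eq_0_iff)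
    also have "(\<Sum>i\<in>I. ?y i - a0 i) = (\<Sum>j\<in>I. ?y i - a0 i)" by (rule sum.cong) (auto intro: eq[OF _ i])
    finally have "of_nat (card I) * (?y i - a0 i) = 0" by simp
    then show ?thesis using i by auto
  qed
  have u: "?u i = i" and f: "fst x i = 0" if i: "i \<in> I" for i
  proof -
    have "fst x i \<in> \<int>" using x i by (auto simp: aff_weyl_def coroot_lattice_iff int_vecs_iff)
    then obtain c where c: "fst x i = of_int c" by (auto elim: Ints_cases)
    have "a0 i - a0 (?u i) = of_int c" using y[OF i] c by (simp add: ap_def)
    moreover have "?u i \<in> I" using w i by simp
    ultimately show 1: "?u i = i" using a0_inj i by metis
    then show "fst x i = 0" using y[OF i] by (simp add: ap_def)
  qed
  have IJ: "i \<in> I \<or> - i \<in> I" if "i \<in> J" for i using that by (auto simp: I_def J_def)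
  have "?u i = i" for i
    using u[of i] u[of "- i"] IJ[of i] weyl_odd[OF w(2), of i] weyl_notin[OF w(2), of i] by (cases "i \<in> J") auto
  then have "?u = id" by auto
  then have "snd x = id" using inv_inv_weyl[OF w(1)] by simp
  moreover have "fst x i = 0" for i
    using f[of i] f[of "- i"] IJ[of i] trans_lattice_odd[OF carrier_fst[OF xc], of i]
      trans_lattice_notin[OF carrier_fst[OF xc], of i] by (cases "i \<in> J") auto
  then have "fst x = 0" by auto
  ultimately show ?thesis by (simp add: one_G prod_eq_iff)
qed

section \<open>Word length as the number of inversions\<close>

abbreviation Ga :: "aff monoid" where "Ga \<equiv> G\<lparr>carrier := Wa\<rparr>"

lemma inv_Ga: "x \<in> Wa \<Longrightarrow> inv\<^bsub>Ga\<^esub> x = ginv x"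
  using G.m_inv_consistent[OF aff_weyl_subgroup] by simp

lemma word_exists:
  assumes "w \<in> Wa"
  shows "\<exists>ss. length ss = len w \<and> set ss \<subseteq> aff_simple_refls T n \<and> w = foldr (\<cdot>) ss \<one>\<^bsub>G\<^esub>"
  using assms
proof (induction "len w" arbitrary: w)
  case 0
  then have "w = \<one>\<^bsub>G\<^esub>" using Wa_len_zero by simp
  then show ?case using 0 by (auto intro!: exI[of _ "[]"])
next
  case (Suc m)
  have wc: "w \<in> carrier G" using Suc by simp
  obtain i j k where s: "simple i j k" "aroot i j k (ap w a0) < 0"
    using simple_descent[OF wc] Suc.hyps by auto
  let ?s = "arefl i j k"
  note I = simple_I[OF s(1)]
  have d: "Suc (len (?s \<cdot> w)) = len w" using len_arefl_down[OF wc s] .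
  have "?s \<cdot> w \<in> Wa" using Wa_mult arefl_Wa[OF I] Suc.prems by blast
  then obtain ss where ss: "length ss = len (?s \<cdot> w)" "set ss \<subseteq> aff_simple_refls T n"
    "?s \<cdot> w = foldr (\<cdot>) ss \<one>\<^bsub>G\<^esub>" using Suc.hyps(1)[of "?s \<cdot> w"] Suc.hyps(2) d by auto
  have "w = foldr (\<cdot>) (?s # ss) \<one>\<^bsub>G\<^esub>" using arefl_cancel[OF I wc] by (simp flip: ss(3))
  moreover have "set (?s # ss) \<subseteq> aff_simple_refls T n" using ss(2) s(1) by (auto simp: aff_simple_refls_eq)
  moreover have "length (?s # ss) = len w" using ss(1) d by simp
  ultimately show ?case by blast
qed

lemma len_word:
  assumes "set ss \<subseteq> aff_simple_refls T n"
  shows "foldr (\<cdot>) ss \<one>\<^bsub>G\<^esub> \<in> carrier G \<and> len (foldr (\<cdot>) ss \<one>\<^bsub>G\<^esub>) \<le> length ss"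
  using assms
proof (induction ss)
  case Nil
  have "Inv \<one>\<^bsub>G\<^esub> = {}" by (auto simp: Inv_def)
  then show ?case by (simp add: len_def)
next
  case (Cons s ss)
  then obtain i j k where s: "s = arefl i j k" "simple i j k" by (auto simp: aff_simple_refls_eq)
  then have "s \<in> carrier G" "len s = 1" using len_simple by simp_all
  then show ?case using Cons len_subadd[of s "foldr (\<cdot>) ss \<one>\<^bsub>G\<^esub>"] by auto
qed

lemma word_length_len:
  assumes "w \<in> Wa" shows "word_length Ga (aff_simple_refls T n) w = len w"
  unfolding word_length_def
proof (rule Least_equality)
  show "\<exists>ss. length ss = len w \<and> set ss \<subseteq> aff_simple_refls T n \<and> w = foldr (\<otimes>\<^bsub>Ga\<^esub>) ss \<one>\<^bsub>Ga\<^esub>"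
    using word_exists[OF assms] by simp
next
  fix k assume "\<exists>ss. length ss = k \<and> set ss \<subseteq> aff_simple_refls T n \<and> w = foldr (\<otimes>\<^bsub>Ga\<^esub>) ss \<one>\<^bsub>Ga\<^esub>"
  then show "len w \<le> k" using len_word by auto
qed

section \<open>Bruhat order\<close>

text \<open>Reflections multiply on the left and in the whole group, where they are read off from
  signs at \<open>a0\<close>. The order of the statement multiplies on the right inside
  \<open>Wa\<close>; \<open>ble_bruhat_le\<close> passes to it, and \<open>bruhat_le_len\<close>
  returns from it to lengths.\<close>

definition bstep :: "aff \<Rightarrow> aff \<Rightarrow> bool" where
  "bstep x y \<longleftrightarrow> x \<in> carrier G \<and>
     (\<exists>i j k. i \<in> I \<and> j \<in> I \<and> i \<noteq> j \<and> y = arefl i j k \<cdot> x) \<and> len x < len y"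

abbreviation ble :: "aff \<Rightarrow> aff \<Rightarrow> bool" where "ble \<equiv> bstep\<^sup>*\<^sup>*"

lemma bstep_carrier: "bstep x y \<Longrightarrow> x \<in> carrier G" "bstep x y \<Longrightarrow> y \<in> carrier G"
  by (auto simp: bstep_def)

lemma ble_len: "ble x y \<Longrightarrow> x = y \<or> len x < len y"
  by (induction rule: rtranclp_induct) (auto simp: bstep_def)

lemma ble_carrier: "ble x y \<Longrightarrow> x \<in> carrier G \<longleftrightarrow> y \<in> carrier G"
  by (induction rule: rtranclp_induct) (auto dest: bstep_carrier)

lemma bstep_iff:
  assumes "x \<in> carrier G" "i \<in> I" "j \<in> I" "i \<noteq> j" "aroot i j k a0 > 0"
  shows "bstep x (arefl i j k \<cdot> x) \<longleftrightarrow> aroot i j k (ap x a0) > 0"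
  using len_arefl_gt[OF assms] assms unfolding bstep_def by blast

lemma bstep_E:
  assumes "bstep x y"
  obtains i j k where "x \<in> carrier G" "i \<in> I" "j \<in> I" "i \<noteq> j" "aroot i j k a0 > 0"
    "y = arefl i j k \<cdot> x" "aroot i j k (ap x a0) > 0"
proof -
  obtain i j k where r: "x \<in> carrier G" "i \<in> I" "j \<in> I" "i \<noteq> j" "y = arefl i j k \<cdot> x"
    using assms by (auto simp: bstep_def)
  obtain i' j' k' where r': "i' \<in> I" "j' \<in> I" "i' \<noteq> j'" "arefl i' j' k' = arefl i j k" "aroot i' j' k' a0 > 0"
    using arefl_pos_rep r(2-4) by metis
  then have "aroot i' j' k' (ap x a0) > 0" using bstep_iff[OF r(1) r'(1-3,5)] assms r by simp
  then show thesis using that r r' by metis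
qed

text \<open>A simple reflection keeps every root positive at \<open>a0\<close> except its own. So
  the conjugated reflection still raises the length, unless the step is that simple reflection, in
  which case it leads from \<open>x\<close> to \<open>y\<close>.\<close>

lemma bstep_lift_left:
  assumes st: "bstep x y" and s: "simple a b c"
  shows "arefl a b c \<cdot> x = y \<or> bstep (arefl a b c \<cdot> x) (arefl a b c \<cdot> y)"
proof -
  let ?s = "arefl a b c"
  note I = simple_I[OF s]
  have sc: "?s \<in> carrier G" using s by simp
  obtain i j k where r: "x \<in> carrier G" "i \<in> I" "j \<in> I" "i \<noteq> j" "aroot i j k a0 > 0"
    "y = arefl i j k \<cdot> x" "aroot i j k (ap x a0) > 0" using st bstep_E by blast
  show ?thesis
  proof (cases "aroot i j k = aroot a b c")
    case True
    then show ?thesis using arefl_aroot_cong r I by metis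
  next
    case False
    obtain k' where k': "snd ?s i \<in> I" "snd ?s j \<in> I" "snd ?s i \<noteq> snd ?s j"
      "?s \<cdot> arefl i j k = arefl (snd ?s i) (snd ?s j) k' \<cdot> ?s"
      "\<And>p. aroot (snd ?s i) (snd ?s j) k' (ap ?s p) = aroot i j k p"
      using arefl_conj[OF sc r(2-4)] by metis
    have "aroot (snd ?s i) (snd ?s j) k' a0 = aroot i j k (ap ?s a0)"
      using k'(5)[of "ap ?s a0"] sc arefl_arefl[OF I] by (simp flip: ap_mult)
    then have 1: "aroot (snd ?s i) (snd ?s j) k' a0 > 0"
      using simple_ap_pos[OF s aroot_AR[OF r(2-4)] r(5) False] by simp
    have 2: "aroot (snd ?s i) (snd ?s j) k' (ap (?s \<cdot> x) a0) > 0"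
      using k'(5)[of "ap x a0"] r sc by (simp add: ap_mult)
    have "?s \<cdot> y = arefl (snd ?s i) (snd ?s j) k' \<cdot> (?s \<cdot> x)"
      using k' r sc by (simp flip: G.m_assoc)
    then show ?thesis using bstep_iff[of "?s \<cdot> x", OF _ k'(1-3) 1] 2 r sc by simp
  qed
qed

text \<open>Multiplying \<open>x\<close> on the right by a simple reflection is a left reflection in
  the transported root. If that is the root of the step, \<open>y\<close> is reached; otherwise the
  sign of the step's root at the image of \<open>a0\<close> is unchanged.\<close>

lemma bstep_lift_right:
  assumes st: "bstep x y" and s: "simple a b c"
  shows "x \<cdot> arefl a b c = y \<or> bstep (x \<cdot> arefl a b c) (y \<cdot> arefl a b c)"
proof -
  let ?s = "arefl a b c"
  note I = simple_I[OF s]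
  have sc: "?s \<in> carrier G" using s by simp
  obtain i j k where r: "x \<in> carrier G" "i \<in> I" "j \<in> I" "i \<noteq> j" "aroot i j k a0 > 0"
    "y = arefl i j k \<cdot> x" "aroot i j k (ap x a0) > 0" using st bstep_E by blast
  obtain c' where c': "snd x a \<in> I" "snd x b \<in> I" "snd x a \<noteq> snd x b"
    "x \<cdot> ?s = arefl (snd x a) (snd x b) c' \<cdot> x"
    "\<And>p. aroot (snd x a) (snd x b) c' (ap x p) = aroot a b c p"
    using arefl_conj[OF r(1) I] by metis
  show ?thesis
  proof (cases "aroot i j k = aroot (snd x a) (snd x b) c'")
    case True
    then show ?thesis using arefl_aroot_cong r c' by metis
  next
    case False
    let ?g = "\<lambda>p. aroot i j k (ap x p)"
    have "?g \<noteq> aroot a b c"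
    proof
      assume g: "?g = aroot a b c"
      have "aroot i j k p = aroot (snd x a) (snd x b) c' p" for p
      proof -
        have "aroot i j k p = ?g (ap (ginv x) p)" using r by simp
        also have "\<dots> = aroot a b c (ap (ginv x) p)" by (rule fun_cong[OF g])
        also have "\<dots> = aroot (snd x a) (snd x b) c' p" using c'(5)[of "ap (ginv x) p"] r by simp
        finally show ?thesis .
      qed
      then show False using False by blast
    qed
    then have "?g (ap ?s a0) > 0"
      using simple_ap_pos[OF s AR_ap[OF aroot_AR[OF r(2-4)] r(1)]] r(7) by simp
    then have "aroot i j k (ap (x \<cdot> ?s) a0) > 0" using r sc by (simp add: ap_mult)
    then show ?thesis using bstep_iff[of "x \<cdot> ?s", OF _ r(2-5)] r sc by (simp add: G.m_assoc)
  qed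
qed

text \<open>The lifting property in a form without case distinctions on lengths, obtained by
  following a chain of steps.\<close>

lemma ble_lift_left:
  assumes "ble x w" "simple a b c"
  shows "ble (arefl a b c \<cdot> x) (arefl a b c \<cdot> w) \<or> ble (arefl a b c \<cdot> x) w"
    and "x \<in> carrier G \<Longrightarrow> ble (arefl a b c \<cdot> x) (arefl a b c \<cdot> w) \<or> ble x (arefl a b c \<cdot> w)"
proof -
  show "ble (arefl a b c \<cdot> x) (arefl a b c \<cdot> w) \<or> ble (arefl a b c \<cdot> x) w"
    using assms(1)
  proof (induction rule: rtranclp_induct)
    case (step y z)
    then show ?case using bstep_lift_left[OF step(2) assms(2)] rtranclp.rtrancl_into_rtrancl[of bstep] by blast
  qed simp
next
  assume x: "x \<in> carrier G"
  show "ble (arefl a b c \<cdot> x) (arefl a b c \<cdot> w) \<or> ble x (arefl a b c \<cdot> w)"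
    using assms(1)
  proof (induction rule: rtranclp_induct)
    case (step y z)
    show ?case
    proof (cases "arefl a b c \<cdot> y = z")
      case True
      have "y \<in> carrier G" using step bstep_carrier by blast
      then have "arefl a b c \<cdot> z = y" using True arefl_cancel simple_I[OF assms(2)] by metis
      then show ?thesis using step by simp
    next
      case False
      then have "bstep (arefl a b c \<cdot> y) (arefl a b c \<cdot> z)" using bstep_lift_left step assms by blast
      then show ?thesis using step.IH by (metis rtranclp.rtrancl_into_rtrancl)
    qed
  qed simp
qed

lemma ble_lift_right:
  assumes "ble x w" "simple a b c"
  shows "ble (x \<cdot> arefl a b c) (w \<cdot> arefl a b c) \<or> ble (x \<cdot> arefl a b c) w"
    and "x \<in> carrier G \<Longrightarrow> ble (x \<cdot> arefl a b c) (w \<cdot> arefl a b c) \<or> ble x (w \<cdot> arefl a b c)"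
proof -
  show "ble (x \<cdot> arefl a b c) (w \<cdot> arefl a b c) \<or> ble (x \<cdot> arefl a b c) w"
    using assms(1)
  proof (induction rule: rtranclp_induct)
    case (step y z)
    then show ?case using bstep_lift_right[OF step(2) assms(2)] by (metis rtranclp.rtrancl_into_rtrancl)
  qed simp
next
  assume x: "x \<in> carrier G"
  show "ble (x \<cdot> arefl a b c) (w \<cdot> arefl a b c) \<or> ble x (w \<cdot> arefl a b c)"
    using assms(1)
  proof (induction rule: rtranclp_induct)
    case (step y z)
    show ?case
    proof (cases "y \<cdot> arefl a b c = z")
      case True
      have "y \<in> carrier G" using step bstep_carrier by blast
      then have "z \<cdot> arefl a b c = y" using True arefl_cancel' simple_I[OF assms(2)] by metis
      then show ?thesis using step by simp
    next
      case False
      then have "bstep (y \<cdot> arefl a b c) (z \<cdot> arefl a b c)" using bstep_lift_right step assms by blast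
      then show ?thesis using step.IH by (metis rtranclp.rtrancl_into_rtrancl)
    qed
  qed simp
qed

lemma len_left_cases:
  assumes "x \<in> carrier G" "simple a b c"
  shows "len (arefl a b c \<cdot> x) = Suc (len x) \<or> Suc (len (arefl a b c \<cdot> x)) = len x"
  using len_arefl_up[OF assms] len_arefl_down[OF assms] AR_apa0_nz[OF simple_AR[OF assms(2)] assms(1)]
  by linarith

lemma len_right_eq:
  assumes "x \<in> carrier G" "simple a b c"
  shows "len (x \<cdot> arefl a b c) = len (arefl a b c \<cdot> ginv x)"
  using len_inv[of "x \<cdot> arefl a b c"] assms inv_arefl[OF simple_I[OF assms(2)]]
  by (simp add: G.inv_mult_group)

lemma len_right_cases:
  assumes "x \<in> carrier G" "simple a b c"
  shows "len (x \<cdot> arefl a b c) = Suc (len x) \<or> Suc (len (x \<cdot> arefl a b c)) = len x"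
  using len_right_eq[OF assms] len_left_cases[of "ginv x", OF _ assms(2)] len_inv assms by simp

lemma bstep_left: "x \<in> carrier G \<Longrightarrow> simple a b c \<Longrightarrow> len x < len (arefl a b c \<cdot> x) \<Longrightarrow> bstep x (arefl a b c \<cdot> x)"
  unfolding bstep_def using simple_I by blast

lemma bstep_right:
  assumes "x \<in> carrier G" "simple a b c" "len x < len (x \<cdot> arefl a b c)"
  shows "bstep x (x \<cdot> arefl a b c)"
proof -
  obtain c' where "snd x a \<in> I" "snd x b \<in> I" "snd x a \<noteq> snd x b"
    "x \<cdot> arefl a b c = arefl (snd x a) (snd x b) c' \<cdot> x"
    using arefl_conj[OF assms(1) simple_I[OF assms(2)]] by metis
  then show ?thesis using assms unfolding bstep_def by blast
qed

text \<open>Each one-sided multiplication changes the length by one, so a shorter conjugate is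
  shorter by two and both multiplications go down.\<close>

lemma simple_conj_down:
  assumes w: "w \<in> carrier G" and s: "simple a b c"
    and l: "len (arefl a b c \<cdot> w \<cdot> arefl a b c) < len w"
  shows "ble (arefl a b c \<cdot> w \<cdot> arefl a b c) w"
proof -
  let ?s = "arefl a b c"
  have sc: "?s \<in> carrier G" using s by simp
  note I = simple_I[OF s]
  have l2: "len (?s \<cdot> w) < len w" "len (?s \<cdot> w \<cdot> ?s) < len (?s \<cdot> w)"
    using l len_left_cases[OF w s] len_right_cases[of "?s \<cdot> w", OF _ s] sc w by auto
  have "bstep (?s \<cdot> w) w"
    using bstep_left[of "?s \<cdot> w", OF _ s] arefl_cancel[OF I w] l2 sc w by simp
  moreover have "bstep (?s \<cdot> w \<cdot> ?s) (?s \<cdot> w)"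
    using bstep_right[of "?s \<cdot> w \<cdot> ?s", OF _ s] arefl_cancel'[OF I, of "?s \<cdot> w"] l2 sc w by simp
  ultimately show ?thesis by (meson converse_rtranclp_into_rtranclp r_into_rtranclp)
qed

text \<open>Carries a smaller element across a conjugation that keeps the length; both candidates
  for \<open>y\<close> lie in the fiber of \<open>x\<close>. If one of the two one-sided products is
  shorter than \<open>w\<close>, lifting first on that side and then on the other gives the claim;
  if both are longer, \<open>w\<close> commutes with the reflection.\<close>

lemma simple_conj_transfer:
  assumes w: "w \<in> carrier G" and s: "simple a b c"
    and l: "len (arefl a b c \<cdot> w \<cdot> arefl a b c) = len w"
    and x: "ble x w" "len x < len w"
  shows "\<exists>y. (y = x \<or> y = arefl a b c \<cdot> x \<cdot> arefl a b c) \<and>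
    ble y (arefl a b c \<cdot> w \<cdot> arefl a b c) \<and> len y < len w"
proof -
  let ?s = "arefl a b c"
  let ?w = "?s \<cdot> w \<cdot> ?s" and ?x = "?s \<cdot> x \<cdot> ?s"
  have sc: "?s \<in> carrier G" using s by simp
  note I = simple_I[OF s]
  have xc: "x \<in> carrier G" using x w ble_carrier by blast
  have a1: "?w = ?s \<cdot> (w \<cdot> ?s)" and a2: "?x = ?s \<cdot> (x \<cdot> ?s)"
    using sc w xc by (simp_all add: G.m_assoc)
  have xx: "?s \<cdot> (?s \<cdot> z \<cdot> ?s) \<cdot> ?s = z" if z: "z \<in> carrier G" for z
  proof -
    have "?s \<cdot> (?s \<cdot> z \<cdot> ?s) = ?s \<cdot> (?s \<cdot> z) \<cdot> ?s"
      using z sc by (simp add: G.m_assoc)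
    also have "\<dots> = z \<cdot> ?s" by (simp only: arefl_cancel[OF I z])
    finally show ?thesis by (simp only: arefl_cancel'[OF I z])
  qed
  have fin: ?thesis if "ble x ?w \<or> ble ?x ?w"
  proof (cases "ble x ?w")
    case False
    then have b: "ble ?x ?w" using that by blast
    have "?x \<noteq> ?w"
    proof
      assume "?x = ?w"
      then have "x = w" using xx[OF xc] xx[OF w] by metis
      then show False using x by simp
    qed
    then have "len ?x < len w" using ble_len[OF b] l by simp
    then show ?thesis using b by blast
  qed (use x in blast)
  consider "len (?s \<cdot> w) < len w" | "len (w \<cdot> ?s) < len w"
    | "len w < len (?s \<cdot> w)" "len w < len (w \<cdot> ?s)"
    using len_left_cases[OF w s] len_right_cases[OF w s] by linarith
  then show ?thesis
  proof cases
    case 1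
    then have up: "bstep (?s \<cdot> w) ?w" using bstep_right[of "?s \<cdot> w", OF _ s] l sc w by simp
    show ?thesis
    proof (cases "ble x (?s \<cdot> w)")
      case True
      then have "ble x ?w" using rtranclp.rtrancl_into_rtrancl[of bstep, OF _ up] by blast
      then show ?thesis using fin by blast
    next
      case False
      then have "ble (?s \<cdot> x) (?s \<cdot> w)" using ble_lift_left(2)[OF x(1) s xc] by blast
      then have "ble ?x ?w \<or> ble ?x (?s \<cdot> w)" by (rule ble_lift_right(1)[OF _ s])
      then have "ble ?x ?w" using rtranclp.rtrancl_into_rtrancl[of bstep, OF _ up] by blast
      then show ?thesis using fin by blast
    qed
  next
    case 2
    then have up: "bstep (w \<cdot> ?s) ?w" using bstep_left[of "w \<cdot> ?s", OF _ s] l sc w a1 by simp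
    show ?thesis
    proof (cases "ble x (w \<cdot> ?s)")
      case True
      then have "ble x ?w" using rtranclp.rtrancl_into_rtrancl[of bstep, OF _ up] by blast
      then show ?thesis using fin by blast
    next
      case False
      then have "ble (x \<cdot> ?s) (w \<cdot> ?s)" using ble_lift_right(2)[OF x(1) s xc] by blast
      then have "ble ?x ?w \<or> ble ?x (w \<cdot> ?s)" unfolding a1 a2 by (rule ble_lift_left(1)[OF _ s])
      then have "ble ?x ?w" using rtranclp.rtrancl_into_rtrancl[of bstep, OF _ up] by blast
      then show ?thesis using fin by blast
    qed
  next
    \<comment> \<open>If \<open>s w\<close> and \<open>w s\<close> differed, \<open>s w\<close>
      would be shorter than \<open>s w s\<close>, whose length is that of \<open>w\<close>.\<close>
    case 3
    then have "bstep w (w \<cdot> ?s)" using bstep_right[OF w s] by simp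
    then have "?s \<cdot> w = w \<cdot> ?s \<or> bstep (?s \<cdot> w) ?w" using bstep_lift_left[OF _ s] a1 by metis
    then have "?s \<cdot> w = w \<cdot> ?s" using 3 l by (auto simp: bstep_def)
    then have "?w = w" using arefl_cancel'[OF I w] by simp
    then have "ble x ?w" using x(1) by simp
    then show ?thesis using x(2) by blast
  qed
qed

section \<open>Comparison with the Bruhat order of the Coxeter system\<close>

lemma length_zero_iff: "x \<in> length_zero T n \<longleftrightarrow> x \<in> carrier G \<and> len x = 0"
proof (cases "x \<in> carrier G")
  case True
  then show ?thesis unfolding length_zero_def mem_Collect_eq aff_length_len[OF True] by simp
qed (simp add: length_zero_def)

text \<open>Simple descents are stripped off on the left until length zero is reached.\<close>

lemma aff_weyl_decomp:
  assumes "x \<in> carrier G"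
  shows "\<exists>u \<in> Wa. \<exists>\<tau> \<in> length_zero T n. x = u \<cdot> \<tau>"
  using assms
proof (induction "len x" arbitrary: x)
  case 0
  then show ?case using Wa_one by (intro bexI[of _ "\<one>\<^bsub>G\<^esub>"] bexI[of _ x]) (auto simp: length_zero_iff)
next
  case (Suc m)
  obtain i j k where s: "simple i j k" "aroot i j k (ap x a0) < 0"
    using simple_descent[OF Suc.prems] Suc.hyps by auto
  let ?s = "arefl i j k"
  note I = simple_I[OF s(1)]
  have "Suc (len (?s \<cdot> x)) = len x" using len_arefl_down[OF Suc.prems s] .
  then obtain u \<tau> where u: "u \<in> Wa" "\<tau> \<in> length_zero T n" "?s \<cdot> x = u \<cdot> \<tau>"
    using Suc.hyps(1)[of "?s \<cdot> x"] Suc.hyps(2) Suc.prems s(1) by auto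
  have "x = ?s \<cdot> (u \<cdot> \<tau>)" using arefl_cancel[OF I Suc.prems] by (simp flip: u(3))
  also have "\<dots> = (?s \<cdot> u) \<cdot> \<tau>" using u s(1) by (simp add: G.m_assoc length_zero_iff)
  finally show ?case using u Wa_mult arefl_Wa[OF I] by blast
qed

lemma bruhat_le_len:
  assumes "bruhat_le T n x y" shows "x = y \<or> len x < len y"
proof -
  obtain u v \<tau> where u: "u \<in> Wa" "v \<in> Wa" "\<tau> \<in> length_zero T n" "x = u \<cdot> \<tau>" "y = v \<cdot> \<tau>"
    and c: "cox_bruhat_le Ga (aff_simple_refls T n) u v"
    using assms unfolding bruhat_le_def by blast
  have "u = v \<or> word_length Ga (aff_simple_refls T n) u < word_length Ga (aff_simple_refls T n) v"
    using c unfolding cox_bruhat_le_def by (induction rule: rtranclp_induct) auto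
  then have "u = v \<or> len u < len v" using word_length_len u by simp
  moreover have "len x = len u" "len y = len v" using u len_mult_zero by (auto simp: length_zero_iff)
  ultimately show ?thesis using u by auto
qed

text \<open>A left factor \<open>r\<close> of \<open>v\<close> is the right factor
  \<open>v^(-1) r v\<close>, and multiplication by an element of length zero preserves lengths, so
  each step descends to the \<open>Wa\<close>-parts.\<close>

lemma ble_bruhat_le:
  assumes "ble x y" "x \<in> carrier G" shows "bruhat_le T n x y"
proof -
  obtain u \<tau> where u: "u \<in> Wa" "\<tau> \<in> length_zero T n" "x = u \<cdot> \<tau>"
    using aff_weyl_decomp assms(2) by blast
  have tc: "\<tau> \<in> carrier G" "len \<tau> = 0" using u by (auto simp: length_zero_iff)
  have "\<exists>v \<in> Wa. y = v \<cdot> \<tau> \<and> cox_bruhat_le Ga (aff_simple_refls T n) u v"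
    using assms(1)
  proof (induction rule: rtranclp_induct)
    case base
    then show ?case using u unfolding cox_bruhat_le_def by blast
  next
    case (step y z)
    then obtain v where v: "v \<in> Wa" "y = v \<cdot> \<tau>" "cox_bruhat_le Ga (aff_simple_refls T n) u v" by blast
    obtain i j k where r: "i \<in> I" "j \<in> I" "i \<noteq> j" "z = arefl i j k \<cdot> y" and l: "len y < len z"
      using step(2) unfolding bstep_def by blast
    let ?r = "arefl i j k"
    have rW: "?r \<in> Wa" using arefl_Wa r by blast
    obtain g a b c where g: "g \<in> Wa" "simple a b c" "?r = g \<cdot> arefl a b c \<cdot> ginv g"
      using arefl_conj_simple r by metis
    have sc: "arefl a b c \<in> carrier G" using g by simp
    \<comment> \<open>If \<open>r\<close> is the conjugate of a simple reflection by
      \<open>g\<close>, then \<open>v^(-1) r v\<close> is its conjugate by this element.\<close>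
    define h where "h = ginv v \<cdot> g"
    have hW: "h \<in> Wa" unfolding h_def using Wa_mult Wa_inv v g by blast
    define t where "t = h \<cdot> arefl a b c \<cdot> ginv h"
    have "t = h \<otimes>\<^bsub>Ga\<^esub> arefl a b c \<otimes>\<^bsub>Ga\<^esub> inv\<^bsub>Ga\<^esub> h" using inv_Ga[OF hW] by (simp add: t_def)
    then have tR: "t \<in> cox_refls Ga (aff_simple_refls T n)"
    proof -
      have "arefl a b c \<in> aff_simple_refls T n" unfolding aff_simple_refls_eq using g(2) by blast
      moreover have "h \<in> carrier Ga" using hW by simp
      ultimately show ?thesis unfolding cox_refls_def using \<open>t = h \<otimes>\<^bsub>Ga\<^esub> arefl a b c \<otimes>\<^bsub>Ga\<^esub> inv\<^bsub>Ga\<^esub> h\<close> by blast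
    qed
    have rv: "?r \<cdot> v = v \<cdot> t"
    proof -
      have vh: "v \<cdot> h = g" unfolding h_def using v g(1) by (simp flip: G.m_assoc)
      have ih: "ginv h = ginv g \<cdot> v" unfolding h_def using v g(1) by (simp add: G.inv_mult_group)
      have "v \<cdot> t = (v \<cdot> h) \<cdot> arefl a b c \<cdot> ginv h"
        unfolding t_def using v hW sc by (simp add: G.m_assoc)
      also have "\<dots> = ?r \<cdot> v" unfolding vh ih g(3) using v g(1) sc by (simp add: G.m_assoc)
      finally show ?thesis by simp
    qed
    have rvW: "?r \<cdot> v \<in> Wa" using Wa_mult rW v by blast
    have z: "z = (?r \<cdot> v) \<cdot> \<tau>" using r v tc rW by (simp add: G.m_assoc)
    have "len v < len (?r \<cdot> v)" using l z v tc rvW len_mult_zero by simp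
    then have "word_length Ga (aff_simple_refls T n) v < word_length Ga (aff_simple_refls T n) (?r \<cdot> v)"
      using word_length_len v rvW by simp
    then have "cox_bruhat_le Ga (aff_simple_refls T n) u (?r \<cdot> v)"
      using v(3) tR rv v(1) unfolding cox_bruhat_le_def
      by (intro rtranclp.rtrancl_into_rtrancl[OF v(3)[unfolded cox_bruhat_le_def]]) auto
    then show ?case using z rvW by blast
  qed
  then show ?thesis using u unfolding bruhat_le_def by blast
qed

end

section \<open>Newton vectors\<close>

lemma permutes_power_id:
  assumes "finite S" "\<sigma> permutes S"
  shows "\<exists>m\<ge>1. \<sigma> ^^ m = id"
proof -
  have p: "(\<sigma> ^^ m) permutes S" for m
  proof (induction m)
    case 0 show ?case by (simp only: funpow.simps(1) permutes_id)
  next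
    case (Suc m) show ?case by (simp only: funpow.simps(2)) (rule permutes_compose[OF Suc assms(2)])
  qed
  have "\<not> inj (\<lambda>m. \<sigma> ^^ m)"
  proof
    assume i: "inj (\<lambda>m. \<sigma> ^^ m)"
    have "range (\<lambda>m. \<sigma> ^^ m) \<subseteq> {\<tau>. \<tau> permutes S}" using p by auto
    then have "finite (range (\<lambda>m. \<sigma> ^^ m))" using finite_permutations[OF assms(1)] finite_subset by blast
    then show False using i finite_imageD by blast
  qed
  then obtain a b where ab: "a \<noteq> b" "\<sigma> ^^ a = \<sigma> ^^ b" by (auto simp: inj_def)
  have *: "\<sigma> ^^ (b - a) = id" if "a < b" "\<sigma> ^^ a = \<sigma> ^^ b" for a b
  proof
    fix x
    have "(\<sigma> ^^ a) ((\<sigma> ^^ (b - a)) x) = (\<sigma> ^^ (a + (b - a))) x" by (simp only: funpow_add comp_apply)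
    also have "\<dots> = (\<sigma> ^^ a) x" using that by simp
    finally show "(\<sigma> ^^ (b - a)) x = id x" using permutes_inj[OF p[of a]] by (simp add: inj_eq)
  qed
  show ?thesis
  proof (cases "a < b")
    case True then show ?thesis using *[OF True ab(2)] by (intro exI[of _ "b - a"]) simp
  next
    case False then show ?thesis using *[of b a] ab by (intro exI[of _ "a - b"]) simp
  qed
qed

context affine_weyl
begin

lemma snd_pow: "snd (x [^]\<^bsub>G\<^esub> (m::nat)) = snd x ^^ m"
  by (induction m) (simp_all add: one_G mult_G funpow_Suc_right del: funpow.simps)

lemma pow_id: "(\<chi>, id) [^]\<^bsub>G\<^esub> (k::nat) = (Defs.scale (of_nat k) \<chi>, id)"
proof (induction k)
  case 0
  have "Defs.scale (of_nat 0) \<chi> = 0" by (simp add: Defs.scale_def fun_eq_iff)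
  then show ?case by (simp only: G.nat_pow_0 one_G)
next
  case (Suc k)
  have "Defs.scale (of_nat k) \<chi> + \<chi> = Defs.scale (of_nat (Suc k)) \<chi>"
    by (simp add: Defs.scale_def fun_eq_iff distrib_right)
  then show ?case by (simp only: G.nat_pow_Suc Suc mult_G fst_conv snd_conv act_id comp_id)
qed

lemma pow_exists:
  assumes "x \<in> carrier G"
  obtains m \<chi> where "m \<ge> 1" "x [^]\<^bsub>G\<^esub> (m::nat) = (\<chi>, id)" "(\<chi>, id) \<in> carrier G"
proof -
  obtain m where "m \<ge> 1" "snd x ^^ m = id"
    using permutes_power_id[OF finite_J weyl_permutes[OF carrier_snd[OF assms]]] by blast
  then show thesis using that[of m "fst (x [^]\<^bsub>G\<^esub> m)"] snd_pow[of x m] assms G.nat_pow_closed[OF assms, of m]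
    by (metis prod.collapse)
qed

text \<open>Two exponents are compared through the power whose exponent is their product.\<close>

lemma newton_vecI:
  assumes x: "x \<in> carrier G" and m: "m \<ge> 1" "x [^]\<^bsub>G\<^esub> (m::nat) = (\<chi>, id)"
  shows "newton_vec T n x = Defs.scale (1 / of_nat m) \<chi>"
  unfolding newton_vec_def
proof (rule the_equality)
  show "\<exists>m'\<ge>1. \<exists>\<chi>'. x [^]\<^bsub>G\<^esub> (m'::nat) = (\<chi>', id) \<and> Defs.scale (1 / of_nat m) \<chi> = Defs.scale (1 / of_nat m') \<chi>'"
    using m by blast
next
  fix v assume "\<exists>m'\<ge>1. \<exists>\<chi>'. x [^]\<^bsub>G\<^esub> (m'::nat) = (\<chi>', id) \<and> v = Defs.scale (1 / of_nat m') \<chi>'"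
  then obtain m' \<chi>' where m': "m' \<ge> 1" "x [^]\<^bsub>G\<^esub> (m'::nat) = (\<chi>', id)" "v = Defs.scale (1 / of_nat m') \<chi>'" by blast
  have "(\<chi>, id) [^]\<^bsub>G\<^esub> m' = (\<chi>', id) [^]\<^bsub>G\<^esub> m"
    using x by (simp flip: m(2) m'(2) add: G.nat_pow_pow mult.commute)
  then have "Defs.scale (of_nat m') \<chi> = Defs.scale (of_nat m) \<chi>'" by (simp add: pow_id)
  then have "of_nat m' * \<chi> i = of_nat m * \<chi>' i" for i unfolding Defs.scale_def by (rule fun_cong)
  then show "v = Defs.scale (1 / of_nat m) \<chi>"
    using m(1) m'(1) unfolding m'(3) by (simp add: Defs.scale_def fun_eq_iff field_simps)
qed

lemma newton_vec_vecs: assumes "x \<in> carrier G" shows "newton_vec T n x \<in> vecs n"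
proof -
  obtain m \<chi> where m: "m \<ge> 1" "x [^]\<^bsub>G\<^esub> (m::nat) = (\<chi>, id)" "(\<chi>, id) \<in> carrier G"
    using pow_exists assms by blast
  then have "\<chi> \<in> vecs n" by (simp add: carrier_G trans_lattice_vecs)
  then show ?thesis unfolding newton_vecI[OF assms m(1,2)] vecs_iff Defs.scale_def by simp
qed

lemma lp_pow: assumes "x \<in> carrier G" "lp x v = v" shows "lp (x [^]\<^bsub>G\<^esub> (m::nat)) v = v"
  by (induction m) (simp_all add: lp_mult assms)

lemma ap_pow:
  assumes "x \<in> carrier G" "lp x v = v" "ap x p = p + v"
  shows "ap (x [^]\<^bsub>G\<^esub> (m::nat)) p = (\<lambda>i. p i + of_nat m * v i)"
proof (induction m)
  case (Suc m)
  have "ap (x [^]\<^bsub>G\<^esub> Suc m) p = ap (x [^]\<^bsub>G\<^esub> m) (p + v)" by (simp add: ap_mult assms)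
  also have "\<dots> = (\<lambda>i. p i + of_nat m * v i) + v" by (simp only: ap_add lp_pow[OF assms(1,2)] Suc)
  finally show ?case by (simp add: fun_eq_iff distrib_right)
qed simp

text \<open>The power \<open>m\<close> for which \<open>x\<close> becomes a translation moves
  \<open>p\<close> by \<open>m v\<close>. Newton vectors can therefore be found from one suitable
  point, without computing powers.\<close>

lemma newton_vec_eq:
  assumes x: "x \<in> carrier G" and "lp x v = v" "ap x p = p + v"
  shows "real_of_rat (newton_vec T n x i) = v i"
proof -
  obtain m \<chi> where m: "m \<ge> 1" "x [^]\<^bsub>G\<^esub> (m::nat) = (\<chi>, id)" using pow_exists x by blast
  have "ap (x [^]\<^bsub>G\<^esub> m) p i = p i + of_nat m * v i" using ap_pow[OF assms] by simp
  then have "real_of_rat (\<chi> i) = of_nat m * v i" using m by (simp add: ap_def)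
  then show ?thesis using m(1) unfolding newton_vecI[OF x m]
    by (simp add: Defs.scale_def of_rat_mult of_rat_divide)
qed

lemma pow_conj:
  assumes "x \<in> carrier G" "g \<in> carrier G"
  shows "(g \<cdot> x \<cdot> ginv g) [^]\<^bsub>G\<^esub> (m::nat) = g \<cdot> x [^]\<^bsub>G\<^esub> m \<cdot> ginv g"
proof (induction m)
  case 0 then show ?case using assms by simp
next
  case (Suc m)
  have "(g \<cdot> x \<cdot> ginv g) [^]\<^bsub>G\<^esub> Suc m = g \<cdot> x [^]\<^bsub>G\<^esub> m \<cdot> ginv g \<cdot> (g \<cdot> x \<cdot> ginv g)"
    using Suc by simp
  also have "\<dots> = g \<cdot> x [^]\<^bsub>G\<^esub> m \<cdot> ((ginv g \<cdot> g) \<cdot> x) \<cdot> ginv g"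
  proof -
    have "ginv g \<cdot> (g \<cdot> z) = z" if "z \<in> carrier G" for z
      using that assms(2) by (simp flip: G.m_assoc)
    then show ?thesis using assms by (simp add: G.m_assoc)
  qed
  also have "\<dots> = g \<cdot> x [^]\<^bsub>G\<^esub> Suc m \<cdot> ginv g" using assms by (simp add: G.m_assoc)
  finally show ?case .
qed

lemma newton_conj:
  assumes x: "x \<in> carrier G" and g: "g \<in> carrier G"
  shows "newton_vec T n (g \<cdot> x \<cdot> ginv g) = act (snd g) (newton_vec T n x)"
proof -
  obtain m \<chi> where m: "m \<ge> 1" "x [^]\<^bsub>G\<^esub> (m::nat) = (\<chi>, id)" "(\<chi>, id) \<in> carrier G"
    using pow_exists x by blast
  have w: "snd g \<in> weyl T n" using g by simp
  have 1: "snd g \<circ> inv_into UNIV (snd g) = id" using w by auto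
  have "g \<cdot> (\<chi>, id) \<cdot> ginv g = (fst g + act (snd g) \<chi> - act (snd g \<circ> inv_into UNIV (snd g)) (fst g), snd g \<circ> inv_into UNIV (snd g))"
    using w weyl_inv[OF w] g by (simp add: mult_G inv_G act_uminus act_comp)
  also have "\<dots> = (act (snd g) \<chi>, id)" unfolding 1 by simp
  finally have "(g \<cdot> x \<cdot> ginv g) [^]\<^bsub>G\<^esub> m = (act (snd g) \<chi>, id)"
    using pow_conj[OF x g, of m] m(2) by simp
  then show ?thesis using newton_vecI[OF _ m(1)] newton_vecI[OF x m(1,2)] x g by (simp add: act_scale)
qed

text \<open>Homogeneous, so it extends the length of translations to rational Newton vectors. On
  dominant \<open>v\<close> it is the pairing with the sum of the positive roots.\<close>

definition rho_norm :: "vec \<Rightarrow> rat" where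
  "rho_norm v = (\<Sum>\<alpha> \<in> pos_roots T n. \<bar>ip n v \<alpha>\<bar>)"

lemma rho_norm_scale: "rho_norm (Defs.scale c v) = \<bar>c\<bar> * rho_norm v"
proof -
  have "ip n (Defs.scale c v) \<alpha> = c * ip n v \<alpha>" for \<alpha>
    by (simp add: ip_def Defs.scale_def sum_distrib_left mult.assoc)
  then show ?thesis by (simp add: rho_norm_def abs_mult sum_distrib_left)
qed

text \<open>Twice this number is the sum over all roots, which the Weyl group permutes.\<close>

lemma rho_norm_act:
  assumes v: "v \<in> vecs n" and s: "\<sigma> \<in> weyl T n" shows "rho_norm (act \<sigma> v) = rho_norm v"
proof -
  define R where "R = {uv i j | i j. i \<in> I \<and> j \<in> I \<and> i \<noteq> j}"
  have 0: "a0 i \<noteq> a0 j" if "i \<in> I" "j \<in> I" "i \<noteq> j" for i j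
    using a0_inj[of i j 0] that by auto
  have R: "R = pos_roots T n \<union> neg_roots T n"
  proof -
    have "i \<in> I \<and> j \<in> I \<and> i \<noteq> j \<longleftrightarrow> i \<in> I \<and> j \<in> I \<and> a0 j < a0 i \<or> i \<in> I \<and> j \<in> I \<and> a0 i < a0 j" for i j
      using 0[of i j] by auto
    then show ?thesis unfolding R_def pos_roots_eq neg_roots_eq by blast
  qed
  have fn: "finite (neg_roots T n)" using finite_pos_roots by (simp add: neg_roots_def)
  have two: "(\<Sum>\<alpha>\<in>R. \<bar>ip n u \<alpha>\<bar>) = 2 * rho_norm u" for u
  proof -
    have "(\<Sum>\<alpha>\<in>neg_roots T n. \<bar>ip n u \<alpha>\<bar>) = (\<Sum>\<alpha>\<in>pos_roots T n. \<bar>ip n u (- \<alpha>)\<bar>)"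
      unfolding neg_roots_def by (subst sum.reindex) (auto simp: inj_on_def)
    also have "\<dots> = rho_norm u" by (simp add: rho_norm_def ip_def sum_negf)
    finally show ?thesis unfolding R
      using finite_pos_roots fn pos_neg_disjoint by (subst sum.union_disjoint) (auto simp: rho_norm_def)
  qed
  let ?u = "inv_into UNIV \<sigma>"
  have u: "?u \<in> weyl T n" using s weyl_inv by blast
  have bij: "bij_betw (act ?u) R R"
  proof (rule bij_betwI[where g = "act \<sigma>"])
    have *: "act \<tau> \<alpha> \<in> R" if "\<tau> \<in> weyl T n" "\<alpha> \<in> R" for \<tau> \<alpha>
    proof -
      obtain i j where ij: "\<alpha> = uv i j" "i \<in> I" "j \<in> I" "i \<noteq> j" using \<open>\<alpha> \<in> R\<close> unfolding R_def by blast
      then have "act \<tau> \<alpha> = uv (\<tau> i) (\<tau> j)" "\<tau> i \<in> I" "\<tau> j \<in> I" "\<tau> i \<noteq> \<tau> j"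
        using that(1) act_uv weyl_inv_f by (simp, simp, simp, metis)
      then show ?thesis unfolding R_def by blast
    qed
    show "act ?u \<in> R \<rightarrow> R" "act \<sigma> \<in> R \<rightarrow> R" using * u s by auto
    show "act \<sigma> (act ?u \<alpha>) = \<alpha>" "act ?u (act \<sigma> \<alpha>) = \<alpha>" for \<alpha>
      using s u by (simp_all add: act_def)
  qed
  have ip: "ip n (act \<sigma> v) \<alpha> = ip n v (act ?u \<alpha>)" if "\<alpha> \<in> R" for \<alpha>
  proof -
    obtain i j where ij: "\<alpha> = uv i j" "i \<in> I" "j \<in> I" using \<open>\<alpha> \<in> R\<close> unfolding R_def by blast
    then have J: "i \<in> J" "j \<in> J" "?u i \<in> J" "?u j \<in> J" using u by auto
    have "ip n (act \<sigma> v) \<alpha> = v (?u i) - v (?u j)"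
      using ip_uv[OF vecs_act[OF v s] J(1,2)] ij by (simp add: act_def)
    moreover have "ip n v (act ?u \<alpha>) = v (?u i) - v (?u j)"
      using ip_uv[OF v J(3,4)] act_uv[OF u] ij by simp
    ultimately show ?thesis by simp
  qed
  have "2 * rho_norm (act \<sigma> v) = (\<Sum>\<alpha>\<in>R. \<bar>ip n v (act ?u \<alpha>)\<bar>)"
    unfolding two[symmetric] using ip by (intro sum.cong) auto
  also have "\<dots> = 2 * rho_norm v" unfolding two[symmetric] by (rule sum.reindex_bij_betw[OF bij])
  finally show ?thesis by simp
qed

lemma len_translation:
  assumes "(\<chi>, id) \<in> carrier G" shows "of_nat (len (\<chi>, id)) = rho_norm \<chi>"
proof -
  have e: "{\<alpha>. \<alpha> \<in> pos_roots T n \<and> \<alpha> \<in> neg_roots T n} = {}" using pos_neg_disjoint by blast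
  have "aff_length T n (\<chi>, id) = rho_norm \<chi>"
    by (simp add: rho_norm_def e)
  then show ?thesis using aff_length_len[OF assms] by simp
qed

lemma len_pow_le: "x \<in> carrier G \<Longrightarrow> len (x [^]\<^bsub>G\<^esub> (m::nat)) \<le> m * len x"
proof (induction m)
  case 0
  have "Inv \<one>\<^bsub>G\<^esub> = {}" by (auto simp: Inv_def)
  then show ?case by (simp add: len_def)
next
  case (Suc m)
  then show ?case using len_subadd[of "x [^]\<^bsub>G\<^esub> m" x] by simp
qed

lemma rho_norm_le_len:
  assumes x: "x \<in> carrier G" shows "rho_norm (newton_vec T n x) \<le> of_nat (len x)"
proof -
  obtain m \<chi> where m: "m \<ge> 1" "x [^]\<^bsub>G\<^esub> (m::nat) = (\<chi>, id)" "(\<chi>, id) \<in> carrier G"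
    using pow_exists x by blast
  have "rho_norm \<chi> \<le> of_nat (m * len x)"
    using len_translation[OF m(3)] len_pow_le[OF x, of m] m(2) by (metis of_nat_le_iff)
  then show ?thesis using m(1) unfolding newton_vecI[OF x m(1,2)] rho_norm_scale by (simp add: field_simps)
qed

text \<open>If \<open>len x\<close> attains the norm, then \<open>x^(k m)\<close> is a translation
  of length exactly \<open>k m len x\<close>. By subadditivity this is at most
  \<open>m len (x^k)\<close>, which forces \<open>len (x^k) = k len x\<close>.\<close>

lemma good_iff:
  assumes x: "x \<in> carrier G" shows "good T n x \<longleftrightarrow> of_nat (len x) = rho_norm (newton_vec T n x)"
proof -
  obtain m \<chi> where m: "m \<ge> 1" "x [^]\<^bsub>G\<^esub> (m::nat) = (\<chi>, id)" "(\<chi>, id) \<in> carrier G"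
    using pow_exists x by blast
  have N: "rho_norm \<chi> = of_nat m * rho_norm (newton_vec T n x)"
    unfolding newton_vecI[OF x m(1,2)] rho_norm_scale using m(1) by simp
  have g: "good T n x \<longleftrightarrow> (\<forall>k\<ge>1. len (x [^]\<^bsub>G\<^esub> k) = k * len x)"
    unfolding good_def using x by (simp add: aff_length_len flip: of_nat_mult)
  show ?thesis
  proof
    assume "good T n x"
    then have "len (\<chi>, id) = m * len x" using g m by (metis)
    then have "of_nat m * of_nat (len x) = rho_norm \<chi>" using len_translation[OF m(3)] by (metis of_nat_mult)
    then show "of_nat (len x) = rho_norm (newton_vec T n x)" using N m(1) by simp
  next
    assume e: "of_nat (len x) = rho_norm (newton_vec T n x)"
    have "len (x [^]\<^bsub>G\<^esub> k) = k * len x" for k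
    proof -
      have p: "(x [^]\<^bsub>G\<^esub> k) [^]\<^bsub>G\<^esub> m = (Defs.scale (of_nat k) \<chi>, id)"
        using m(2) pow_id[of \<chi> k] x by (metis G.nat_pow_pow mult.commute)
      then have c: "(Defs.scale (of_nat k) \<chi>, id) \<in> carrier G" using x by (metis G.nat_pow_closed)
      have "of_nat (len ((x [^]\<^bsub>G\<^esub> k) [^]\<^bsub>G\<^esub> m)) = of_nat k * rho_norm \<chi>"
        unfolding p len_translation[OF c] rho_norm_scale by simp
      also have "\<dots> = of_nat (k * m * len x)" unfolding N e[symmetric] by simp
      finally have "len ((x [^]\<^bsub>G\<^esub> k) [^]\<^bsub>G\<^esub> m) = k * m * len x" by (simp only: of_nat_eq_iff)
      moreover have "len ((x [^]\<^bsub>G\<^esub> k) [^]\<^bsub>G\<^esub> m) \<le> m * len (x [^]\<^bsub>G\<^esub> k)" using len_pow_le x by simp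
      ultimately have "m * (k * len x) \<le> m * len (x [^]\<^bsub>G\<^esub> k)" by (simp add: ac_simps)
      then have "k * len x \<le> len (x [^]\<^bsub>G\<^esub> k)" using m(1) by simp
      then show ?thesis using len_pow_le[OF x, of k] by simp
    qed
    then show "good T n x" using g by blast
  qed
qed

section \<open>Fibers of f\<close>

lemma weyl_orbit_eq_iff:
  "weyl_orbit T n v = weyl_orbit T n u \<longleftrightarrow> (\<exists>\<sigma> \<in> weyl T n. v = act \<sigma> u)"
proof
  assume "weyl_orbit T n v = weyl_orbit T n u"
  moreover have "v \<in> weyl_orbit T n v" unfolding weyl_orbit_def using weyl_id act_id by (metis (mono_tags, lifting) mem_Collect_eq)
  ultimately show "\<exists>\<sigma> \<in> weyl T n. v = act \<sigma> u" by (auto simp: weyl_orbit_def)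
next
  assume "\<exists>\<sigma> \<in> weyl T n. v = act \<sigma> u"
  then obtain \<sigma> where s: "\<sigma> \<in> weyl T n" "v = act \<sigma> u" by blast
  have "act \<tau> u = act (\<tau> \<circ> inv_into UNIV \<sigma>) v" if "\<tau> \<in> weyl T n" for \<tau>
    using s that by (simp add: act_comp weyl_inv) (simp add: act_def)
  then have "weyl_orbit T n u \<subseteq> weyl_orbit T n v"
    unfolding weyl_orbit_def using weyl_comp[OF _ weyl_inv[OF s(1)]] by blast
  moreover have "act \<tau> v = act (\<tau> \<circ> \<sigma>) u" if "\<tau> \<in> weyl T n" for \<tau>
    using s that by (simp add: act_comp)
  then have "weyl_orbit T n v \<subseteq> weyl_orbit T n u"
    unfolding weyl_orbit_def using weyl_comp[OF _ s(1)] by blast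
  ultimately show "weyl_orbit T n v = weyl_orbit T n u" by blast
qed

lemma f_map_eq_iff:
  assumes "x \<in> carrier G" "y \<in> carrier G"
  shows "f_map T n x = f_map T n y \<longleftrightarrow>
    (\<exists>\<sigma> \<in> weyl T n. newton_vec T n x = act \<sigma> (newton_vec T n y)) \<and> Wa #>\<^bsub>G\<^esub> x = Wa #>\<^bsub>G\<^esub> y"
  unfolding f_map_def using weyl_orbit_eq_iff by simp

lemma f_map_conj:
  assumes "x \<in> carrier G" "g \<in> carrier G"
  shows "f_map T n (g \<cdot> x \<cdot> ginv g) = f_map T n x"
  using assms coset_conj[OF assms] newton_conj[OF assms] carrier_snd[OF assms(2)]
  by (subst f_map_eq_iff) auto

lemma f_map_rho_norm:
  assumes "x \<in> carrier G" "y \<in> carrier G" "f_map T n x = f_map T n y"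
  shows "rho_norm (newton_vec T n x) = rho_norm (newton_vec T n y)"
  using f_map_eq_iff[OF assms(1,2)] assms(3) rho_norm_act newton_vec_vecs[OF assms(2)] by metis

section \<open>Minimising the displacement over the closed alcove\<close>

text \<open>Only finitely many inequalities occur; \<open>alcove_AR\<close> recovers those of all
  roots positive at \<open>a0\<close>. The condition off \<open>J\<close> makes a point determined
  by the coordinates over which \<open>B\<close> sums. In type A the set contains whole lines in the
  diagonal direction.\<close>

definition alcove :: "(int \<Rightarrow> real) set" where
  "alcove = {p. odd_fun p \<and> (\<forall>l. l \<notin> J \<longrightarrow> p l = 0) \<and> (\<forall>i j k. simple i j k \<longrightarrow> aroot i j k p \<ge> 0)}"

lemma chamD: "p \<in> alcove \<Longrightarrow> odd_fun p" "p \<in> alcove \<Longrightarrow> l \<notin> J \<Longrightarrow> p l = 0"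
  "p \<in> alcove \<Longrightarrow> simple i j k \<Longrightarrow> aroot i j k p \<ge> 0"
  by (auto simp: alcove_def)

lemma alcove_AR: "p \<in> alcove \<Longrightarrow> \<beta> \<in> AR \<Longrightarrow> \<beta> a0 > 0 \<Longrightarrow> \<beta> p \<ge> 0"
  using AR_nonneg chamD by blast

lemma a0_alcove: "a0 \<in> alcove"
  unfolding alcove_def using simple_pos by (auto simp: a0_def less_imp_le)

text \<open>Summing over both signs doubles the inner product of odd vectors, and makes invariance
  under signed permutations a mere reindexing.\<close>

definition B :: "(int \<Rightarrow> real) \<Rightarrow> (int \<Rightarrow> real) \<Rightarrow> real" where
  "B u v = (\<Sum>l\<in>J. u l * v l)"

definition disp :: "aff \<Rightarrow> (int \<Rightarrow> real) \<Rightarrow> real" where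
  "disp w p = B (ap w p - p) (ap w p - p)"

lemma B_lp: assumes "w \<in> carrier G" shows "B (lp w u) (lp w v) = B u v"
proof -
  have "inv_into UNIV (snd w) permutes J" using assms by (simp add: permutes_inv weyl_permutes)
  then show ?thesis unfolding B_def lp_def
    using sum.permute[of "inv_into UNIV (snd w)" J "\<lambda>l. u l * v l"] by (simp add: comp_def)
qed

lemma B_add: "B (u + u') v = B u v + B u' v" "B v (u + u') = B v u + B v u'"
  and B_diff: "B (u - u') v = B u v - B u' v" "B v (u - u') = B v u - B v u'"
  by (simp_all add: B_def algebra_simps sum.distrib sum_subtractf)

lemma B_scale: "B (\<lambda>l. c * u l) v = c * B u v" "B u (\<lambda>l. c * v l) = c * B u v"
  by (simp_all add: B_def sum_distrib_left ac_simps)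

lemma B_commute: "B u v = B v u"
  by (simp add: B_def mult.commute)

lemma B_self_pos: assumes "l \<in> J" "u l \<noteq> 0" shows "B u u > 0"
proof -
  have "0 < u l * u l" using assms(2) by (meson mult_pos_pos mult_neg_neg linorder_neqE_linordered_idom)
  also have "\<dots> \<le> B u u" unfolding B_def using assms(1) by (intro member_le_sum) auto
  finally show ?thesis .
qed

definition cstep :: "aff \<Rightarrow> aff \<Rightarrow> bool" where
  "cstep w w' \<longleftrightarrow> w \<in> carrier G \<and>
     (\<exists>i j k. simple i j k \<and> w' = arefl i j k \<cdot> w \<cdot> arefl i j k) \<and> len w' \<le> len w"

lemma cstep_conj:
  assumes "cstep w w'" shows "\<exists>g \<in> Wa. w' = g \<cdot> w \<cdot> ginv g"
proof -
  obtain i j k where "simple i j k" "w' = arefl i j k \<cdot> w \<cdot> arefl i j k"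
    using assms unfolding cstep_def by blast
  then show ?thesis using arefl_Wa[OF simple_I] inv_arefl[OF simple_I] by metis
qed

lemma csteps_conj:
  assumes "cstep\<^sup>*\<^sup>* w w'" "w \<in> carrier G"
  shows "\<exists>g \<in> Wa. w' = g \<cdot> w \<cdot> ginv g"
  using assms(1)
proof (induction rule: rtranclp_induct)
  case base
  then show ?case using Wa_one assms(2) by (intro bexI[of _ "\<one>\<^bsub>G\<^esub>"]) auto
next
  case (step y z)
  obtain g where g: "g \<in> Wa" "y = g \<cdot> w \<cdot> ginv g" using step by blast
  obtain h where h: "h \<in> Wa" "z = h \<cdot> y \<cdot> ginv h" using cstep_conj step by blast
  have "z = (h \<cdot> g) \<cdot> w \<cdot> ginv (h \<cdot> g)"
    unfolding h(2) g(2) using g(1) h(1) assms(2) by (simp add: G.m_assoc G.inv_mult_group)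
  then show ?case using Wa_mult[OF h(1) g(1)] by blast
qed

lemma csteps_carrier: "cstep\<^sup>*\<^sup>* w w' \<Longrightarrow> w \<in> carrier G \<Longrightarrow> w' \<in> carrier G"
  using csteps_conj by fastforce

lemma csteps_len: "cstep\<^sup>*\<^sup>* w w' \<Longrightarrow> len w' \<le> len w"
  by (induction rule: rtranclp_induct) (auto simp: cstep_def)

lemma csteps_coset: "cstep\<^sup>*\<^sup>* w w' \<Longrightarrow> w \<in> carrier G \<Longrightarrow> Wa #>\<^bsub>G\<^esub> w' = Wa #>\<^bsub>G\<^esub> w"
  using csteps_conj coset_conj Wa_carrier by metis

section \<open>Finiteness of the reachable set and the effect of crossing a wall\<close>

lemma finite_simple: "finite {(i, j, k). simple i j k}"
proof -
  have "{(i, j, k). simple i j k} \<subseteq> I \<times> I \<times> {-1..1}"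
  proof (clarsimp)
    fix i j k assume s: "simple i j k"
    have e: "a0 i - a0 j - of_int k = 1 / of_int N" using s by (simp add: simple_def aroot_odd)
    have b: "\<bar>a0 i - a0 j\<bar> < 1" using a0_diff_lt_1 simple_I[OF s] by blast
    have "0 < 1 / real_of_int N" "1 / real_of_int N \<le> 1" using N_pos by auto
    then have "real_of_int k < 1" "real_of_int k > -2" using e b by linarith+
    then have "- 1 \<le> k \<and> k \<le> 1" by linarith
    then show "i \<in> I \<and> j \<in> I \<and> - 1 \<le> k \<and> k \<le> 1" using simple_I[OF s] by simp
  qed
  then show ?thesis by (rule finite_subset) simp
qed

text \<open>Induction on the bound: a coset has at most one element of length zero, and a longer
  element is shortened by one of finitely many simple reflections without leaving the coset.\<close>

lemma finite_coset_len:
  assumes w: "w \<in> carrier G" shows "finite {x \<in> Wa #>\<^bsub>G\<^esub> w. len x \<le> L}"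
proof (induction L)
  case 0
  have "x = y" if x: "x \<in> Wa #>\<^bsub>G\<^esub> w" "len x \<le> 0" and y: "y \<in> Wa #>\<^bsub>G\<^esub> w" "len y \<le> 0" for x y
  proof -
    obtain u u' where u: "u \<in> Wa" "x = u \<cdot> w" "u' \<in> Wa" "y = u' \<cdot> w" using x y by (auto simp: r_coset_def)
    let ?h = "u' \<cdot> ginv u"
    have h: "?h \<in> Wa" using u Wa_mult Wa_inv by blast
    have "ginv u \<cdot> (u \<cdot> w) = w" using u w by (simp flip: G.m_assoc)
    then have y': "y = ?h \<cdot> x" using u w by (simp add: G.m_assoc)
    have "x \<in> carrier G" using u w by simp
    then have "len ?h = 0" using len_mult_zero[of ?h x] h x y y' by simp
    then have "?h = \<one>\<^bsub>G\<^esub>" using Wa_len_zero h by blast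
    then show ?thesis using y' \<open>x \<in> carrier G\<close> by simp
  qed
  then have "\<exists>a. {x \<in> Wa #>\<^bsub>G\<^esub> w. len x \<le> 0} \<subseteq> {a}" by blast
  then show ?case using finite_subset by blast
next
  case (Suc L)
  let ?F = "{x \<in> Wa #>\<^bsub>G\<^esub> w. len x \<le> L}"
  let ?S = "{(i, j, k). simple i j k}"
  have "{x \<in> Wa #>\<^bsub>G\<^esub> w. len x \<le> Suc L} \<subseteq> ?F \<union> (\<Union>(i,j,k)\<in>?S. (\<lambda>x. arefl i j k \<cdot> x) ` ?F)"
  proof
    fix x assume x: "x \<in> {x \<in> Wa #>\<^bsub>G\<^esub> w. len x \<le> Suc L}"
    have xc: "x \<in> carrier G" using x mem_coset_iff[OF w] by blast
    show "x \<in> ?F \<union> (\<Union>(i,j,k)\<in>?S. (\<lambda>x. arefl i j k \<cdot> x) ` ?F)"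
    proof (cases "len x \<le> L")
      case False
      then have "len x > 0" by simp
      then obtain i j k where s: "simple i j k" "aroot i j k (ap x a0) < 0" using simple_descent[OF xc] by blast
      let ?y = "arefl i j k \<cdot> x"
      have "len ?y \<le> L" using len_arefl_down[OF xc s] x by simp
      moreover have "?y \<in> Wa #>\<^bsub>G\<^esub> w"
      proof -
        obtain u where "u \<in> Wa" "x = u \<cdot> w" using x by (auto simp: r_coset_def)
        then have "?y = (arefl i j k \<cdot> u) \<cdot> w" "arefl i j k \<cdot> u \<in> Wa"
          using s(1) w Wa_mult arefl_Wa[OF simple_I[OF s(1)]] by (simp_all add: G.m_assoc)
        then show ?thesis by (auto simp: r_coset_def)
      qed
      ultimately have y: "?y \<in> ?F" by blast
      have "x = arefl i j k \<cdot> ?y" using arefl_cancel[OF simple_I[OF s(1)] xc] by simp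
      then have "x \<in> (\<lambda>x. arefl i j k \<cdot> x) ` ?F" using y by (rule image_eqI)
      then show ?thesis using s(1) by blast
    qed (use x in blast)
  qed
  moreover have "finite (?F \<union> (\<Union>(i,j,k)\<in>?S. (\<lambda>x. arefl i j k \<cdot> x) ` ?F))"
    using Suc finite_simple by (intro finite_UnI finite_UN_I) (auto split: prod.splits)
  ultimately show ?case by (rule finite_subset)
qed

lemma finite_csteps:
  assumes w: "w \<in> carrier G" shows "finite {w'. cstep\<^sup>*\<^sup>* w w'}"
proof -
  have "{w'. cstep\<^sup>*\<^sup>* w w'} \<subseteq> {x \<in> Wa #>\<^bsub>G\<^esub> w. len x \<le> len w}"
  proof
    fix w' assume "w' \<in> {w'. cstep\<^sup>*\<^sup>* w w'}"
    then have c: "cstep\<^sup>*\<^sup>* w w'" by simp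
    have "w' \<in> Wa #>\<^bsub>G\<^esub> w'" using mem_coset_iff csteps_carrier[OF c w] by simp
    then show "w' \<in> {x \<in> Wa #>\<^bsub>G\<^esub> w. len x \<le> len w}" using csteps_coset[OF c w] csteps_len[OF c] by simp
  qed
  then show ?thesis using finite_coset_len[OF w] finite_subset by blast
qed

text \<open>If the conjugate were longer, both one-sided products would be longer than
  \<open>w\<close>. The simple root would then be positive at the images of \<open>a0\<close> under
  \<open>w\<close> and its inverse, hence nonnegative at those of \<open>p\<close>. For
  \<open>p\<close> on the wall, \<open>grad_aroot\<close> reads the hypothesis as saying that the
  descent direction leaves the alcove through this wall.\<close>

lemma cross_len:
  assumes w: "w \<in> carrier G" and s: "simple i j k" and p: "p \<in> alcove"
    and neg: "aroot i j k (ap w p) + aroot i j k (ap (ginv w) p) < 0"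
  shows "len (arefl i j k \<cdot> w \<cdot> arefl i j k) \<le> len w"
proof (rule ccontr)
  let ?s = "arefl i j k" and ?b = "aroot i j k"
  assume l: "\<not> len (?s \<cdot> w \<cdot> ?s) \<le> len w"
  have sc: "?s \<in> carrier G" using s by simp
  have 1: "len w < len (?s \<cdot> w)"
    using l len_left_cases[OF w s] len_right_cases[of "?s \<cdot> w", OF _ s] sc w by auto
  have 2: "len w < len (w \<cdot> ?s)"
    using l len_right_cases[OF w s] len_left_cases[of "w \<cdot> ?s", OF _ s] sc w by (auto simp: G.m_assoc)
  have pos: "?b (ap x p) \<ge> 0" if x: "x \<in> carrier G" "len x < len (?s \<cdot> x)" for x
  proof -
    have "?b (ap x a0) > 0"
      using len_arefl_gt[OF x(1) simple_I[OF s] simple_pos[OF s]] x(2) by blast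
    then show ?thesis using alcove_AR[OF p AR_ap[OF simple_AR[OF s] x(1)]] by simp
  qed
  have "?b (ap w p) \<ge> 0" using pos[OF w 1] .
  moreover have "?b (ap (ginv w) p) \<ge> 0"
    using pos[of "ginv w"] 2 len_right_eq[OF w s] len_inv[OF w] w by simp
  ultimately show False using neg by simp
qed

section \<open>Existence of a point of least displacement\<close>

definition one_vec :: "int \<Rightarrow> real" where
  "one_vec l = (if l \<in> J then (if l > 0 then 1 else - 1) else 0)"

lemma lp_one_vec: assumes "w \<in> carrier G" is_A shows "lp w one_vec = one_vec"
proof
  fix l
  let ?u = "inv_into UNIV (snd w)"
  have u: "?u \<in> weyl T n" using assms weyl_inv by simp
  have "?u l > 0 \<longleftrightarrow> l > 0" if "l \<in> J"
  proof -
    have "?u l \<in> I \<longleftrightarrow> l \<in> I" using u by simp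
    then show ?thesis using that u assms(2) by (simp add: I_def)
  qed
  then show "lp w one_vec l = one_vec l" using u by (simp add: lp_def one_vec_def)
qed

text \<open>In type C oddness bounds the coordinates. In type A the diagonal direction is fixed by
  every linear part, so moving \<open>p\<close> along it until its first coordinate vanishes changes
  no displacement.\<close>

lemma alcove_bound:
  assumes "p \<in> alcove"
  shows "\<exists>q\<in>alcove. (\<forall>l. \<bar>q l\<bar> \<le> 1) \<and> (\<forall>w\<in>carrier G. disp w q = disp w p)"
proof -
  have d: "\<bar>p i - p j\<bar> \<le> 1" if "i \<in> I" "j \<in> I" for i j
  proof (cases "i = j")
    case False
    \<comment> \<open>Hence the roots with constant \<open>-1\<close> are positive at
      \<open>a0\<close>, and so they are nonnegative on the closed alcove.\<close>
    have "\<bar>a0 i - a0 j\<bar> < 1" using a0_diff_lt_1 that by blast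
    then have "aroot i j (-1) p \<ge> 0" "aroot j i (-1) p \<ge> 0"
      using alcove_AR[OF assms aroot_AR] that False by (auto simp: aroot_odd)
    then show ?thesis using chamD(1)[OF assms] by (simp add: aroot_odd)
  qed simp
  show ?thesis
  proof (cases is_A)
    case False
    have "\<bar>p l\<bar> \<le> 1" for l
    proof (cases "l \<in> J")
      case True
      then have "l \<in> I" "- l \<in> I" using False by (auto simp: I_def)
      then show ?thesis using d[of l "- l"] chamD(1)[OF assms] by (simp add: odd_funD)
    qed (simp add: chamD(2)[OF assms])
    then show ?thesis using assms by blast
  next
    case True
    define q where "q = p + (\<lambda>l. - p 1 * one_vec l)"
    have oI: "one_vec l = 1" if "l \<in> I" for l using that True by (simp add: one_vec_def I_def)
    have oo: "odd_fun one_vec" unfolding odd_fun_def one_vec_def using zero_notin_J by auto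
    have q_odd: "odd_fun q" using oo chamD(1)[OF assms] by (simp add: q_def odd_fun_def)
    have "aroot i j k q = aroot i j k p" if "i \<in> I" "j \<in> I" for i j k
      using that oI q_odd chamD(1)[OF assms] by (simp add: aroot_odd) (simp add: q_def)
    then have "q \<in> alcove"
      using assms q_odd simple_I unfolding alcove_def by (auto simp: q_def one_vec_def)
    moreover have "\<bar>q l\<bar> \<le> 1" for l
    proof -
      have 1: "1 \<in> I" using n_pos by (auto simp: I_def J_def)
      have *: "\<bar>q l\<bar> \<le> 1" if "l \<in> I" for l using d[OF that 1] oI[OF that] by (simp add: q_def)
      have "l \<in> I \<or> - l \<in> I" if "l \<in> J" using J_cases[OF that] that by (auto simp: I_def)
      then consider "l \<in> I" | "- l \<in> I" | "l \<notin> J" by blast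
      then show ?thesis
      proof cases
        case 2 then show ?thesis using *[of "- l"] q_odd by (simp add: odd_funD)
      qed (use * chamD(2)[OF assms] in \<open>auto simp: q_def one_vec_def\<close>)
    qed
    moreover have "disp w q = disp w p" if w: "w \<in> carrier G" for w
    proof -
      have "lp w (\<lambda>l. - p 1 * one_vec l) = (\<lambda>l. - p 1 * one_vec l)"
        using lp_one_vec[OF w True] by (auto simp: lp_def fun_eq_iff)
      then have "ap w q - q = ap w p - p" unfolding q_def ap_add by (simp add: fun_eq_iff)
      then show ?thesis by (simp add: disp_def)
    qed
    ultimately show ?thesis by blast
  qed
qed

lemma continuous_coord [continuous_intros]: "continuous_on A (\<lambda>p::int \<Rightarrow> real. p i)"
  by (rule continuous_on_subset[OF continuous_on_product_coordinates]) simp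

text \<open>The points with coordinates in \<open>[-1, 1]\<close> form a compact set in the product
  topology, and \<open>alcove_bound\<close> moves any point of the alcove there at equal
  displacement.\<close>

lemma disp_attains_min:
  assumes w: "w \<in> carrier G" shows "\<exists>p\<in>alcove. \<forall>q\<in>alcove. disp w p \<le> disp w q"
proof -
  define K where "K = {p\<in>alcove. \<forall>l. \<bar>p l\<bar> \<le> 1}"
  have "compactin (product_topology (\<lambda>i::int. euclidean) UNIV) (PiE UNIV (\<lambda>_. {-1..1::real}))"
    unfolding compactin_PiE by simp
  then have c: "compact (PiE (UNIV :: int set) (\<lambda>_. {-1..1::real}))"
    by (simp add: euclidean_product_topology)
  have K: "K = PiE UNIV (\<lambda>_. {-1..1}) \<inter> ((\<Inter>l. {p. p (- l) = - p l}) \<inter> (\<Inter>l\<in>-J. {p. p l = 0}) \<inter>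
    (\<Inter>(i,j,k)\<in>{(i, j, k). simple i j k}. {p. 0 \<le> aroot i j k p}))"
    unfolding K_def alcove_def odd_fun_def by (auto simp: abs_le_iff minus_le_iff)
  have cl: "closed ((\<Inter>l. {p::int\<Rightarrow>real. p (- l) = - p l}) \<inter> (\<Inter>l\<in>-J. {p. p l = 0}) \<inter>
    (\<Inter>(i,j,k)\<in>{(i, j, k). simple i j k}. {p. 0 \<le> aroot i j k p}))"
    unfolding aroot_def
    by (intro closed_Int closed_INT ballI) (auto intro!: closed_Collect_eq closed_Collect_le continuous_intros)
  then have "compact K" unfolding K by (rule compact_Int_closed[OF c])
  moreover have "K \<noteq> {}" using alcove_bound[OF a0_alcove] unfolding K_def by blast
  moreover have "continuous_on K (disp w)"
    unfolding disp_def B_def ap_def minus_apply by (intro continuous_intros)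
  ultimately obtain p where p: "p \<in> K" "\<forall>q\<in>K. disp w p \<le> disp w q"
    using continuous_attains_inf by metis
  have "disp w p \<le> disp w q" if "q \<in> alcove" for q
  proof -
    obtain q' where "q' \<in> K" "disp w q' = disp w q" using alcove_bound[OF \<open>q \<in> alcove\<close>] w unfolding K_def by blast
    then show ?thesis using p(2) by metis
  qed
  then show ?thesis using p(1) unfolding K_def by blast
qed

text \<open>Equal to \<open>w p + w^(-1) p - 2 p\<close>. In the bracketed form the first difference
  is the image of the second under the linear part of \<open>w\<close> (\<open>lp_disp\<close>), so
  a zero of \<open>grad\<close> means that the displacement is fixed by that linear part.\<close>

definition grad :: "aff \<Rightarrow> (int \<Rightarrow> real) \<Rightarrow> int \<Rightarrow> real" where
  "grad w p = (ap w p - p) - (p - ap (ginv w) p)"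

lemma lp_diff: "lp w (u - v) = lp w u - lp w v"
  by (simp add: lp_def fun_eq_iff)

lemma lp_scale: "lp w (\<lambda>l. c * u l) = (\<lambda>l. c * lp w u l)"
  by (simp add: lp_def)

lemma lp_disp: "w \<in> carrier G \<Longrightarrow> lp w (p - ap (ginv w) p) = ap w p - p"
  by (simp flip: ap_diff)

lemma B_line: "B (u + (\<lambda>l. e * h l)) (u + (\<lambda>l. e * h l)) = B u u + 2 * e * B u h + e\<^sup>2 * B h h"
  by (simp add: B_add B_scale B_commute[of h u] power2_eq_square algebra_simps)

text \<open>The gradient of \<open>disp w\<close> is \<open>-2 grad w\<close>.\<close>

lemma disp_along_grad:
  assumes w: "w \<in> carrier G"
  shows "\<exists>D. \<forall>e. disp w (p + (\<lambda>l. e * grad w p l)) = disp w p - 2 * e * B (grad w p) (grad w p) + e\<^sup>2 * D"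
proof -
  let ?g = "grad w p" and ?u = "ap w p - p" and ?u' = "p - ap (ginv w) p"
  let ?h = "lp w ?g - ?g"
  have "B ?u (lp w ?g) = B ?u' ?g" using B_lp[OF w, of ?u' ?g] lp_disp[OF w] by simp
  moreover have "B ?u ?h = B ?u (lp w ?g) - B ?u ?g" by (rule B_diff(2))
  moreover have "B ?g x = B ?u x - B ?u' x" for x by (simp only: grad_def B_diff(1))
  ultimately have 1: "B ?u ?h = - B ?g ?g" by simp
  have 2: "ap w (p + (\<lambda>l. e * ?g l)) - (p + (\<lambda>l. e * ?g l)) = ?u + (\<lambda>l. e * ?h l)" for e
    unfolding ap_add lp_scale by (simp add: fun_eq_iff algebra_simps)
  then have "disp w (p + (\<lambda>l. e * ?g l)) = disp w p - 2 * e * B ?g ?g + e\<^sup>2 * B ?h ?h" for e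
    unfolding disp_def 2 B_line 1 by (simp add: fun_diff_def)
  then show ?thesis by blast
qed

lemma grad_odd: "odd_fun p \<Longrightarrow> w \<in> carrier G \<Longrightarrow> odd_fun (grad w p)"
  using odd_ap[of p w] odd_ap[of p "ginv w"] by (simp add: odd_fun_def grad_def)

lemma grad_aroot:
  assumes "odd_fun p" "w \<in> carrier G"
  shows "grad w p i - grad w p j = aroot i j k (ap w p) + aroot i j k (ap (ginv w) p) - 2 * aroot i j k p"
  using assms by (simp add: aroot_odd grad_def)

text \<open>The linear part \<open>s\<close> of the reflection is an isometric involution, so
  \<open>B (s g - g) (s q - q) = 2 B g q - 2 B (s g) q\<close>. The left side is negative: both
  differences are multiples of one coroot, with opposite signs.\<close>

lemma B_arefl_less:
  assumes s: "simple i j k" and "odd_fun g" "odd_fun q" and "g i - g j < 0" "q i - q j > 0"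
  shows "B g q < B (lp (arefl i j k) g) q"
proof -
  let ?s = "arefl i j k"
  note I = simple_I[OF s]
  have J: "i \<in> J" "j \<in> J" and nz: "i \<noteq> 0" "j \<noteq> 0" using I by (auto dest: I_J)
  have sc: "?s \<in> carrier G" using s by simp
  have l: "lp ?s u l = u (swp i j l)" for u l using nz by (simp add: lp_def arefl_def)
  have ss: "lp ?s (lp ?s u) = u" for u using nz by (simp add: l fun_eq_iff)
  let ?d = "lp ?s g - g" and ?e = "lp ?s q - q"
  have "B ?d ?e = 2 * B g q - 2 * B (lp ?s g) q"
    using B_lp[OF sc, of g q] B_lp[OF sc, of g "lp ?s q"] by (simp add: B_diff ss)
  moreover have "B ?d ?e < 0"
  proof -
    have np: "?d l * ?e l \<le> 0" for l
    proof -
      have "(g j - g i) * (q j - q i) \<le> 0" using assms by (simp add: mult_nonneg_nonpos)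
      then show ?thesis using assms(2,3) unfolding minus_apply l swp_def odd_fun_def by (auto simp: algebra_simps)
    qed
    have "0 < - (?d i * ?e i)" using assms(4,5) by (simp add: l swp_def mult_pos_neg)
    also have "\<dots> \<le> (\<Sum>l\<in>J. - (?d l * ?e l))" using np J by (intro member_le_sum) (auto simp del: minus_apply simp: le_minus_iff)
    also have "\<dots> = - B ?d ?e" by (simp add: B_def sum_negf)
    finally show ?thesis by simp
  qed
  ultimately show ?thesis by simp
qed

lemma csteps_to_translated_point:
  assumes w: "w \<in> carrier G"
  obtains w' p v where "cstep\<^sup>*\<^sup>* w w'" "p \<in> alcove" "ap w' p = p + v" "lp w' v = v"
proof -
  define C where "C = {w'. cstep\<^sup>*\<^sup>* w w'}"
  have finC: "finite C" and wC: "w \<in> C" unfolding C_def using finite_csteps w by auto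
  have Cc: "x \<in> carrier G" if "x \<in> C" for x using csteps_carrier w that by (auto simp: C_def)
  have Cs: "y \<in> C" if "x \<in> C" "cstep x y" for x y using that by (auto simp: C_def)
  obtain P where P: "P x \<in> alcove \<and> (\<forall>q\<in>alcove. disp x (P x) \<le> disp x q)" if "x \<in> C" for x
    using disp_attains_min Cc by metis
  obtain w1 where w1: "w1 \<in> C" "\<And>x. x \<in> C \<Longrightarrow> disp w1 (P w1) \<le> disp x (P x)"
    using arg_min_if_finite[OF finC, of "\<lambda>x. disp x (P x)"] wC by (metis empty_iff linorder_not_less)
  define p where "p = P w1"
  have p: "p \<in> alcove" using P w1 by (simp add: p_def)
  have po: "odd_fun p" using chamD(1)[OF p] .
  have pmin: "disp w1 p \<le> disp x q" if "x \<in> C" "q \<in> alcove" for x q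
    using P[OF that(1)] w1(2)[OF that(1)] that(2) unfolding p_def by force
  define D where "D = {x \<in> C. disp x p = disp w1 p}"
  have finD: "finite D" and DC: "D \<subseteq> C" and w1D: "w1 \<in> D" using finC w1(1) by (auto simp: D_def)
  let ?q = "a0 - p"
  \<comment> \<open>The tie among elements with equal displacement at \<open>p\<close> is broken by
    the pairing with \<open>a0 - p\<close>, a vector on which every simple root vanishing at
    \<open>p\<close> has positive linear part.\<close>
  obtain w2 where w2: "w2 \<in> D" "\<And>x. x \<in> D \<Longrightarrow> B (grad x p) ?q \<le> B (grad w2 p) ?q"
    using arg_min_if_finite[OF finD, of "\<lambda>x. - B (grad x p) ?q"] w1D by (metis empty_iff linorder_not_less neg_less_iff_less)
  have w2C: "w2 \<in> C" using w2 DC by blast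
  have w2c: "w2 \<in> carrier G" using Cc w2C by blast
  let ?g = "grad w2 p"
  have go: "odd_fun ?g" using grad_odd po w2c by blast
  \<comment> \<open>Otherwise conjugation by this reflection, which fixes \<open>p\<close>, stays in
    \<open>D\<close> and reflects the descent direction; by \<open>B_arefl_less\<close> the pairing
    would grow.\<close>
  have dom: "?g i - ?g j \<ge> 0" if s: "simple i j k" and r0: "aroot i j k p = 0" for i j k
  proof (rule ccontr)
    assume "\<not> ?g i - ?g j \<ge> 0"
    then have neg: "?g i - ?g j < 0" by simp
    let ?s = "arefl i j k"
    note I = simple_I[OF s]
    have sc: "?s \<in> carrier G" using s by simp
    let ?w = "?s \<cdot> w2 \<cdot> ?s"
    have "len ?w \<le> len w2" using cross_len[OF w2c s p] neg grad_aroot[OF po w2c, of i j k] r0 by simp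
    then have "cstep w2 ?w" unfolding cstep_def using w2c s by blast
    then have wC: "?w \<in> C" using Cs w2C by blast
    have fx: "ap ?s p = p" using ap_arefl_fix po I r0 by blast
    have aw: "ap ?w p = ap ?s (ap w2 p)" using sc w2c by (simp add: ap_mult fx)
    have iw: "ginv ?w = ?s \<cdot> ginv w2 \<cdot> ?s"
      using sc w2c inv_arefl[OF I] by (simp add: G.inv_mult_group G.m_assoc)
    have aiw: "ap (ginv ?w) p = ap ?s (ap (ginv w2) p)" unfolding iw using sc w2c by (simp add: ap_mult fx)
    have d1: "ap ?w p - p = lp ?s (ap w2 p - p)" using aw fx ap_diff[of ?s "ap w2 p" p] by simp
    have d2: "p - ap (ginv ?w) p = lp ?s (p - ap (ginv w2) p)" using aiw fx ap_diff[of ?s p "ap (ginv w2) p"] by simp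
    have "disp ?w p = disp w2 p" unfolding disp_def d1 B_lp[OF sc] ..
    then have "?w \<in> D" using wC w2 by (simp add: D_def)
    moreover have "grad ?w p = lp ?s ?g" unfolding grad_def d1 d2 lp_diff ..
    moreover have "?q i - ?q j > 0" using simple_pos[OF s] r0 po by (simp add: aroot_odd)
    moreover have "odd_fun ?q" using po odd_funD[OF a0_odd] by (simp add: odd_fun_def)
    ultimately show False using B_arefl_less[OF s go _ neg] w2(2)[of ?w] by fastforce
  qed
  \<comment> \<open>A small step from \<open>p\<close> along the descent direction stays in the
    alcove: at walls through \<open>p\<close> by \<open>dom\<close>, at the others by continuity.
    For small \<open>e\<close> the linear decrease outweighs the quadratic term, against
    minimality.\<close>
  have g0: "?g l = 0" for l
  proof (rule ccontr)
    assume nz: "?g l \<noteq> 0"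
    have gz: "?g l = 0" if "l \<notin> J" for l
      using that chamD(2)[OF p] w2c trans_lattice_notin[OF carrier_fst] weyl_notin[OF weyl_inv[OF carrier_snd]]
      by (simp add: grad_def ap_def G.inv_closed del: carrier_fst)
    have "l \<in> J" using nz gz by blast
    then have Bp: "B ?g ?g > 0" using B_self_pos nz by blast
    obtain Q where Q: "\<And>e. disp w2 (p + (\<lambda>l. e * ?g l)) = disp w2 p - 2 * e * B ?g ?g + e\<^sup>2 * Q"
      using disp_along_grad[OF w2c, of p] by blast
    let ?p = "\<lambda>e. p + (\<lambda>l. e * ?g l)"
    have ev1: "\<forall>\<^sub>F e in at_right (0::real). e > 0" by (simp add: eventually_at_right_less)
    have ev2: "\<forall>\<^sub>F e in at_right 0. aroot i j k (?p e) \<ge> 0" if s: "simple i j k" for i j k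
    proof -
      have r: "aroot i j k (?p e) = aroot i j k p + e * (?g i - ?g j)" for e
        using po go by (simp add: aroot_def odd_fun_def field_simps)
      show ?thesis
      proof (cases "aroot i j k p = 0")
        case True
        then show ?thesis unfolding r using dom[OF s True] ev1 by (auto elim!: eventually_mono)
      next
        case False
        then have "aroot i j k p > 0" using chamD(3)[OF p s] by simp
        moreover have "((\<lambda>e. aroot i j k p + e * (?g i - ?g j)) \<longlongrightarrow> aroot i j k p + 0 * (?g i - ?g j)) (at_right 0)"
          by (intro tendsto_intros)
        ultimately have "\<forall>\<^sub>F e in at_right 0. aroot i j k p + e * (?g i - ?g j) > 0"
          by (intro order_tendstoD(1)[where y = "aroot i j k p + 0 * (?g i - ?g j)"]) auto
        then show ?thesis unfolding r by (auto elim!: eventually_mono)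
      qed
    qed
    have ev3: "\<forall>\<^sub>F e in at_right 0. e * Q < 2 * B ?g ?g"
    proof -
      have "((\<lambda>e. e * Q) \<longlongrightarrow> 0 * Q) (at_right 0)" by (intro tendsto_intros)
      then show ?thesis using Bp by (intro order_tendstoD(2)[where y = "0 * Q"]) auto
    qed
    have "\<forall>\<^sub>F e in at_right 0. \<forall>z\<in>{(i, j, k). simple i j k}. case z of (i, j, k) \<Rightarrow> aroot i j k (?p e) \<ge> 0"
      using ev2 by (intro eventually_ball_finite finite_simple) auto
    then have "\<forall>\<^sub>F e in at_right 0. e > 0 \<and> e * Q < 2 * B ?g ?g \<and> (\<forall>z\<in>{(i, j, k). simple i j k}. case z of (i, j, k) \<Rightarrow> aroot i j k (?p e) \<ge> 0)"
      using ev1 ev3 by eventually_elim auto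
    then obtain e where e: "e > 0" "e * Q < 2 * B ?g ?g" "\<And>i j k. simple i j k \<Longrightarrow> aroot i j k (?p e) \<ge> 0"
      using eventually_happens[of _ "at_right (0::real)"] by fastforce
    have "?p e \<in> alcove"
      unfolding alcove_def using e(3) po go gz chamD(2)[OF p] by (auto simp: odd_fun_def)
    then have "disp w1 p \<le> disp w2 (?p e)" using pmin w2C by blast
    moreover have "disp w2 p = disp w1 p" using w2 by (simp add: D_def)
    moreover have "e * (e * Q) < e * (2 * B ?g ?g)" using e by simp
    ultimately show False unfolding Q by (simp add: power2_eq_square algebra_simps)
  qed
  let ?v = "ap w2 p - p"
  \<comment> \<open>With zero gradient the displacement at \<open>p\<close> equals its own preimage
    under the linear part.\<close>
  have "?v = p - ap (ginv w2) p"
  proof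
    fix l show "?v l = (p - ap (ginv w2) p) l" using g0[of l] unfolding grad_def minus_apply by simp
  qed
  then have "lp w2 ?v = ?v" using lp_disp[OF w2c, of p] by metis
  moreover have "ap w2 p = p + ?v" by simp
  ultimately show thesis using that[of w2 p ?v] w2C p by (simp add: C_def)
qed

text \<open>An affine root separating \<open>a0\<close> from \<open>w a0\<close> and vanishing at both \<open>p\<close> and \<open>p + v\<close> gives a
  reflection that shortens \<open>w\<close> and keeps the Newton vector.\<close>

definition splits_at :: "aff \<Rightarrow> (int \<Rightarrow> real) \<Rightarrow> (int \<Rightarrow> real) \<Rightarrow> bool" where
  "splits_at w p v \<longleftrightarrow> (\<exists>\<beta>\<in>AR. \<beta> p = 0 \<and> lin \<beta> v = 0 \<and> \<beta> a0 > 0 \<and> \<beta> (ap w a0) < 0)"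

section \<open>Splitting roots, shorter elements and goodness\<close>

lemma AR_arefl:
  assumes "\<beta> \<in> AR" "x \<in> carrier G" "\<beta> a0 > 0" "\<beta> (ap x a0) < 0"
  obtains r where "r \<in> Wa" "len (r \<cdot> x) < len x" "bstep (r \<cdot> x) x"
    "\<And>p. odd_fun p \<Longrightarrow> \<beta> p = 0 \<Longrightarrow> ap r p = p"
proof -
  obtain i j k where b: "\<beta> = aroot i j k" "i \<in> I" "j \<in> I" "i \<noteq> j" using AR_E assms by metis
  have l: "len (arefl i j k \<cdot> x) < len x" using strong_exchange[OF assms(2) b(2-4)] assms b by simp
  moreover have "bstep (arefl i j k \<cdot> x) x"
    unfolding bstep_def using l b assms(2) arefl_cancel[OF b(2-4) assms(2)]
    by (intro conjI exI[of _ i] exI[of _ j] exI[of _ k]) auto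
  moreover have "ap (arefl i j k) p = p" if "odd_fun p" "\<beta> p = 0" for p
    using ap_arefl_fix[OF that(1) b(2-4)] that(2) b(1) by simp
  ultimately show thesis using that arefl_Wa[OF b(2-4)] by blast
qed

text \<open>The reflection fixes \<open>p\<close> and \<open>p + v\<close>, hence its linear part
  fixes \<open>v\<close>. So the product still translates \<open>p\<close> by a fixed vector, and
  \<open>newton_vec_eq\<close> gives it the same Newton vector; the coset is unchanged because the
  reflection lies in \<open>Wa\<close>.\<close>

lemma split_smaller:
  assumes w: "w \<in> carrier G" and p: "odd_fun p" and "ap w p = p + v" "lp w v = v" and s: "splits_at w p v"
  shows "\<exists>y. ble y w \<and> len y < len w \<and> y \<in> carrier G \<and> f_map T n y = f_map T n w"
proof -
  obtain \<beta> where b: "\<beta> \<in> AR" "\<beta> p = 0" "lin \<beta> v = 0" "\<beta> a0 > 0" "\<beta> (ap w a0) < 0"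
    using s unfolding splits_at_def by blast
  obtain r where r: "r \<in> Wa" "len (r \<cdot> w) < len w" "bstep (r \<cdot> w) w"
    "\<And>p. odd_fun p \<Longrightarrow> \<beta> p = 0 \<Longrightarrow> ap r p = p" using AR_arefl[OF b(1) w b(4,5)] by blast
  have rc: "r \<in> carrier G" using r by simp
  have vo: "odd_fun (p + v)" using odd_ap[OF p w] assms(3) by simp
  have "\<beta> (p + v) = 0" using AR_add[OF b(1), of p v] b(2,3) by simp
  then have fp: "ap r p = p" "ap r (p + v) = p + v" using r(4)[OF p b(2)] r(4)[OF vo] by simp_all
  have lv: "lp r v = v" using fp ap_add[of r p v] by (simp add: fun_eq_iff)
  let ?y = "r \<cdot> w"
  have yc: "?y \<in> carrier G" using rc w by simp
  have "ap ?y p = p + v" "lp ?y v = v" using fp lv rc w assms(3,4) by (simp_all add: ap_mult lp_mult)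
  then have "real_of_rat (newton_vec T n ?y i) = v i" for i using newton_vec_eq[OF yc] by blast
  moreover have "real_of_rat (newton_vec T n w i) = v i" for i using newton_vec_eq[OF w assms(4,3)] .
  ultimately have "newton_vec T n ?y = newton_vec T n w" by (metis ext of_rat_eq_iff)
  then have "f_map T n ?y = f_map T n w" unfolding f_map_def using coset_Wa_mult[OF w r(1)] by simp
  then show ?thesis using r yc by blast
qed

lemma lin_lp_pow:
  assumes w: "w \<in> carrier G" and "lp w v = v" and b: "\<beta> \<in> AR"
  shows "lin (\<lambda>q. \<beta> (ap (w [^]\<^bsub>G\<^esub> (k::nat)) q)) v = lin \<beta> v"
  unfolding lin_ap[OF b] lp_pow[OF w assms(2)] ..

lemma ap_AR_pow:
  assumes w: "w \<in> carrier G" and tr: "ap w p = p + v" "lp w v = v" and g: "\<gamma> \<in> AR"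
  shows "\<gamma> (ap (w [^]\<^bsub>G\<^esub> (k::nat)) p) = \<gamma> p + of_nat k * lin \<gamma> v"
proof -
  have "ap (w [^]\<^bsub>G\<^esub> k) p = p + (\<lambda>i. of_nat k * v i)" using ap_pow[OF w tr(2,1)] by (simp add: fun_eq_iff)
  then show ?thesis using AR_add[OF g] lin_scale[OF g] by simp
qed

text \<open>The pullbacks of the root along the powers of \<open>w\<close> vanish at
  \<open>p\<close> and have linear part zero on \<open>v\<close> as well. A sign change between
  consecutive powers would make such a pullback or its negative a splitting root.\<close>

lemma not_split_sign:
  assumes w: "w \<in> carrier G" and tr: "ap w p = p + v" "lp w v = v" and s: "\<not> splits_at w p v"
    and g: "\<gamma> \<in> AR" and z: "\<gamma> p = 0" "lin \<gamma> v = 0"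
  shows "\<gamma> (ap (w [^]\<^bsub>G\<^esub> (k::nat)) a0) > 0 \<longleftrightarrow> \<gamma> a0 > 0"
proof -
  let ?w = "\<lambda>k. w [^]\<^bsub>G\<^esub> (k::nat)"
  have wc: "?w k \<in> carrier G" for k using w by simp
  have val: "\<gamma> (ap (?w k) p) = \<gamma> p + of_nat k * lin \<gamma> v" if g: "\<gamma> \<in> AR" for \<gamma> k
    using ap_AR_pow[OF w tr g] .
  have spl: "splits_at w p v" if "\<beta> \<in> AR" "\<beta> p = 0" "lin \<beta> v = 0" "\<beta> a0 > 0" "\<beta> (ap w a0) < 0" for \<beta>
    unfolding splits_at_def using that by blast
  have const: "\<gamma> (ap (?w k) a0) > 0 \<longleftrightarrow> \<gamma> a0 > 0" for k
  proof (induction k)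
    case (Suc k)
    let ?b = "\<lambda>q. \<gamma> (ap (?w k) q)"
    have b: "?b \<in> AR" using AR_ap[OF g wc] .
    have bp: "?b p = 0" using val[OF g, of k] z by simp
    have bv: "lin ?b v = 0" using lin_lp_pow[OF w tr(2) g, of k] z by simp
    have e: "?b (ap w a0) = \<gamma> (ap (?w (Suc k)) a0)" using w by (simp add: ap_mult)
    have "\<not> (?b a0 > 0 \<and> ?b (ap w a0) < 0)" using s spl[OF b bp bv] by blast
    moreover have "\<not> ((- ?b) a0 > 0 \<and> (- ?b) (ap w a0) < 0)"
    proof -
      have "(- ?b) p = 0" "lin (- ?b) v = 0" using bp bv by (simp_all add: lin_def)
      then show ?thesis using s spl[OF AR_uminus[OF b]] by blast
    qed
    ultimately have "?b (ap w a0) > 0 \<longleftrightarrow> ?b a0 > 0"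
      using AR_apa0_nz[OF b w] AR_a0_nz[OF b] by (auto simp: not_less)
    then show ?case using Suc e by simp
  qed simp
  show ?thesis using const .
qed

lemma good_of_not_split:
  assumes w: "w \<in> carrier G" and p: "p \<in> alcove" and tr: "ap w p = p + v" "lp w v = v" and s: "\<not> splits_at w p v"
  shows "good T n w"
proof -
  have po: "odd_fun p" using chamD(1)[OF p] .
  let ?w = "\<lambda>k. w [^]\<^bsub>G\<^esub> (k::nat)"
  have wc: "?w k \<in> carrier G" for k using w by simp
  have val: "\<gamma> (ap (?w k) p) = \<gamma> p + of_nat k * lin \<gamma> v" if g: "\<gamma> \<in> AR" for \<gamma> k
  proof -
    have "ap (?w k) p = p + (\<lambda>i. of_nat k * v i)" using ap_pow[OF w tr(2,1)] by (simp add: fun_eq_iff)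
    then show ?thesis using AR_add[OF g] lin_scale[OF g] by simp
  qed
  \<comment> \<open>The pullback along \<open>w^k\<close> is an affine root with this value at
    \<open>p\<close>; being positive at a point of the closed alcove, it is positive at
    \<open>a0\<close>.\<close>
  have sgn: "\<gamma> (ap (?w k) a0) > 0" if g: "\<gamma> \<in> AR" and "\<gamma> p + of_nat k * lin \<gamma> v > 0" for \<gamma> k
  proof (rule ccontr)
    let ?b = "\<lambda>q. \<gamma> (ap (?w k) q)"
    assume "\<not> \<gamma> (ap (?w k) a0) > 0"
    then have "\<gamma> (ap (?w k) a0) < 0" using AR_apa0_nz[OF g wc, of k] by linarith
    then have "(- ?b) a0 > 0" by simp
    then have "(- ?b) p \<ge> 0" using alcove_AR[OF p AR_uminus[OF AR_ap[OF g wc]]] by blast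
    then show False using val[OF g, of k] that(2) by simp
  qed
  have sgn': "\<gamma> (ap (?w k) a0) < 0" if g: "\<gamma> \<in> AR" and "\<gamma> p + of_nat k * lin \<gamma> v < 0" for \<gamma> k
  proof -
    have "lin (- \<gamma>) v = - lin \<gamma> v" by (simp add: lin_def)
    then show ?thesis using sgn[OF AR_uminus[OF g], of k] that(2) by simp
  qed
  note const = not_split_sign[OF w tr s]
  \<comment> \<open>The values at the points \<open>w^k p\<close> are affine in \<open>k\<close>, so
    a root that turns negative at the first step stays negative. When they are constantly zero,
    \<open>const\<close> decides.\<close>
  have A: "\<gamma> (ap (?w k) a0) < 0" if g: "\<gamma> \<in> AR" and "\<gamma> a0 > 0" "\<gamma> (ap w a0) < 0" "k \<ge> 1" for \<gamma> k
  proof -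
    have 0: "\<gamma> p \<ge> 0" using sgn'[OF g, of 0] that by (force simp: not_less)
    have 1: "\<gamma> p + lin \<gamma> v \<le> 0" using sgn[OF g, of 1] that w by (force simp: not_less)
    show ?thesis
    proof (cases "lin \<gamma> v = 0")
      case True
      then have "\<gamma> p = 0" using 0 1 by simp
      then show ?thesis using const[OF g _ True, of 1] that w by simp
    next
      case False
      then have neg: "lin \<gamma> v < 0" using 0 1 by simp
      show ?thesis
      proof (cases "k = 1")
        case True then show ?thesis using that w by simp
      next
        case False
        then have "of_nat k - 1 > (0::real)" using that(4) by simp
        then have "(of_nat k - 1) * lin \<gamma> v < 0" using neg by (simp add: mult_pos_neg)
        then have "\<gamma> p + of_nat k * lin \<gamma> v < 0" using 1 by (simp add: algebra_simps)
        then show ?thesis using sgn'[OF g] by blast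
      qed
    qed
  qed
  \<comment> \<open>The same monotonicity read backwards: a root that turns negative only later was
    positive at the start.\<close>
  have Bw: "\<gamma> a0 > 0" if g: "\<gamma> \<in> AR" and "\<gamma> (ap w a0) > 0" "\<gamma> (ap (?w (Suc k)) a0) < 0" for \<gamma> k
  proof -
    have 1: "\<gamma> p + lin \<gamma> v \<ge> 0" using sgn'[OF g, of 1] that w by (force simp: not_less)
    have 2: "\<gamma> p + of_nat (Suc k) * lin \<gamma> v \<le> 0" using sgn[OF g, of "Suc k"] that(3) by (force simp: not_less)
    have k: "k \<noteq> 0"
    proof
      assume "k = 0"
      then show False using that(2,3) w by simp
    qed
    have "of_nat k * lin \<gamma> v \<le> 0" using 1 2 by (simp add: algebra_simps)
    then have le: "lin \<gamma> v \<le> 0" using k by (simp add: mult_le_0_iff)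
    show ?thesis
    proof (cases "lin \<gamma> v = 0")
      case True
      then have "\<gamma> p = 0" using 1 2 by simp
      then show ?thesis using const[OF g _ True, of 1] that w by simp
    next
      case False
      then have "\<gamma> p > 0" using 1 le by simp
      then show ?thesis using sgn[OF g, of 0] by simp
    qed
  qed
  \<comment> \<open>The roots separating \<open>a0\<close> from \<open>w a0\<close> and those
    separating \<open>w a0\<close> from \<open>w^(m+1) a0\<close> are disjoint, and by
    \<open>A\<close> and \<open>Bw\<close> all of them separate \<open>a0\<close> from
    \<open>w^(m+1) a0\<close>.\<close>
  have "len w + len (?w m) \<le> len (?w (Suc m))" for m
  proof -
    let ?i = "ginv w"
    let ?X = "(\<lambda>\<beta> q. \<beta> (ap ?i q) :: real) ` Inv (?w m)"
    have wS: "ap (?w (Suc m)) a0 = ap w (ap (?w m) a0)"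
      using w ap_mult[OF w wc[of m]] by (metis G.nat_pow_Suc2)
    have "Inv w \<subseteq> Inv (?w (Suc m))"
      using A[of _ "Suc m"] by (auto simp: Inv_def)
    moreover have "?X \<subseteq> Inv (?w (Suc m))"
    proof
      fix \<gamma> assume "\<gamma> \<in> ?X"
      then obtain \<beta> where b: "\<beta> \<in> AR" "\<beta> a0 > 0" "\<beta> (ap (?w m) a0) < 0" "\<gamma> = (\<lambda>q. \<beta> (ap ?i q))"
        by (auto simp: Inv_def)
      have g: "\<gamma> \<in> AR" unfolding b(4) using AR_ap[OF b(1)] w by simp
      have "\<gamma> (ap w a0) > 0" "\<gamma> (ap (?w (Suc m)) a0) < 0" unfolding b(4) wS using b w by simp_all
      then show "\<gamma> \<in> Inv (?w (Suc m))" using Bw[OF g] g by (simp add: Inv_def)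
    qed
    moreover have "Inv w \<inter> ?X = {}"
      using w by (auto simp: Inv_def)
    ultimately have "card (Inv w) + card ?X \<le> card (Inv (?w (Suc m)))"
      using finite_Inv[OF w] finite_Inv[OF wc[of m]] finite_Inv[OF wc[of "Suc m"]] by (subst card_Un_disjoint[symmetric]) (auto intro!: card_mono)
    then show ?thesis unfolding len_def using card_comp_ap[of ?i "Inv (?w m)"] w by simp
  qed
  then have "m * len w \<le> len (?w m)" for m
  proof (induction m)
    case (Suc m)
    have "len w + m * len w \<le> len w + len (?w m)" using Suc by simp
    then show ?case using Suc.prems[of m] by simp
  qed simp
  then have "len (?w m) = m * len w" for m using len_pow_le[OF w, of m] by (simp add: le_antisym)
  then show ?thesis unfolding good_def using w by (simp add: aff_length_len)
qed

text \<open>If the end of the conjugation chain is split, it has a smaller element. If it is unsplit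
  it is good, and then its length must be less than that of \<open>w\<close>, because equal length
  and equal Newton norm would make \<open>w\<close> good; so somewhere the chain descends in the
  Bruhat order.\<close>

lemma not_good_smaller:
  assumes w: "w \<in> carrier G" and ng: "\<not> good T n w"
  shows "\<exists>y. ble y w \<and> len y < len w \<and> y \<in> carrier G \<and> f_map T n y = f_map T n w"
proof -
  obtain w' p v where c: "cstep\<^sup>*\<^sup>* w w'" and p: "p \<in> alcove" and tr: "ap w' p = p + v" "lp w' v = v"
    using csteps_to_translated_point[OF w] by blast
  have w'c: "w' \<in> carrier G" using csteps_carrier c w by blast
  let ?Q = "\<lambda>x. \<exists>y. ble y x \<and> len y < len x \<and> y \<in> carrier G \<and> f_map T n y = f_map T n x"
  have fm: "f_map T n z = f_map T n y" if "cstep y z" for y z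
    using cstep_conj[OF that] f_map_conj that unfolding cstep_def by (metis Wa_carrier)
  \<comment> \<open>Invariant of the chain: either \<open>w\<close> already has a smaller element in
    its fiber, or no length has dropped and a smaller element at the current end can be carried
    back.\<close>
  have "?Q w \<or> (len w' = len w \<and> (?Q w' \<longrightarrow> ?Q w))"
    using c
  proof (induction rule: rtranclp_induct)
    case (step y z)
    show ?case
    proof (cases "?Q w")
      case False
      then have IH: "len y = len w" "\<not> ?Q y" using step.IH by auto
      obtain i j k where s: "y \<in> carrier G" "simple i j k" "z = arefl i j k \<cdot> y \<cdot> arefl i j k" "len z \<le> len y"
        using step(2) unfolding cstep_def by blast
      let ?s = "arefl i j k"
      note I = simple_I[OF s(2)]
      have sc: "?s \<in> carrier G" using s by simp
      have zc: "z \<in> carrier G" using s sc by simp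
      have l: "len z = len y"
      proof (rule ccontr)
        assume "len z \<noteq> len y"
        then have lt: "len z < len y" using s by simp
        then have "ble z y" using simple_conj_down[OF s(1,2)] s(3) by simp
        then show False using IH(2) lt zc fm[OF step(2)] by blast
      qed
      have "\<not> ?Q z"
      proof
        assume "?Q z"
        then obtain x where x: "ble x z" "len x < len z" "x \<in> carrier G" "f_map T n x = f_map T n z" by blast
        have zy: "?s \<cdot> z \<cdot> ?s = y"
        proof -
          have "?s \<cdot> (?s \<cdot> y \<cdot> ?s) = ?s \<cdot> (?s \<cdot> y) \<cdot> ?s"
            using s(1) sc by (simp add: G.m_assoc)
          also have "\<dots> = y \<cdot> ?s" by (simp only: arefl_cancel[OF I s(1)])
          finally show ?thesis unfolding s(3) by (simp only: arefl_cancel'[OF I s(1)])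
        qed
        obtain u where u: "u = x \<or> u = ?s \<cdot> x \<cdot> ?s" "ble u y" "len u < len z"
          using simple_conj_transfer[OF zc s(2) _ x(1,2)] zy l by auto
        have "u \<in> carrier G" using u x sc by auto
        moreover have "f_map T n (?s \<cdot> x \<cdot> ?s) = f_map T n x"
          using f_map_conj[OF x(3) sc] inv_arefl[OF I] by simp
        then have "f_map T n u = f_map T n y" using u(1) x(4) fm[OF step(2)] by auto
        moreover have "len u < len y" using u(3) l by simp
        ultimately show False using IH(2) u(2) by blast
      qed
      then show ?thesis using l IH by auto
    qed blast
  qed simp
  moreover have "?Q w'" if "splits_at w' p v"
    using split_smaller[OF w'c chamD(1)[OF p] tr that] .
  moreover have False if "\<not> splits_at w' p v" "len w' = len w"
  proof -
    have g: "good T n w'" using good_of_not_split[OF w'c p tr that(1)] .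
    have "f_map T n w' = f_map T n w" using csteps_conj[OF c w] f_map_conj w by (metis Wa_carrier)
    then have "rho_norm (newton_vec T n w') = rho_norm (newton_vec T n w)" using f_map_rho_norm w w'c by blast
    then have "good T n w" using g that(2) good_iff[OF w] good_iff[OF w'c] by simp
    then show False using ng by blast
  qed
  ultimately show ?thesis by blast
qed

end

section \<open>Distinguished elements\<close>

lemma nat_block_ex:
  assumes "k < sum_list bs"
  shows "\<exists>j t. j < length bs \<and> t < bs ! j \<and> k = sum_list (take j bs) + (t::nat)"
  using assms
proof (induction bs arbitrary: k)
  case (Cons b bs)
  show ?case
  proof (cases "k < b")
    case True then show ?thesis by (intro exI[of _ 0] exI[of _ k]) simp
  next
    case False
    then have "k - b < sum_list bs" using Cons.prems by auto
    then obtain j t where "j < length bs" "t < bs ! j" "k - b = sum_list (take j bs) + t" using Cons.IH by blast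
    then show ?thesis using False by (intro exI[of _ "Suc j"] exI[of _ t]) auto
  qed
qed simp

lemma sum_take_Suc: "j < length bs \<Longrightarrow> sum_list (take (Suc j) bs) = sum_list (take j bs) + bs ! j" for bs :: "nat list"
  by (simp add: take_Suc_conv_app_nth)

lemma sum_take_mono: "i \<le> j \<Longrightarrow> sum_list (take i bs) \<le> sum_list (take j bs)" for bs :: "nat list"
proof -
  assume "i \<le> j"
  then have "take j bs = take i bs @ take (j - i) (drop i bs)" by (metis le_add_diff_inverse take_add)
  then show ?thesis by simp
qed

lemma concat_nth_block:
  assumes "j < length xss" "t < length (xss ! j)"
  shows "sum_list (take j (map length xss)) + t < length (concat xss) \<and>
    concat xss ! (sum_list (take j (map length xss)) + t) = xss ! j ! t"
  using assms
proof (induction xss arbitrary: j)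
  case (Cons xs xss)
  then show ?case by (cases j) (auto simp: nth_append)
qed simp

lemma foldr_comp_app: "foldr (\<circ>) (xs @ ys) id = foldr (\<circ>) xs id \<circ> foldr (\<circ>) ys id"
  by (induction xs) (auto simp: comp_assoc)

lemma foldr_comp_fix: "(\<And>f. f \<in> set fs \<Longrightarrow> f x = x) \<Longrightarrow> foldr (\<circ>) fs id x = x"
  by (induction fs) auto

text \<open>For cycles on disjoint blocks only the factor of the block of \<open>x\<close> acts: the
  factors applied before it fix \<open>x\<close>, those applied after it fix the image.\<close>

lemma foldr_comp_single:
  assumes j: "j < m" and fx: "\<And>i. i < m \<Longrightarrow> i \<noteq> j \<Longrightarrow> g i x = x \<and> g i (g j x) = g j x"
  shows "foldr (\<circ>) (map g [0..<m]) id x = g j x"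
proof -
  have "[0..<m] = [0..<j] @ [j] @ [Suc j..<m]"
    using j by (metis append_Cons append_Nil le0 less_imp_le_nat upt_add_eq_append upt_conv_Cons le_add_diff_inverse)
  then have e: "foldr (\<circ>) (map g [0..<m]) id = foldr (\<circ>) (map g [0..<j]) id \<circ> (g j \<circ> foldr (\<circ>) (map g [Suc j..<m]) id)"
    by (simp only: map_append foldr_comp_app) simp
  have "foldr (\<circ>) (map g [Suc j..<m]) id x = x" using fx by (intro foldr_comp_fix) auto
  moreover have "foldr (\<circ>) (map g [0..<j]) id (g j x) = g j x" using fx j by (intro foldr_comp_fix) auto
  ultimately show ?thesis unfolding e by simp
qed

section \<open>Signed cycles on blocks\<close>

lemma cycle_of_list_upto:
  assumes "a \<le> k" "k \<le> b" shows "cycle_of_list [a..b] k = (if k = b then a else k + 1 :: int)"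
proof -
  let ?i = "nat (k - a)"
  have i: "?i < length [a..b]" "[a..b] ! ?i = k" using assms by auto
  have "map (cycle_of_list [a..b]) [a..b] = rotate1 [a..b]"
    using cyclic_rotation[of "[a..b]" 1] by (simp add: rotate_def)
  then have "cycle_of_list [a..b] ([a..b] ! ?i) = rotate1 [a..b] ! ?i" using i(1) by (metis nth_map)
  also have "\<dots> = [a..b] ! (Suc ?i mod length [a..b])" using i(1) by (rule nth_rotate1)
  finally have 1: "cycle_of_list [a..b] k = [a..b] ! (Suc ?i mod length [a..b])" using i(2) by simp
  show ?thesis
  proof (cases "k = b")
    case True
    then have "Suc ?i = length [a..b]" using assms by simp
    then show ?thesis using 1 True assms by simp
  next
    case False
    then have "Suc ?i < length [a..b]" using assms by auto
    moreover have "[a..b] ! Suc ?i = k + 1" using assms False by simp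
    ultimately show ?thesis using 1 False by simp
  qed
qed

lemma signed_cycle_pos:
  assumes "\<forall>y\<in>set xs. y > 0" "x \<ge> 0" shows "signed_cycle xs x = cycle_of_list xs x"
proof -
  have "x \<notin> set (map uminus xs)" using assms by force
  then show ?thesis by (simp add: signed_cycle_def id_outside_supp)
qed

lemma cycle_of_list_in: "x \<in> set xs \<Longrightarrow> cycle_of_list xs x \<in> set xs"
  using cycle_permutes permutes_in_image by metis

lemma cycle_uminus:
  assumes "distinct xs" shows "cycle_of_list (map uminus xs) (- x) = - cycle_of_list xs (x::int)"
proof -
  have b: "bij (uminus :: int \<Rightarrow> int)" by (rule o_bij[of uminus]) auto
  have i: "inv_into UNIV (uminus :: int \<Rightarrow> int) = uminus" by (rule inv_equality) auto
  show ?thesis using fun_cong[OF conjugation_of_cycle[OF assms b], of "- x"] i by simp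
qed

lemma signed_cycle_odd:
  assumes "\<forall>y\<in>set xs. y > 0" "distinct xs" shows "signed_cycle xs (- x) = - signed_cycle xs (x::int)"
proof -
  have pos: "signed_cycle xs (- x) = - signed_cycle xs x" if "x \<ge> 0" for x
  proof -
    have "cycle_of_list xs x \<ge> 0" using cycle_of_list_in[of x xs] id_outside_supp[of x xs] assms that
      by (cases "x \<in> set xs") force+
    then have "- cycle_of_list xs x \<notin> set xs" using assms by force
    then show ?thesis unfolding signed_cycle_pos[OF assms(1) that]
      using cycle_uminus[OF assms(2)] by (simp add: signed_cycle_def id_outside_supp)
  qed
  show ?thesis
  proof (cases "x \<ge> 0")
    case False then show ?thesis using pos[of "- x"] by simp
  qed (use pos in simp)
qed

lemma block_end_Suc: "j < length l \<Longrightarrow> block_end l (Suc j) = block_end l j + int (fst (l ! j))"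
  by (simp add: block_end_def sum_take_Suc flip: take_map)

lemma block_end_mono: "i \<le> j \<Longrightarrow> block_end l i \<le> block_end l j"
  using sum_take_mono[of i j "map fst l"] by (simp add: block_end_def take_map)

lemma block_end_ge: "block_end l j \<ge> 0"
  by (simp add: block_end_def)

lemma block_end_le: "block_end l j \<le> int (sum_list (map fst l))"
  using sum_take_mono[of j "max j (length l)" "map fst l"] by (simp add: block_end_def take_map)

lemma block_ex:
  assumes "1 \<le> k" "k \<le> int (sum_list (map fst l))"
  obtains j t where "j < length l" "t < fst (l ! j)" "k = block_end l j + 1 + int t"
proof -
  have "nat (k - 1) < sum_list (map fst l)" using assms by linarith
  from nat_block_ex[OF this] obtain j t where *: "j < length (map fst l)" "t < map fst l ! j"
    "nat (k - 1) = sum_list (take j (map fst l)) + t" by blast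
  have "k = block_end l j + 1 + int t" using *(3) assms(1) unfolding block_end_def take_map by linarith
  then show thesis using that[of j t] *(1,2) by simp
qed

lemma dist_perm_odd:
  "snd (dist_elt l) (- k) = - snd (dist_elt l) k"
proof -
  have "foldr (\<circ>) (map (\<lambda>j. signed_cycle [block_end l j + 1..block_end l (Suc j)]) js) id (- k)
    = - foldr (\<circ>) (map (\<lambda>j. signed_cycle [block_end l j + 1..block_end l (Suc j)]) js) id k" for js
  proof (induction js)
    case (Cons j js)
    have "\<forall>y\<in>set [block_end l j + 1..block_end l (Suc j)]. y > 0" using block_end_ge[of l j] by auto
    then show ?case using Cons signed_cycle_odd by simp
  qed simp
  then show ?thesis by (simp add: dist_elt_def)
qed

lemma dist_perm_block:
  assumes j: "j < length l" and t: "t < fst (l ! j)"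
  shows "snd (dist_elt l) (block_end l j + 1 + int t) =
    (if Suc t < fst (l ! j) then block_end l j + 1 + int (Suc t) else block_end l j + 1)"
proof -
  let ?k = "block_end l j + 1 + int t"
  let ?L = "\<lambda>j. [block_end l j + 1..block_end l (Suc j)]"
  let ?g = "\<lambda>j. signed_cycle (?L j)"
  have pos: "\<forall>y\<in>set (?L i). y > 0" for i using block_end_ge[of l i] by auto
  have k: "block_end l j + 1 \<le> ?k" "?k \<le> block_end l (Suc j)" using t block_end_Suc[OF j] by auto
  have gk: "?g j ?k = (if ?k = block_end l (Suc j) then block_end l j + 1 else ?k + 1)"
    using signed_cycle_pos[OF pos, of ?k j] cycle_of_list_upto[OF k] block_end_ge[of l j] by simp
  have fx: "?g i x = x" if "i \<noteq> j" "block_end l j + 1 \<le> x" "x \<le> block_end l (Suc j)" for i x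
  proof -
    have "x \<notin> set (?L i)"
    proof (cases "i < j")
      case True then show ?thesis using block_end_mono[of "Suc i" j l] that by auto
    next
      case False then show ?thesis using block_end_mono[of "Suc j" i l] that by auto
    qed
    then show ?thesis using signed_cycle_pos[OF pos, of x i] that block_end_ge[of l j] by (simp add: id_outside_supp)
  qed
  have "snd (dist_elt l) ?k = ?g j ?k"
    unfolding dist_elt_def snd_conv
  proof (rule foldr_comp_single[OF j])
    fix i assume "i < length l" "i \<noteq> j"
    then show "?g i ?k = ?k \<and> ?g i (?g j ?k) = ?g j ?k" using fx k gk by auto
  qed
  then show ?thesis unfolding gk using t block_end_Suc[OF j] by auto
qed

text \<open>\<open>sum_fun_apply\<close> lives in the locale and is taken here at rank 1.\<close>

lemma dist_vec_apply: "fst (dist_elt l) k = (\<Sum>j<length l. of_int (snd (l ! j)) * unit_vec (block_end l (Suc j)) k)"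
  by (simp add: dist_elt_def affine_weyl.sum_fun_apply[of 1] affine_weyl_def Defs.scale_def)

text \<open>Blocks are nonempty, so their ends are distinct and positive, and at most one unit
  vector contributes at each position.\<close>

lemma dist_vec_block:
  assumes b: "\<forall>(b, c) \<in> set l. b \<ge> 1" and j: "j < length l" and t: "t < fst (l ! j)"
  shows "fst (dist_elt l) (block_end l j + 1 + int t) = (if Suc t = fst (l ! j) then of_int (snd (l ! j)) else 0)"
proof -
  let ?k = "block_end l j + 1 + int t"
  have fb: "fst (l ! i) \<ge> 1" if "i < length l" for i using bspec[OF b nth_mem[OF that]] by (simp add: case_prod_beta)
  have "unit_vec (block_end l (Suc i)) ?k = (if i = j \<and> Suc t = fst (l ! j) then 1 else 0)" if i: "i < length l" for i
  proof -
    have "?k \<noteq> - block_end l (Suc i)" using block_end_ge[of l j] block_end_ge[of l "Suc i"] by linarith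
    moreover have "?k = block_end l (Suc i) \<longleftrightarrow> i = j \<and> Suc t = fst (l ! j)"
    proof (cases i j rule: linorder_cases)
      case equal then show ?thesis using block_end_Suc[OF j] by auto
    next
      case less then show ?thesis using block_end_mono[of "Suc i" j l] by auto
    next
      case greater
      then have "block_end l (Suc j) \<le> block_end l i" using block_end_mono[of "Suc j" i l] by simp
      then show ?thesis using block_end_Suc[OF i] block_end_Suc[OF j] fb[OF i] t greater by auto
    qed
    ultimately show ?thesis by (auto simp: unit_vec_def)
  qed
  then have "fst (dist_elt l) ?k = (\<Sum>i<length l. if i = j then (if Suc t = fst (l ! j) then of_int (snd (l ! j)) else 0) else 0)"
    unfolding dist_vec_apply by (intro sum.cong) auto
  then show ?thesis using j by simp
qed

lemma dist_vec_odd: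
  assumes b: "\<forall>(b, c) \<in> set l. b \<ge> 1"
  shows "fst (dist_elt l) (- k) = - fst (dist_elt l) k"
proof -
  have fb: "fst (l ! i) \<ge> 1" if "i < length l" for i using bspec[OF b nth_mem[OF that]] by (simp add: case_prod_beta)
  have "block_end l (Suc j) \<noteq> 0" if "j < length l" for j
    using block_end_Suc[OF that] block_end_ge[of l j] fb[OF that] by linarith
  then have "unit_vec (block_end l (Suc j)) (- k) = - unit_vec (block_end l (Suc j)) k" if "j < length l" for j
    using that by (auto simp: unit_vec_def)
  then show ?thesis unfolding dist_vec_apply by (simp add: sum_negf[symmetric])
qed

section \<open>Slopes determine double partitions\<close>

lemma coprime_slope_eq:
  assumes "b \<ge> 1" "b' \<ge> 1" "gcd (int b) c = 1" "gcd (int b') c' = 1"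
    "of_int c / of_nat b = (of_int c' / of_nat b' :: rat)"
  shows "b = b' \<and> c = c'"
proof -
  have "of_int (c * int b') = (of_int (c' * int b) :: rat)" using assms by (simp add: field_simps)
  then have e: "c * int b' = c' * int b" by (simp only: of_int_eq_iff)
  have "int b dvd int b' * c" using e by (metis dvd_triv_right mult.commute)
  then have 1: "int b dvd int b'" using assms(3) by (metis coprime_dvd_mult_left_iff coprime_iff_gcd_eq_1)
  have "int b' dvd int b * c'" using e by (metis dvd_triv_right mult.commute)
  then have "int b' dvd int b" using assms(4) by (metis coprime_dvd_mult_left_iff coprime_iff_gcd_eq_1)
  then have "int b = int b'" using 1 by (intro zdvd_antisym_nonneg) auto
  then show ?thesis using e assms(1) by simp
qed

text \<open>The coordinates of the Newton vector of \<open>dist_elt l\<close> in order: the cycle of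
  a pair \<open>(b, c)\<close> contributes \<open>c / b\<close> at each of its \<open>b\<close>
  places (\<open>dist_newton\<close>).\<close>

definition slopes :: "(nat \<times> int) list \<Rightarrow> rat list" where
  "slopes l = concat (map (\<lambda>(b, c). replicate b (of_int c / of_nat b)) l)"

lemma length_slopes: "length (slopes l) = sum_list (map fst l)"
  unfolding slopes_def by (induction l) auto

lemma slopes_block:
  assumes "j < length l" "t < fst (l ! j)"
  shows "nat (block_end l j + int t) < length (slopes l)"
    "slopes l ! nat (block_end l j + int t) = of_int (snd (l ! j)) / of_nat (fst (l ! j))"
proof -
  let ?X = "map (\<lambda>(b, c). replicate b (of_int c / of_nat b :: rat)) l"
  have X: "?X ! j = replicate (fst (l ! j)) (of_int (snd (l ! j)) / of_nat (fst (l ! j)))"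
    using assms(1) by (simp add: case_prod_beta)
  have ml: "map length ?X = map fst l" by (simp add: case_prod_beta comp_def)
  have i: "sum_list (take j (map length ?X)) + t = nat (block_end l j + int t)"
    by (simp only: ml) (simp add: block_end_def take_map nat_int_add)
  have "j < length ?X" "t < length (?X ! j)" using assms X by simp_all
  note c = concat_nth_block[OF this, unfolded i]
  show "nat (block_end l j + int t) < length (slopes l)"
    using c unfolding slopes_def by blast
  show "slopes l ! nat (block_end l j + int t) = of_int (snd (l ! j)) / of_nat (fst (l ! j))"
    using c X assms(2) unfolding slopes_def by simp
qed

text \<open>Distinct coprime pairs have distinct slopes, so only copies of \<open>(b, c)\<close>
  contribute, each of them \<open>b\<close> times.\<close>

lemma count_slopes:
  assumes "\<forall>(b, c) \<in> set l. b \<ge> 1 \<and> gcd (int b) c = 1" "b \<ge> 1" "gcd (int b) c = 1"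
  shows "count_list (slopes l) (of_int c / of_nat b) = count_list l (b, c) * b"
  using assms(1)
proof (induction l)
  case (Cons x l)
  obtain b' c' where x: "x = (b', c')" by fastforce
  have "count_list (replicate b' (of_int c' / of_nat b' :: rat)) (of_int c / of_nat b) = (if x = (b, c) then b else 0)"
  proof (cases "of_int c / of_nat b = (of_int c' / of_nat b' :: rat)")
    case True
    then have "b = b' \<and> c = c'" using coprime_slope_eq[of b b' c c'] assms(2,3) Cons.prems x by auto
    then show ?thesis using x by (auto simp: count_list_eq_length_filter)
  next
    case False
    then have "x \<noteq> (b, c)" using x by auto
    then show ?thesis using False by (auto simp: count_list_0_iff)
  qed
  then show ?case using Cons x by (simp add: slopes_def)
qed (simp add: slopes_def)

lemma double_partition_sorted: "double_partition l \<Longrightarrow> sorted (rev l)"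
  unfolding double_partition_def sorted_wrt_rev
  by (auto elim!: sorted_wrt_mono_rel[rotated] simp: less_eq_prod_def)

text \<open>Equal slope counts give equal multisets of pairs, and sorting fixes the order.\<close>

lemma double_partition_eq:
  assumes l: "double_partition l" "\<forall>(b, c) \<in> set l. gcd (int b) c = 1"
    and l': "double_partition l'" "\<forall>(b, c) \<in> set l'. gcd (int b) c = 1"
    and e: "\<And>q. count_list (slopes l) q = count_list (slopes l') q"
  shows "l = l'"
proof -
  have c: "\<forall>(b, c) \<in> set l. b \<ge> 1 \<and> gcd (int b) c = 1" "\<forall>(b, c) \<in> set l'. b \<ge> 1 \<and> gcd (int b) c = 1"
    using l l' by (auto simp: double_partition_def)
  have "count_list l x = count_list l' x" for x
  proof -
    obtain b c where x: "x = (b, c)" by fastforce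
    show ?thesis
    proof (cases "b \<ge> 1 \<and> gcd (int b) c = 1")
      case True
      then show ?thesis using count_slopes[OF c(1), of b c] count_slopes[OF c(2), of b c] e x by simp
    next
      case False
      then have "x \<notin> set l" "x \<notin> set l'" using c x by auto
      then show ?thesis by (simp flip: count_list_0_iff)
    qed
  qed
  then have "mset (rev l) = mset (rev l')" by (intro multiset_eqI) (simp add: count_mset)
  then have "sort (rev l') = rev l" by (intro properties_for_sort double_partition_sorted l)
  moreover have "sort (rev l') = rev l'" by (intro sorted_sort_id double_partition_sorted l') 
  ultimately show ?thesis by simp
qed

text \<open>Describes functions on \<open>1..n\<close> block by block: the entry at offset
  \<open>t\<close> in the block of \<open>x\<close> is \<open>f x t\<close>.\<close>

definition blocks :: "('a \<Rightarrow> nat) \<Rightarrow> ('a \<Rightarrow> nat \<Rightarrow> 'b) \<Rightarrow> 'a list \<Rightarrow> 'b list" where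
  "blocks r f xs = concat (map (\<lambda>x. map (f x) [0..<r x]) xs)"

lemma blocks_nth:
  assumes "j < length xs" "t < r (xs ! j)"
  shows "blocks r f xs ! (sum_list (take j (map r xs)) + t) = f (xs ! j) t"
proof -
  let ?X = "map (\<lambda>x. map (f x) [0..<r x]) xs"
  have ml: "map length ?X = map r xs" by (simp add: comp_def)
  have "j < length ?X" "t < length (?X ! j)" using assms by simp_all
  from concat_nth_block[OF this, unfolded ml] show ?thesis using assms by (simp add: blocks_def)
qed

context affine_weyl
begin

definition oext :: "(int \<Rightarrow> 'a::ab_group_add) \<Rightarrow> int \<Rightarrow> 'a" where
  "oext F k = (if 1 \<le> k \<and> k \<le> int n then F k else if 1 \<le> - k \<and> - k \<le> int n then - F (- k) else 0)"

lemma oext_odd: "oext F (- k) = - oext F k"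
  by (auto simp: oext_def)

lemma oext_pos: "1 \<le> k \<Longrightarrow> k \<le> int n \<Longrightarrow> oext F k = F k"
  by (simp add: oext_def)

lemma oext_notin: "k \<notin> J \<Longrightarrow> oext F k = 0"
  by (auto simp: oext_def J_def)

lemma odd_eqI:
  fixes f g :: "int \<Rightarrow> 'a::ab_group_add"
  assumes "\<And>k. f (- k) = - f k" "\<And>k. g (- k) = - g k" "\<And>k. k \<notin> J \<Longrightarrow> f k = g k"
    "\<And>k. 1 \<le> k \<Longrightarrow> k \<le> int n \<Longrightarrow> f k = g k"
  shows "f = g"
proof
  fix k show "f k = g k"
  proof (cases "k \<in> J")
    case True
    from J_cases[OF this] consider "1 \<le> k" "k \<le> int n" | "1 \<le> - k" "- k \<le> int n" by auto
    then show ?thesis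
    proof cases
      case 2
      then have "f (- k) = g (- k)" using assms(4) by blast
      then show ?thesis using assms(1,2) by simp
    qed (use assms(4) in blast)
  qed (use assms(3) in blast)
qed

lemma dist_perm_range:
  assumes l: "sum_list (map fst l) = n" and k: "1 \<le> k" "k \<le> int n"
  obtains j t where "j < length l" "t < fst (l ! j)" "k = block_end l j + 1 + int t"
    "snd (dist_elt l) k = (if Suc t < fst (l ! j) then block_end l j + 1 + int (Suc t) else block_end l j + 1)"
    "1 \<le> snd (dist_elt l) k" "snd (dist_elt l) k \<le> int n"
proof -
  obtain j t where jt: "j < length l" "t < fst (l ! j)" "k = block_end l j + 1 + int t"
    using block_ex[of k l] k l by metis
  have e: "snd (dist_elt l) k = (if Suc t < fst (l ! j) then block_end l j + 1 + int (Suc t) else block_end l j + 1)"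
    using dist_perm_block[OF jt(1,2)] jt(3) by simp
  have "block_end l (Suc j) \<le> int n" using block_end_le[of l "Suc j"] l by simp
  then have "block_end l j + int (fst (l ! j)) \<le> int n" using block_end_Suc[OF jt(1)] by simp
  then have "1 \<le> snd (dist_elt l) k" "snd (dist_elt l) k \<le> int n"
    unfolding e using block_end_ge[of l j] jt(2) by auto
  then show thesis using that jt e by blast
qed

lemma dist_perm_surj:
  assumes l: "sum_list (map fst l) = n" and d: "snd (dist_elt l) \<in> weyl T n" and k: "1 \<le> k" "k \<le> int n"
  obtains k' where "1 \<le> k'" "k' \<le> int n" "k = snd (dist_elt l) k'"
proof -
  let ?s = "snd (dist_elt l)"
  let ?k = "inv_into UNIV ?s k"
  have kk: "?s ?k = k" using d by simp
  have "k \<in> J" using k by (auto simp: J_def)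
  then have "?k \<in> J" using weyl_inv[OF d] by simp
  moreover have "\<not> ?k < 0"
  proof
    assume "?k < 0"
    with \<open>?k \<in> J\<close> have "1 \<le> - ?k" "- ?k \<le> int n" by (auto simp: J_def)
    then have "1 \<le> ?s (- ?k)" using dist_perm_range[OF l] by metis
    then show False using dist_perm_odd[of l ?k] kk k by simp
  qed
  ultimately have "1 \<le> ?k" "?k \<le> int n" by (auto simp: J_def)
  then show thesis using that kk by metis
qed

text \<open>By \<open>newton_vec_eq\<close> it suffices to exhibit a point \<open>P\<close> that is
  translated by the vector \<open>V\<close> of slopes.\<close>

lemma dist_newton:
  assumes l: "sum_list (map fst l) = n" and b: "\<forall>(b, c) \<in> set l. b \<ge> 1" and d: "dist_elt l \<in> carrier G"
    and k: "1 \<le> k" "k \<le> int n"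
  shows "newton_vec T n (dist_elt l) k = slopes l ! nat (k - 1)"
proof -
  let ?d = "dist_elt l"
  let ?s = "snd ?d" and ?a = "fst ?d"
  have w: "?s \<in> weyl T n" using d by simp
  \<comment> \<open>Solves the translation condition around one cycle: each step lowers the
    coordinate by the slope, and \<open>c\<close> is added at the last place of the block, where the
    translation part sits. For \<open>b = 1\<close> first and last place coincide.\<close>
  define pf where "pf = (\<lambda>(b::nat, c::int) (t::nat). - of_nat t * (of_int c / of_nat b) + (if Suc t = b then of_int c else (0::real)))"
  define P where "P = oext (\<lambda>k. blocks fst pf l ! nat (k - 1))"
  define V where "V = oext (\<lambda>k. real_of_rat (slopes l ! nat (k - 1)))"
  have sb: "P (block_end l j + 1 + int t) = pf (l ! j) t"
    "V (block_end l j + 1 + int t) = of_int (snd (l ! j)) / of_nat (fst (l ! j))"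
    if jt: "j < length l" "t < fst (l ! j)" for j t
  proof -
    have le: "1 \<le> block_end l j + 1 + int t" "block_end l j + 1 + int t \<le> int n"
      using block_end_ge[of l j] block_end_le[of l "Suc j"] block_end_Suc[OF jt(1)] jt(2) l by auto
    have i: "nat (block_end l j + 1 + int t - 1) = sum_list (take j (map fst l)) + t"
      by (simp add: block_end_def take_map nat_int_add)
    show "P (block_end l j + 1 + int t) = pf (l ! j) t"
      unfolding P_def oext_pos[OF le] i using blocks_nth[OF jt(1), of t fst pf] jt by simp
    show "V (block_end l j + 1 + int t) = of_int (snd (l ! j)) / of_nat (fst (l ! j))"
      unfolding V_def oext_pos[OF le] using slopes_block(2)[OF jt] by (simp add: of_rat_divide)
  qed
  have Po: "P (- k) = - P k" and Vo: "V (- k) = - V k" for k by (simp_all add: P_def V_def oext_odd)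
  have key: "of_rat (?a (?s k)) + P k = P (?s k) + V (?s k)" "V (?s k) = V k" if k: "1 \<le> k" "k \<le> int n" for k
  proof -
    obtain j t where jt: "j < length l" "t < fst (l ! j)" "k = block_end l j + 1 + int t"
      "?s k = (if Suc t < fst (l ! j) then block_end l j + 1 + int (Suc t) else block_end l j + 1)"
      using dist_perm_range[OF l k] by metis
    obtain bb c where bc: "l ! j = (bb, c)" by fastforce
    have bpos: "bb > 0" using jt(2) bc by simp
    have Pk: "P k = pf (bb, c) t" and Vk: "V k = of_int c / of_nat bb" using sb[OF jt(1,2)] jt(3) bc by simp_all
    show "of_rat (?a (?s k)) + P k = P (?s k) + V (?s k)" "V (?s k) = V k"
    proof -
      show "V (?s k) = V k"
      proof (cases "Suc t < bb")
        case True
        then show ?thesis using sb(2)[OF jt(1), of "Suc t"] bc jt(4) Vk by simp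
      next
        case False
        then show ?thesis using sb(2)[OF jt(1), of 0] bc jt(4) Vk bpos by simp
      qed
      then have Vs: "V (?s k) = of_int c / of_nat bb" using Vk by simp
      show "of_rat (?a (?s k)) + P k = P (?s k) + V (?s k)"
      proof (cases "Suc t < bb")
        case True
        have s: "?s k = block_end l j + 1 + int (Suc t)" using True jt(4) bc by simp
        have "?a (?s k) = (if Suc (Suc t) = bb then of_int c else 0)" "P (?s k) = pf (bb, c) (Suc t)"
          using dist_vec_block[OF b jt(1), of "Suc t"] sb(1)[OF jt(1), of "Suc t"] s True bc by simp_all
        then show ?thesis unfolding Pk Vs using True bpos by (simp add: pf_def field_simps)
      next
        case False
        then have t: "Suc t = bb" using jt(2) bc by simp
        have s: "?s k = block_end l j + 1 + int 0" using False jt(4) bc by simp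
        have "?a (?s k) = (if Suc 0 = bb then of_int c else 0)" "P (?s k) = pf (bb, c) 0"
          using dist_vec_block[OF b jt(1), of 0] sb(1)[OF jt(1), of 0] s bpos bc by simp_all
        then have a: "real_of_rat (?a (?s k)) = P (?s k)" by (simp add: pf_def)
        have "real bb = of_nat t + 1" using t by simp
        then have "real_of_int c = (of_nat t + 1) * (of_int c / of_nat bb)" using bpos by simp
        then have "pf (bb, c) t = of_int c / of_nat bb" using t unfolding pf_def by (simp add: add_divide_distrib distrib_right)
        then show ?thesis unfolding Pk Vs a by simp
      qed
    qed
  qed
  have ao: "?a (- k) = - ?a k" and a0': "k \<notin> J \<Longrightarrow> ?a k = 0" for k
    using trans_lattice_odd[OF carrier_fst[OF d]] trans_lattice_notin[OF carrier_fst[OF d]] by auto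
  have "ap ?d P = P + V"
  proof (rule odd_eqI)
    fix k assume "1 \<le> k" "k \<le> int n"
    then obtain k' where k': "1 \<le> k'" "k' \<le> int n" "k = ?s k'" using dist_perm_surj[OF l w] by metis
    then show "ap ?d P k = (P + V) k" using key(1)[OF k'(1,2)] w by (simp add: ap_def)
  next
    fix k assume "k \<notin> J"
    then show "ap ?d P k = (P + V) k"
      using weyl_notin[OF weyl_inv[OF w]] a0' by (simp add: ap_def P_def V_def oext_notin)
  next
    fix k show "ap ?d P (- k) = - ap ?d P k"
      using weyl_odd[OF weyl_inv[OF w]] ao Po by (simp add: ap_def of_rat_minus)
    show "(P + V) (- k) = - (P + V) k" using Po Vo by simp
  qed
  moreover have "lp ?d V = V"
  proof (rule odd_eqI)
    fix k assume "1 \<le> k" "k \<le> int n"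
    then obtain k' where k': "1 \<le> k'" "k' \<le> int n" "k = ?s k'" using dist_perm_surj[OF l w] by metis
    then show "lp ?d V k = V k" using key(2)[OF k'(1,2)] w by (simp add: lp_def)
  next
    fix k assume "k \<notin> J"
    then show "lp ?d V k = V k"
      using weyl_notin[OF weyl_inv[OF w]] by (simp add: lp_def)
  next
    fix k show "lp ?d V (- k) = - lp ?d V k"
      using weyl_odd[OF weyl_inv[OF w]] Vo by (simp add: lp_def)
    show "V (- k) = - V k" using Vo .
  qed
  ultimately have "real_of_rat (newton_vec T n ?d k) = V k" using newton_vec_eq[OF d] by blast
  then show ?thesis using k by (simp add: V_def oext_pos)
qed

lemma dist_newton_count:
  assumes l: "sum_list (map fst l) = n" and b: "\<forall>(b, c) \<in> set l. b \<ge> 1" and d: "dist_elt l \<in> carrier G"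
  shows "count_list (slopes l) q = card {k \<in> {1..int n}. newton_vec T n (dist_elt l) k = q}"
proof -
  have "count_list (slopes l) q = card {i. i < n \<and> slopes l ! i = q}"
    using length_filter_conv_card[of "(=) q" "slopes l"] length_slopes[of l] l
    by (simp add: count_list_eq_length_filter eq_commute)
  also have "\<dots> = card ((\<lambda>i. int i + 1) ` {i. i < n \<and> slopes l ! i = q})"
    by (rule card_image[symmetric]) (auto simp: inj_on_def)
  also have "(\<lambda>i. int i + 1) ` {i. i < n \<and> slopes l ! i = q} = {k \<in> {1..int n}. newton_vec T n (dist_elt l) k = q}"
  proof (intro equalityI subsetI)
    fix k assume "k \<in> (\<lambda>i. int i + 1) ` {i. i < n \<and> slopes l ! i = q}"
    then obtain i where "i < n" "slopes l ! i = q" "k = int i + 1" by blast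
    then show "k \<in> {k \<in> {1..int n}. newton_vec T n (dist_elt l) k = q}" using dist_newton[OF assms, of k] by simp
  next
    fix k assume k: "k \<in> {k \<in> {1..int n}. newton_vec T n (dist_elt l) k = q}"
    then have "slopes l ! nat (k - 1) = q" using dist_newton[OF assms, of k] by simp
    then show "k \<in> (\<lambda>i. int i + 1) ` {i. i < n \<and> slopes l ! i = q}"
      using k by (intro image_eqI[of _ _ "nat (k - 1)"]) auto
  qed
  finally show ?thesis .
qed

lemma admissible_D:
  assumes "admissible T n l"
  shows "double_partition l" "sum_list (map fst l) = n" "\<forall>(b, c) \<in> set l. gcd (int b) c = 1"
    "\<forall>(b, c) \<in> set l. b \<ge> 1" "\<not> is_A \<Longrightarrow> \<forall>(b, c) \<in> set l. c \<ge> 0"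
proof -
  show "double_partition l" "sum_list (map fst l) = n" "\<forall>(b, c) \<in> set l. gcd (int b) c = 1"
    using assms unfolding admissible_def by auto
  then show "\<forall>(b, c) \<in> set l. b \<ge> 1" by (simp add: double_partition_def)
  have "\<not> is_A \<Longrightarrow> T = TypeC" unfolding is_A_def by (cases T) simp_all
  then show "\<not> is_A \<Longrightarrow> \<forall>(b, c) \<in> set l. c \<ge> 0" using assms unfolding admissible_def by blast
qed

lemma dist_newton_nonneg:
  assumes a: "admissible T n l" and d: "dist_elt l \<in> carrier G" and nA: "\<not> is_A" and k: "1 \<le> k" "k \<le> int n"
  shows "newton_vec T n (dist_elt l) k \<ge> 0"
proof -
  have "nat (k - 1) < length (slopes l)" using k admissible_D(2)[OF a] by (simp add: length_slopes)
  then have "slopes l ! nat (k - 1) \<in> set (slopes l)" by simp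
  also have "set (slopes l) \<subseteq> {0..}"
    using admissible_D(5)[OF a nA] unfolding slopes_def by (auto simp: split_beta)
  finally show ?thesis using dist_newton[OF admissible_D(2,4)[OF a] d k] by simp
qed

text \<open>Forgetting signs in the Weyl group element that relates the two Newton vectors gives a
  permutation of positions matching the slopes, which are nonnegative in type C. So both lists have
  the same slopes with multiplicity.\<close>

lemma dist_elt_unique:
  assumes a: "admissible T n l" "dist_elt l \<in> carrier G" and a': "admissible T n l'" "dist_elt l' \<in> carrier G"
    and f: "f_map T n (dist_elt l) = f_map T n (dist_elt l')"
  shows "l = l'"
proof -
  let ?v = "newton_vec T n (dist_elt l)" and ?v' = "newton_vec T n (dist_elt l')"
  obtain \<rho> where r: "\<rho> \<in> weyl T n" "?v = act \<rho> ?v'" using f f_map_eq_iff a a' by blast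
  let ?u = "inv_into UNIV \<rho>"
  have u: "?u \<in> weyl T n" using r weyl_inv by blast
  have v'o: "?v' (- k) = - ?v' k" for k using newton_vec_vecs[OF a'(2)] vecs_iff by blast
  have bij: "bij_betw (\<lambda>k. \<bar>?u k\<bar>) {1..int n} {1..int n}"
  proof (rule bij_betwI[where g = "\<lambda>k. \<bar>\<rho> k\<bar>"])
    have *: "\<bar>\<tau> k\<bar> \<in> {1..int n}" if "\<tau> \<in> weyl T n" "k \<in> {1..int n}" for \<tau> k
    proof -
      have "k \<in> J" using that(2) by (auto simp: J_def)
      then have "\<tau> k \<in> J" using that(1) by simp
      then show ?thesis by (auto simp: J_def)
    qed
    show "(\<lambda>k. \<bar>?u k\<bar>) \<in> {1..int n} \<rightarrow> {1..int n}" "(\<lambda>k. \<bar>\<rho> k\<bar>) \<in> {1..int n} \<rightarrow> {1..int n}"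
      using * u r by auto
    have ab: "\<bar>\<tau> \<bar>y\<bar>\<bar> = \<bar>\<tau> y\<bar>" if "\<tau> \<in> weyl T n" for \<tau> y
      using weyl_odd[OF that, of y] by (cases "y \<ge> 0") auto
    show "\<bar>\<rho> \<bar>?u k\<bar>\<bar> = k" "\<bar>?u \<bar>\<rho> k\<bar>\<bar> = k" if "k \<in> {1..int n}" for k
      using that ab r u by auto
  qed
  have vv: "?v k = ?v' \<bar>?u k\<bar>" if k: "k \<in> {1..int n}" for k
  proof (cases "?u k \<ge> 0")
    case True then show ?thesis using r(2) by (simp add: act_def)
  next
    case False
    have nA: "\<not> is_A"
    proof
      assume is_A
      then have "\<forall>i>0. 0 < ?u i" using u unfolding weyl_iff by blast
      then have "0 < ?u k" using k by simp
      then show False using False by linarith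
    qed
    \<comment> \<open>A sign change relates two nonnegative slopes, so both are zero.\<close>
    have e: "?v k = - ?v' \<bar>?u k\<bar>" using fun_cong[OF r(2), of k] v'o[of "?u k"] False by (simp add: act_def)
    moreover have "\<bar>?u k\<bar> \<in> {1..int n}" using bij_betw_apply[OF bij k] .
    then have "?v' \<bar>?u k\<bar> \<ge> 0" using dist_newton_nonneg[OF a' nA] by simp
    moreover have "?v k \<ge> 0" using dist_newton_nonneg[OF a nA] k by simp
    ultimately show ?thesis by simp
  qed
  have "card {k \<in> {1..int n}. ?v k = q} = card {k \<in> {1..int n}. ?v' k = q}" for q
  proof (rule bij_betw_same_card)
    show "bij_betw (\<lambda>k. \<bar>?u k\<bar>) {k \<in> {1..int n}. ?v k = q} {k \<in> {1..int n}. ?v' k = q}"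
      unfolding bij_betw_def
    proof
      show "inj_on (\<lambda>k. \<bar>?u k\<bar>) {k \<in> {1..int n}. ?v k = q}"
        using bij unfolding bij_betw_def by (rule inj_on_subset[OF conjunct1]) auto
      show "(\<lambda>k. \<bar>?u k\<bar>) ` {k \<in> {1..int n}. ?v k = q} = {k \<in> {1..int n}. ?v' k = q}"
      proof (intro equalityI subsetI)
        fix y assume y: "y \<in> {k \<in> {1..int n}. ?v' k = q}"
        then obtain k where "k \<in> {1..int n}" "y = \<bar>?u k\<bar>" using bij unfolding bij_betw_def by blast
        then show "y \<in> (\<lambda>k. \<bar>?u k\<bar>) ` {k \<in> {1..int n}. ?v k = q}" using y vv by auto
      qed (use bij_betw_apply[OF bij] vv in auto)
    qed
  qed
  then have "count_list (slopes l) q = count_list (slopes l') q" for q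
    using dist_newton_count[OF admissible_D(2,4)[OF a(1)] a(2)]
      dist_newton_count[OF admissible_D(2,4)[OF a'(1)] a'(2)] by simp
  then show ?thesis
    by (rule double_partition_eq[OF admissible_D(1,3)[OF a(1)] admissible_D(1,3)[OF a'(1)]])
qed

end

section \<open>Cycles of a permutation\<close>

definition period :: "('a \<Rightarrow> 'a) \<Rightarrow> 'a \<Rightarrow> nat" where
  "period f x = (LEAST m. m \<ge> 1 \<and> (f ^^ m) x = x)"

lemma period_props:
  assumes "m \<ge> 1" "(f ^^ m) x = x"
  shows "period f x \<ge> 1" "(f ^^ period f x) x = x" "period f x \<le> m"
proof -
  have "period f x \<ge> 1 \<and> (f ^^ period f x) x = x"
    unfolding period_def by (rule LeastI[of _ m]) (use assms in blast)
  then show "period f x \<ge> 1" "(f ^^ period f x) x = x" by auto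
  show "period f x \<le> m" unfolding period_def by (rule Least_le) (use assms in blast)
qed

lemma funpow_inj_period:
  assumes "inj f" "t < period f x" "t' < period f x" "(f ^^ t) x = (f ^^ t') x"
  shows "t = t'"
proof -
  have *: False if "t < t'" "t' < period f x" "(f ^^ t) x = (f ^^ t') x" for t t'
  proof -
    have "f ^^ t' = f ^^ t \<circ> f ^^ (t' - t)" using funpow_add[of t "t' - t" f] that(1) by simp
    then have "(f ^^ t') x = (f ^^ t) ((f ^^ (t' - t)) x)" by simp
    then have "(f ^^ (t' - t)) x = x" using that(3) inj_fn[OF assms(1), of t] by (simp add: inj_eq)
    then have "period f x \<le> t' - t" using that(1) by (intro period_props(3)) auto
    then show False using that by simp
  qed
  show ?thesis using *[of t t'] *[of t' t] assms by (metis linorder_neqE_nat)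
qed

text \<open>The least element represents its orbit, and iterating below the period lists the orbit
  once.\<close>

lemma orbit_representatives:
  fixes f :: "'a::linorder \<Rightarrow> 'a"
  assumes X: "finite X" and f: "inj f" and cl: "\<And>x. x \<in> X \<Longrightarrow> f x \<in> X"
    and per: "\<And>x. x \<in> X \<Longrightarrow> \<exists>m\<ge>1. (f ^^ m) x = x"
  obtains R where "R \<subseteq> X" "bij_betw (\<lambda>(x, t). (f ^^ t) x) (Sigma R (\<lambda>x. {..<period f x})) X"
proof -
  define orb where "orb x = range (\<lambda>m. (f ^^ m) x)" for x
  have pp: "period f x \<ge> 1" "(f ^^ period f x) x = x" if x: "x \<in> X" for x
  proof -
    obtain m where "m \<ge> 1" "(f ^^ m) x = x" using per[OF x] by blast
    from period_props[OF this] show "period f x \<ge> 1" "(f ^^ period f x) x = x" by auto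
  qed
  have it: "(f ^^ m) x \<in> X" if "x \<in> X" for m x using that cl by (induction m) auto
  have orbX: "orb x \<subseteq> X" if "x \<in> X" for x using it[OF that] by (auto simp: orb_def)
  have fin: "finite (orb x)" if "x \<in> X" for x using finite_subset[OF orbX[OF that] X] .
  have self: "x \<in> orb x" for x unfolding orb_def by (rule range_eqI[of _ _ 0]) simp
  have orb_f: "orb (f x) = orb x" if x: "x \<in> X" for x
  proof
    have "(f ^^ m) (f x) = (f ^^ Suc m) x" for m by (simp only: funpow_Suc_right comp_apply)
    then show "orb (f x) \<subseteq> orb x" unfolding orb_def by blast
    show "orb x \<subseteq> orb (f x)"
    proof
      fix y assume "y \<in> orb x"
      then obtain m where m: "y = (f ^^ m) x" by (auto simp: orb_def)
      have "y = (f ^^ m) ((f ^^ period f x) x)" using m pp[OF x] by simp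
      also have "\<dots> = (f ^^ (m + (period f x - 1))) (f x)"
      proof -
        have "(f ^^ period f x) x = (f ^^ (period f x - 1)) (f x)"
          using pp(1)[OF x] by (metis Suc_diff_1 Suc_le_eq One_nat_def funpow_Suc_right comp_apply)
        then show ?thesis by (simp only: funpow_add comp_apply)
      qed
      finally show "y \<in> orb (f x)" unfolding orb_def by blast
    qed
  qed
  have orb_it: "orb ((f ^^ m) x) = orb x" if x: "x \<in> X" for m x
    by (induction m) (use orb_f it[OF x] in auto)
  define R where "R = {x \<in> X. Min (orb x) = x}"
  have "inj_on (\<lambda>(x, t). (f ^^ t) x) (Sigma R (\<lambda>x. {..<period f x}))"
  proof (rule inj_onI, clarsimp)
    fix x t x' t' assume x: "x \<in> R" "x' \<in> R" and t: "t < period f x" "t' < period f x'" and e: "(f ^^ t) x = (f ^^ t') x'"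
    have "orb x = orb x'" using orb_it[of x t] orb_it[of x' t'] e x by (simp add: R_def)
    then have xx: "x = x'" using x by (metis (mono_tags, lifting) R_def mem_Collect_eq)
    then show "x = x' \<and> t = t'" using funpow_inj_period[OF f] t e by blast
  qed
  moreover have "(\<lambda>(x, t). (f ^^ t) x) ` (Sigma R (\<lambda>x. {..<period f x})) = X"
  proof (intro equalityI subsetI)
    fix y assume y: "y \<in> X"
    define x where "x = Min (orb y)"
    have xo: "x \<in> orb y" unfolding x_def using fin[OF y] self by (intro Min_in) auto
    then obtain m where "x = (f ^^ m) y" by (auto simp: orb_def)
    then have ox: "orb x = orb y" and xX: "x \<in> X" using orb_it y it by auto
    then have xR: "x \<in> R" by (simp add: R_def x_def)
    have "y \<in> orb x" using self ox by blast
    then obtain m' where "y = (f ^^ m') x" by (auto simp: orb_def)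
    then have "y = (f ^^ (m' mod period f x)) x" using funpow_mod_eq[OF pp(2)[OF xX], of m'] by simp
    moreover have "m' mod period f x < period f x" using pp(1)[OF xX] by simp
    ultimately show "y \<in> (\<lambda>(x, t). (f ^^ t) x) ` (Sigma R (\<lambda>x. {..<period f x}))"
      using xR by (intro image_eqI[of _ _ "(x, m' mod period f x)"]) auto
  qed (use it in \<open>auto simp: R_def\<close>)
  ultimately show thesis using that[of R] by (auto simp: bij_betw_def R_def)
qed

context affine_weyl
begin

lemma dist_perm_notin:
  assumes l: "sum_list (map fst l) = n" and k: "k \<notin> J" shows "snd (dist_elt l) k = k"
proof -
  have pos: "snd (dist_elt l) k = k" if k: "k \<notin> J" "k \<ge> 0" for k
    unfolding dist_elt_def snd_conv
  proof (rule foldr_comp_fix)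
    fix f assume "f \<in> set (map (\<lambda>j. signed_cycle [block_end l j + 1..block_end l (Suc j)]) [0..<length l])"
    then obtain j where j: "f = signed_cycle [block_end l j + 1..block_end l (Suc j)]" by auto
    have "\<forall>y\<in>set [block_end l j + 1..block_end l (Suc j)]. y > 0" using block_end_ge[of l j] by auto
    moreover have "k \<notin> set [block_end l j + 1..block_end l (Suc j)]"
      using k block_end_ge[of l j] block_end_le[of l "Suc j"] l by (auto simp: J_def)
    ultimately show "f k = k" unfolding j using k signed_cycle_pos by (simp add: id_outside_supp)
  qed
  show ?thesis
  proof (cases "k \<ge> 0")
    case False
    then have "snd (dist_elt l) (- k) = - k" using k by (intro pos) auto
    then show ?thesis using dist_perm_odd[of l k] by simp
  qed (use pos k in blast)
qed

text \<open>The set \<open>X\<close> is a half of the signed indices stable under \<open>w\<close>.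
  Each of its cycles becomes a block, with the cycle length and the total translation along the
  cycle as its pair. The conjugating element takes block positions to cycle elements and gathers the
  translation at the last position of each block.\<close>

lemma dist_construct:
  assumes w: "w \<in> carrier G" and fi: "\<And>i. fst w i \<in> \<int>"
    and X1: "X \<inter> uminus ` X = {}" "X \<union> uminus ` X = J" and X2: "\<And>i. i \<in> X \<Longrightarrow> snd w i \<in> X"
    and X3: "is_A \<Longrightarrow> X \<subseteq> {1..int n}"
    and c: "\<And>i. i \<in> X \<Longrightarrow> (\<Sum>m<period (snd w) i. fst w ((snd w ^^ m) i)) = of_int (c i)"
    and gc: "\<And>i. i \<in> X \<Longrightarrow> gcd (int (period (snd w) i)) (c i) = 1"
    and c0: "\<And>i. i \<in> X \<Longrightarrow> \<not> is_A \<Longrightarrow> c i \<ge> 0"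
  shows "\<exists>l g. admissible T n l \<and> g \<in> carrier G \<and> dist_elt l \<in> carrier G \<and> w = g \<cdot> dist_elt l \<cdot> ginv g"
proof -
  let ?s = "snd w" and ?\<chi> = "fst w"
  let ?r = "period ?s"
  have s: "?s \<in> weyl T n" using w by simp
  have XJ: "X \<subseteq> J" using X1 by blast
  have finX: "finite X" using finite_subset[OF XJ] by simp
  have injs: "inj ?s" using weyl_bij[OF s] bij_is_inj by blast
  obtain M where M: "M \<ge> 1" "?s ^^ M = id" using permutes_power_id[OF finite_J weyl_permutes[OF s]] by blast
  have per: "\<exists>m\<ge>1. (?s ^^ m) x = x" for x using M by (metis id_apply)
  have pp: "?r x \<ge> 1" "(?s ^^ ?r x) x = x" for x
  proof -
    obtain m where "m \<ge> 1" "(?s ^^ m) x = x" using per[of x] by blast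
    from period_props[OF this] show "?r x \<ge> 1" "(?s ^^ ?r x) x = x" by auto
  qed
  obtain R where R: "R \<subseteq> X" "bij_betw (\<lambda>(x, t). (?s ^^ t) x) (Sigma R (\<lambda>x. {..<?r x})) X"
    using orbit_representatives[OF finX injs X2 per] by blast
  have finR: "finite R" using R(1) finX finite_subset by blast
  define key where "key x = (?r x, c x)" for x
  \<comment> \<open>Reversing the sort gives the weakly decreasing lexicographic order of a double
    partition.\<close>
  define xs where "xs = rev (sort_key key (sorted_list_of_set R))"
  have xs: "set xs = R" "distinct xs" using finR by (auto simp: xs_def)
  define l where "l = map key xs"
  have len: "length l = length xs" and nthl: "\<And>j. j < length xs \<Longrightarrow> l ! j = (?r (xs ! j), c (xs ! j))"
    by (auto simp: l_def key_def)
  have mf: "map fst l = map ?r xs" by (simp add: l_def key_def)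
  have "sorted (rev l)" by (simp add: l_def xs_def rev_map)
  then have dp: "double_partition l"
    unfolding double_partition_def sorted_wrt_rev
    using pp(1) by (auto elim!: sorted_wrt_mono_rel[rotated] simp: less_eq_prod_def l_def key_def)
  have cardX: "card X = n"
  proof -
    have inj: "inj_on abs X"
    proof (rule inj_onI)
      fix x y assume "x \<in> X" "y \<in> X" "\<bar>x\<bar> = \<bar>y\<bar>"
      then show "x = y" using X1(1) by (auto simp: abs_eq_iff)
    qed
    have "abs ` X = {1..int n}"
    proof (intro equalityI subsetI)
      fix y assume y: "y \<in> {1..int n}"
      then have "y \<in> J" by (auto simp: J_def)
      then have "y \<in> X \<or> - y \<in> X" using X1(2) by force
      then show "y \<in> abs ` X" using y by (auto intro: image_eqI[of y abs y] image_eqI[of y abs "- y"])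
    qed (use XJ in \<open>auto simp: J_def\<close>)
    then show ?thesis using card_image[OF inj] by simp
  qed
  have suml: "sum_list (map fst l) = n"
  proof -
    have "sum_list (map ?r xs) = (\<Sum>x\<in>R. ?r x)" using xs by (simp add: sum_list_distinct_conv_sum_set)
    also have "\<dots> = card (Sigma R (\<lambda>x. {..<?r x}))" using finR by simp
    also have "\<dots> = n" using bij_betw_same_card[OF R(2)] cardX by simp
    finally show ?thesis unfolding mf .
  qed
  have adm: "admissible T n l"
    unfolding admissible_def
  proof (intro conjI dp suml)
    have xX: "x \<in> X" if "x \<in> set xs" for x using that xs R by auto
    show "\<forall>(b, c) \<in> set l. gcd (int b) c = 1" using gc xX by (auto simp: l_def key_def)
    have "T = TypeC \<Longrightarrow> \<not> is_A" unfolding is_A_def by simp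
    then show "T = TypeC \<longrightarrow> (\<forall>(b, c) \<in> set l. c \<ge> 0)" using c0 xX by (auto simp: l_def key_def)
  qed
  have b1: "\<forall>(b, c) \<in> set l. b \<ge> 1" using dp by (simp add: double_partition_def)
  \<comment> \<open>Partial sums of the translation part along the cycle, with the total removed at
    the last position, where \<open>dist_elt\<close> carries it. The value there is zero, which
    closes the cycle.\<close>
  define val where "val x t = (\<Sum>m\<le>t. ?\<chi> ((?s ^^ m) x)) - (if Suc t = ?r x then of_int (c x) else 0)" for x t
  define mm where "mm = oext (\<lambda>k. blocks ?r val xs ! nat (k - 1))"
  define ren where "ren k = (if k \<in> J then oext (\<lambda>k. blocks ?r (\<lambda>x t. (?s ^^ t) x) xs ! nat (k - 1)) k else k)" for k
  have ren_odd: "ren (- k) = - ren k" for k by (simp add: ren_def oext_odd)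
  have mm_odd: "mm (- k) = - mm k" for k by (simp add: mm_def oext_odd)
  have blk: "ren (block_end l j + 1 + int t) = (?s ^^ t) (xs ! j)" "mm (block_end l j + 1 + int t) = val (xs ! j) t"
    "1 \<le> block_end l j + 1 + int t" "block_end l j + 1 + int t \<le> int n"
    if jt: "j < length l" "t < fst (l ! j)" for j t
  proof -
    show le: "1 \<le> block_end l j + 1 + int t" "block_end l j + 1 + int t \<le> int n"
      using block_end_ge[of l j] block_end_le[of l "Suc j"] block_end_Suc[OF jt(1)] jt(2) suml by auto
    have i: "nat (block_end l j + 1 + int t - 1) = sum_list (take j (map ?r xs)) + t"
      by (simp add: block_end_def nat_int_add mf flip: take_map)
    have jt': "j < length xs" "t < ?r (xs ! j)" using jt len nthl by auto
    have inJ: "block_end l j + 1 + int t \<in> J" using le by (auto simp: J_def)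
    show "ren (block_end l j + 1 + int t) = (?s ^^ t) (xs ! j)"
      unfolding ren_def if_P[OF inJ] oext_pos[OF le] i by (rule blocks_nth[of j xs t ?r, OF jt'])
    show "mm (block_end l j + 1 + int t) = val (xs ! j) t"
      unfolding mm_def oext_pos[OF le] i by (rule blocks_nth[of j xs t ?r, OF jt'])
  qed
  have blk_ex: "\<exists>j t. j < length l \<and> t < fst (l ! j) \<and> k = block_end l j + 1 + int t" if "1 \<le> k" "k \<le> int n" for k
    using block_ex[of k l] suml that by metis
  have ren_X: "ren k \<in> X" if k: "1 \<le> k" "k \<le> int n" for k
  proof -
    obtain j t where jt: "j < length l" "t < fst (l ! j)" "k = block_end l j + 1 + int t" using blk_ex[OF k] by blast
    have "(xs ! j, t) \<in> Sigma R (\<lambda>x. {..<?r x})" using jt nthl len xs nth_mem[of j xs] by auto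
    then have "(?s ^^ t) (xs ! j) \<in> X" using bij_betw_apply[OF R(2)] by fastforce
    then show ?thesis using blk(1)[OF jt(1,2)] jt(3) by simp
  qed
  have ren_inj: "k = k'" if k: "1 \<le> k" "k \<le> int n" "1 \<le> k'" "k' \<le> int n" and e: "ren k = ren k'" for k k'
  proof -
    obtain j t where jt: "j < length l" "t < fst (l ! j)" "k = block_end l j + 1 + int t" using blk_ex k by blast
    obtain j' t' where jt': "j' < length l" "t' < fst (l ! j')" "k' = block_end l j' + 1 + int t'" using blk_ex k by blast
    have m: "(xs ! j, t) \<in> Sigma R (\<lambda>x. {..<?r x})" "(xs ! j', t') \<in> Sigma R (\<lambda>x. {..<?r x})"
      using jt jt' nthl len xs nth_mem[of j xs] nth_mem[of j' xs] by auto
    have "(?s ^^ t) (xs ! j) = (?s ^^ t') (xs ! j')" using e blk(1)[OF jt(1,2)] blk(1)[OF jt'(1,2)] jt(3) jt'(3) by simp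
    then have "(xs ! j, t) = (xs ! j', t')"
      using inj_onD[OF bij_betw_imp_inj_on[OF R(2)] _ m] by simp
    then have "j = j'" "t = t'" using nth_eq_iff_index_eq[OF xs(2)] jt(1) jt'(1) len by auto
    then show ?thesis using jt(3) jt'(3) by simp
  qed
  have Jc: "(1 \<le> k \<and> k \<le> int n) \<or> (1 \<le> - k \<and> - k \<le> int n)" if "k \<in> J" for k
    using J_cases[OF that] by auto
  have negX: "ren k \<in> uminus ` X" if "1 \<le> - k" "- k \<le> int n" for k
    using ren_X[OF that] ren_odd[of k] by (metis image_eqI minus_minus)
  have ne: "ren k \<noteq> ren k'" if "1 \<le> k" "k \<le> int n" "1 \<le> - k'" "- k' \<le> int n" for k k'
    using ren_X[OF that(1,2)] negX[OF that(3,4)] X1(1) by (metis IntI empty_iff)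
  have ren_w: "ren \<in> weyl T n"
  proof -
    have inj: "inj_on ren J"
    proof (rule inj_onI)
      fix k k' assume kJ: "k \<in> J" "k' \<in> J" and e: "ren k = ren k'"
      consider "1 \<le> k" "k \<le> int n" "1 \<le> k'" "k' \<le> int n" | "1 \<le> - k" "- k \<le> int n" "1 \<le> - k'" "- k' \<le> int n"
        | "1 \<le> k" "k \<le> int n" "1 \<le> - k'" "- k' \<le> int n" | "1 \<le> - k" "- k \<le> int n" "1 \<le> k'" "k' \<le> int n"
        using Jc[OF kJ(1)] Jc[OF kJ(2)] by blast
      then show "k = k'"
      proof cases
        case 1 then show ?thesis using ren_inj e by blast
      next
        case 2
        have "ren (- k) = ren (- k')" using e ren_odd by simp
        then show ?thesis using ren_inj[OF 2] by simp
      next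
        case 3 then show ?thesis using ne e by blast
      next
        case 4 then show ?thesis using ne[OF 4(3,4,1,2)] e by simp
      qed
    qed
    have "ren ` J \<subseteq> J"
    proof
      fix y assume "y \<in> ren ` J"
      then obtain k where k: "k \<in> J" "y = ren k" by blast
      then have "y \<in> X \<or> y \<in> uminus ` X" using Jc ren_X negX by blast
      then show "y \<in> J" using X1(2) by blast
    qed
    then have "ren ` J = J" using endo_inj_surj[OF finite_J _ inj] by blast
    then have "ren permutes J" using inj by (intro bij_imp_permutes) (auto simp: bij_betw_def ren_def)
    moreover have "ren k > 0" if "is_A" "k > 0" for k
    proof (cases "k \<in> J")
      case True
      then have "ren k \<in> X" using Jc[OF True] that ren_X by auto
      then show ?thesis using X3 that by force
    qed (use that in \<open>simp add: ren_def\<close>)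
    ultimately show ?thesis unfolding weyl_iff using ren_odd by blast
  qed
  have val_int: "val x t \<in> \<int>" for x t
    unfolding val_def using fi by (intro Ints_diff Ints_sum) auto
  have mm_int: "mm k \<in> \<int>" for k
  proof -
    have pos: "mm k \<in> \<int>" if k: "1 \<le> k" "k \<le> int n" for k
      using blk_ex[OF k] blk(2) val_int by metis
    show ?thesis
    proof (cases "k \<in> J")
      case True
      then show ?thesis using Jc[OF True] pos[of k] pos[of "- k"] mm_odd[of k] by auto
    qed (simp add: mm_def oext_notin)
  qed
  have mm_lat: "mm \<in> trans_lattice T n"
    unfolding trans_lattice_iff vecs_iff using mm_odd mm_int by (auto simp: mm_def oext_notin)
  define g where "g = (act ren mm, ren)"
  have gc': "g \<in> carrier G" using ren_w mm_lat trans_lattice_act by (auto simp: g_def carrier_G)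
  let ?d = "dist_elt l"
  have key_eq: "ren (snd ?d k) = ?s (ren k)" "mm (snd ?d k) + fst ?d (snd ?d k) = ?\<chi> (?s (ren k)) + mm k"
    if k: "1 \<le> k" "k \<le> int n" for k
  proof -
    obtain j t where jt: "j < length l" "t < fst (l ! j)" "k = block_end l j + 1 + int t"
      "snd ?d k = (if Suc t < fst (l ! j) then block_end l j + 1 + int (Suc t) else block_end l j + 1)"
      using dist_perm_range[OF suml k] by metis
    define x where "x = xs ! j"
    have lj: "l ! j = (?r x, c x)" using nthl jt(1) len by (simp add: x_def)
    have xX: "x \<in> X" using R(1) xs nth_mem[of j xs] jt(1) len by (auto simp: x_def)
    have pk: "ren k = (?s ^^ t) x" and mk: "mm k = val x t" using blk(1,2)[OF jt(1,2)] jt(3) by (auto simp: x_def)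
    have "ren (snd ?d k) = ?s (ren k) \<and> mm (snd ?d k) + fst ?d (snd ?d k) = ?\<chi> (?s (ren k)) + mm k"
    proof (cases "Suc t < ?r x")
      case True
      have k': "snd ?d k = block_end l j + 1 + int (Suc t)" using True jt(4) lj by simp
      have lt: "Suc t < fst (l ! j)" using True lj by simp
      have 1: "ren (snd ?d k) = (?s ^^ Suc t) x" "mm (snd ?d k) = val x (Suc t)"
        using blk(1,2)[OF jt(1) lt] k' by (auto simp: x_def)
      have 2: "fst ?d (snd ?d k) = (if Suc (Suc t) = ?r x then of_int (c x) else 0)"
        using dist_vec_block[OF b1 jt(1) lt] k' lj by simp
      show ?thesis unfolding 1 2 pk mk val_def using True by (simp add: algebra_simps)
    next
      case False
      then have t: "Suc t = ?r x" using jt(2) lj by simp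
      have k': "snd ?d k = block_end l j + 1 + int 0" using False jt(4) lj by simp
      have lt: "0 < fst (l ! j)" using jt(2) by simp
      have 1: "ren (snd ?d k) = x" "mm (snd ?d k) = val x 0"
        using blk(1,2)[OF jt(1) lt] k' by (auto simp: x_def)
      have 2: "fst ?d (snd ?d k) = (if Suc 0 = ?r x then of_int (c x) else 0)"
        using dist_vec_block[OF b1 jt(1) lt] k' lj by simp
      have 3: "?s ((?s ^^ t) x) = x" using pp(2)[of x] t by (metis comp_apply funpow.simps(2))
      have "val x t = 0" using c[OF xX] t unfolding val_def by (simp flip: lessThan_Suc_atMost)
      then show ?thesis unfolding 1 2 pk mk 3 by (simp add: val_def)
    qed
    then show "ren (snd ?d k) = ?s (ren k)" "mm (snd ?d k) + fst ?d (snd ?d k) = ?\<chi> (?s (ren k)) + mm k" by auto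
  qed
  \<comment> \<open>That \<open>dist_elt l\<close> lies in the group follows from its equality with
    this conjugate.\<close>
  define d' where "d' = ginv g \<cdot> w \<cdot> g"
  have d'c: "d' \<in> carrier G" using gc' w by (simp add: d'_def)
  have gd: "g \<cdot> d' = w \<cdot> g"
    unfolding d'_def using gc' w by (simp flip: G.m_assoc)
  have sgd: "ren (snd d' k) = ?s (ren k)" for k
    using fun_cong[OF arg_cong[OF gd, of snd], of k] by (simp add: mult_G g_def)
  have s_eq: "snd d' = snd ?d"
  proof (rule odd_eqI)
    fix k assume k: "1 \<le> k" "k \<le> int n"
    then have "ren (snd d' k) = ren (snd ?d k)" using sgd key_eq(1) by simp
    then show "snd d' k = snd ?d k" using weyl_bij[OF ren_w] bij_is_inj inj_eq by metis
  next
    fix k assume "k \<notin> J" then show "snd d' k = snd ?d k"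
      using weyl_notin[OF carrier_snd[OF d'c]] dist_perm_notin[OF suml] by simp
  qed (use weyl_odd[OF carrier_snd[OF d'c]] dist_perm_odd in auto)
  have dw: "snd ?d \<in> weyl T n" using carrier_snd[OF d'c] s_eq by simp
  have f_eq: "fst d' = fst ?d"
  proof (rule odd_eqI)
    fix z assume z: "1 \<le> z" "z \<le> int n"
    then obtain k where k: "1 \<le> k" "k \<le> int n" "z = snd ?d k" using dist_perm_surj[OF suml dw] by metis
    let ?y = "ren z"
    have y: "?y = ?s (ren k)" using key_eq(1) k by simp
    have "act ren mm ?y + act ren (fst d') ?y = ?\<chi> ?y + act ?s (act ren mm) ?y"
      using fun_cong[OF arg_cong[OF gd, of fst], of ?y] by (simp add: mult_G g_def)
    moreover have "act ren mm ?y = mm z" "act ren (fst d') ?y = fst d' z" using ren_w by (simp_all add: act_def)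
    moreover have "act ?s (act ren mm) ?y = mm k" using ren_w s unfolding y by (simp add: act_def)
    ultimately have "mm z + fst d' z = ?\<chi> (?s (ren k)) + mm k" using y by simp
    then show "fst d' z = fst ?d z" using key_eq(2)[OF k(1,2)] k(3) by simp
  next
    fix k assume k: "k \<notin> J"
    have "fst ?d k = 0"
      unfolding dist_vec_apply
    proof (rule sum.neutral, intro ballI)
      fix j assume j: "j \<in> {..<length l}"
      then have lj: "l ! j = (?r (xs ! j), c (xs ! j))" using nthl len by simp
      have "block_end l (Suc j) \<ge> 1" using j block_end_Suc[of j l] block_end_ge[of l j] lj pp(1)[of "xs ! j"] by auto
      moreover have "block_end l (Suc j) \<le> int n" using block_end_le[of l "Suc j"] suml by simp
      ultimately have "block_end l (Suc j) \<in> J" by (auto simp: J_def)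
      then show "of_int (snd (l ! j)) * unit_vec (block_end l (Suc j)) k = 0"
        using k uminus_J[of k] by (auto simp: unit_vec_def)
    qed
    then show "fst d' k = fst ?d k" using trans_lattice_notin[OF carrier_fst[OF d'c] k] by simp
  qed (use trans_lattice_odd[OF carrier_fst[OF d'c]] dist_vec_odd[OF b1] in auto)
  have dd: "d' = ?d" using s_eq f_eq by (simp add: prod_eq_iff)
  have "w = g \<cdot> d' \<cdot> ginv g" unfolding gd using w gc' by (simp add: G.m_assoc)
  then show ?thesis using adm gc' d'c dd by metis
qed

section \<open>Good elements are conjugate to distinguished elements\<close>

text \<open>A splitting root would yield an element of the same fiber shorter than \<open>w\<close>,
  below the norm that the length of \<open>w\<close> attains.\<close>

lemma good_unsplit_conj:
  assumes w: "w \<in> carrier G" and g: "good T n w"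
  obtains h p v where "h \<in> Wa" "p \<in> alcove"
    "ap (h \<cdot> w \<cdot> ginv h) p = p + v" "lp (h \<cdot> w \<cdot> ginv h) v = v"
    "\<not> splits_at (h \<cdot> w \<cdot> ginv h) p v"
proof -
  obtain w' p v where c: "cstep\<^sup>*\<^sup>* w w'" and p: "p \<in> alcove" and tr: "ap w' p = p + v" "lp w' v = v"
    using csteps_to_translated_point[OF w] by blast
  obtain h where h: "h \<in> Wa" "w' = h \<cdot> w \<cdot> ginv h" using csteps_conj[OF c w] by blast
  have w'c: "w' \<in> carrier G" using csteps_carrier[OF c w] .
  have f: "f_map T n w' = f_map T n w" using f_map_conj[OF w] h by simp
  have "\<not> splits_at w' p v"
  proof
    assume "splits_at w' p v"
    then obtain y where y: "len y < len w'" "y \<in> carrier G" "f_map T n y = f_map T n w'"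
      using split_smaller[OF w'c chamD(1)[OF p] tr] by blast
    have "rho_norm (newton_vec T n y) = rho_norm (newton_vec T n w)" using f_map_rho_norm[OF y(2) w] y(3) f by simp
    also have "\<dots> = of_nat (len w)" using good_iff[OF w] g by simp
    finally have "len w \<le> len y" using rho_norm_le_len[OF y(2)] by simp
    then show False using y(1) csteps_len[OF c] by simp
  qed
  then show thesis using that[of h p v] h p tr by simp
qed

section \<open>Cycles of an unsplit element\<close>

lemma sum_period_shift:
  fixes h :: "nat \<Rightarrow> 'a::ab_group_add"
  assumes "h M = h 0" shows "(\<Sum>m<M. h (Suc m)) = (\<Sum>m<M. h m)"
  using sum.lessThan_Suc_shift[of h M] sum.lessThan_Suc[of h M] assms by simp

text \<open>If the affine root of \<open>i\<close> and another index of its cycle vanished at \<open>p\<close>, the roots in its orbit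
  under \<open>w\<close> would sum to zero while having the same sign at \<open>a0\<close>.\<close>

lemma unsplit_cycle:
  assumes w: "w \<in> carrier G" and fi: "\<And>i. fst w i \<in> \<int>" and p: "odd_fun p"
    and tr: "ap w p = p + v" "lp w v = v" and ns: "\<not> splits_at w p v"
    and i: "i \<in> I" and bv: "of_nat b * v i \<in> \<int>"
  shows "(snd w ^^ b) i = i"
proof (rule ccontr)
  let ?s = "snd w"
  have s: "?s \<in> weyl T n" using w by simp
  let ?j = "(?s ^^ b) i"
  assume ne: "?j \<noteq> i"
  have it: "(?s ^^ m) y \<in> I \<longleftrightarrow> y \<in> I" for m y using s by (induction m) auto
  have j: "?j \<in> I" using it i by blast
  have vs: "v (?s y) = v y" for y using fun_cong[OF tr(2), of "?s y"] s by (simp add: lp_def)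
  have vit: "v ((?s ^^ m) y) = v y" for m y by (induction m) (simp_all add: vs)
  have ps: "p (?s y) = of_rat (fst w (?s y)) + p y - v y" for y
    using fun_cong[OF tr(1), of "?s y"] s vs[of y] by (simp add: ap_def)
  have fi': "real_of_rat (fst w y) \<in> \<int>" for y
    using fi[of y] by (auto elim!: Ints_cases)
  have pit: "p ((?s ^^ m) i) - p i + of_nat m * v i \<in> \<int>" for m
  proof (induction m)
    case (Suc m)
    have "p ((?s ^^ Suc m) i) - p i + of_nat (Suc m) * v i
      = of_rat (fst w (?s ((?s ^^ m) i))) + (p ((?s ^^ m) i) - p i + of_nat m * v i)"
      using ps[of "(?s ^^ m) i"] vit[of m i] by (simp add: algebra_simps)
    then show ?case using Suc fi' by (metis Ints_add)
  qed simp
  \<comment> \<open>Along the cycle \<open>p\<close> drops by \<open>v i\<close> per step modulo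
    integers. Since \<open>b\<close> times \<open>v i\<close> is integral, the coordinates at both
    indices are congruent, and an affine root in these two indices vanishes at
    \<open>p\<close>.\<close>
  have "p i - p ?j \<in> \<int>" using Ints_diff[OF bv pit[of b]] by simp
  then obtain K where K: "p i - p ?j = of_int K" by (auto elim: Ints_cases)
  let ?b = "aroot i ?j K"
  have bAR: "?b \<in> AR" using aroot_AR i j ne by metis
  have bp: "?b p = 0" using K p by (simp add: aroot_odd)
  have vo: "odd_fun v"
  proof -
    have "v = ap w p - p" using tr(1) by simp
    then show ?thesis using odd_ap[OF p w] p by (simp add: odd_fun_def)
  qed
  have bv0: "lin ?b v = 0"
    using AR_add[OF bAR, of "\<lambda>_. 0" v] vo vit[of b i] unfolding lin_def by (simp add: aroot_def odd_fun_def)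
  obtain M where M: "M \<ge> 1" "?s ^^ M = id" using permutes_power_id[OF finite_J weyl_permutes[OF s]] by blast
  let ?w = "\<lambda>k. w [^]\<^bsub>G\<^esub> (k::nat)"
  have wc: "?w k \<in> carrier G" for k using w by simp
  \<comment> \<open>The root vanishes at every \<open>w^k p\<close>, so its values at
    \<open>w^k a0\<close> come from the linear parts applied to this difference.\<close>
  define d where "d = a0 - p"
  have dod: "odd_fun d" using a0_odd p unfolding d_def odd_fun_def by simp
  have bk: "?b (ap (?w k) a0) = lp (?w k) d i - lp (?w k) d ?j" for k
  proof -
    have z: "?b (ap (?w k) p) = 0" using ap_AR_pow[OF w tr bAR, of k] bp bv0 by simp
    have o: "odd_fun (ap (?w k) a0)" "odd_fun (ap (?w k) p)" using wc p by auto
    have "lp (?w k) d l = ap (?w k) a0 l - ap (?w k) p l" for l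
      unfolding d_def by (simp flip: ap_diff)
    then show ?thesis using z o by (simp add: aroot_odd)
  qed
  \<comment> \<open>Averaging over a full period of the linear part makes the coordinates constant
    along cycles, so the root, which compares two indices of one cycle, sums to zero.\<close>
  define S where "S y = (\<Sum>k<M. lp (?w k) d y)" for y
  have Ss: "S (?s y) = S y" for y
  proof -
    have 1: "lp (?w (Suc k)) d (?s y) = lp (?w k) d y" for k
      using lp_mult[OF w wc[of k]] s by (metis G.nat_pow_Suc2 lp_def weyl_inv_f w)
    have "snd (?w M) = id" using snd_pow M by simp
    then have "lp (?w M) d = lp (?w 0) d" unfolding lp_def by (simp add: one_G)
    then have "S (?s y) = (\<Sum>k<M. lp (?w (Suc k)) d (?s y))"
      unfolding S_def using sum_period_shift[of "\<lambda>k. lp (?w k) d (?s y)" M] by simp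
    then show ?thesis using 1 by (simp only: S_def)
  qed
  have "S ((?s ^^ m) i) = S i" for m by (induction m) (simp_all add: Ss)
  then have sum0: "(\<Sum>k<M. ?b (ap (?w k) a0)) = 0" unfolding bk by (simp add: sum_subtractf S_def)
  have sg: "?b (ap (?w k) a0) > 0 \<longleftrightarrow> ?b a0 > 0" for k using not_split_sign[OF w tr ns bAR bp bv0] .
  have nz: "?b (ap (?w k) a0) \<noteq> 0" for k using AR_apa0_nz[OF bAR wc] .
  have M0: "{..<M} \<noteq> {}" using M(1) by (auto simp: lessThan_empty_iff bot_nat_def)
  show False
  proof (cases "?b a0 > 0")
    case True
    then have "(\<Sum>k<M. ?b (ap (?w k) a0)) > 0" using sg M0 by (intro sum_pos) auto
    then show False using sum0 by simp
  next
    case False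
    then have "- ?b (ap (?w k) a0) > 0" for k using sg[of k] nz[of k] by linarith
    then have "(\<Sum>k<M. - ?b (ap (?w k) a0)) > 0" using M0 by (intro sum_pos) auto
    then show False using sum0 by (simp add: sum_negf)
  qed
qed

text \<open>Summing the translation condition around a cycle gives \<open>r v = c\<close> for its
  length \<open>r\<close> and total translation \<open>c\<close>. With this,
  \<open>unsplit_cycle\<close> becomes coprimality of \<open>r\<close> and \<open>c\<close>.\<close>

lemma unsplit_dist:
  assumes w: "w \<in> carrier G" and fi: "\<And>i. fst w i \<in> \<int>" and p: "odd_fun p"
    and tr: "ap w p = p + v" "lp w v = v" and ns: "\<not> splits_at w p v"
  shows "\<exists>l g. admissible T n l \<and> g \<in> carrier G \<and> dist_elt l \<in> carrier G \<and> w = g \<cdot> dist_elt l \<cdot> ginv g"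
proof -
  let ?s = "snd w"
  let ?r = "period ?s"
  have s: "?s \<in> weyl T n" using w by simp
  have vs: "v (?s y) = v y" for y using fun_cong[OF tr(2), of "?s y"] s by (simp add: lp_def)
  have vit: "v ((?s ^^ m) y) = v y" for m y by (induction m) (simp_all add: vs)
  have ps: "p (?s y) = of_rat (fst w (?s y)) + p y - v y" for y
    using fun_cong[OF tr(1), of "?s y"] s vs[of y] by (simp add: ap_def)
  have vo: "v (- y) = - v y" for y
  proof -
    have "v = ap w p - p" using tr(1) by simp
    then show ?thesis using odd_ap[OF p w] p by (simp add: odd_fun_def)
  qed
  have per: "\<exists>m\<ge>1. (?s ^^ m) x = x" for x
    using permutes_power_id[OF finite_J weyl_permutes[OF s]] by (metis id_apply)
  have pp: "?r x \<ge> 1" "(?s ^^ ?r x) x = x" for x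
  proof -
    obtain m where "m \<ge> 1" "(?s ^^ m) x = x" using per[of x] by blast
    from period_props[OF this] show "?r x \<ge> 1" "(?s ^^ ?r x) x = x" by auto
  qed
  have cyc: "?r i \<le> b" if "i \<in> I" "of_nat b * v i \<in> \<int>" "b \<ge> 1" for i b
    by (rule period_props(3)[OF that(3) unsplit_cycle[OF w fi p tr ns that(1,2)]])
  \<comment> \<open>In type C the sign of an index is chosen so that its slope is positive. Where
    the slope is zero, \<open>unsplit_cycle\<close> with \<open>b = 1\<close> makes the index a
    fixed point; this excludes negative cycles and keeps \<open>X\<close> stable.\<close>
  define X where "X = {i \<in> J. if is_A then i > 0 else v i > 0 \<or> (v i = 0 \<and> i > 0)}"
  have nz: "i \<noteq> 0" if "i \<in> J" for i using that by auto
  have X1: "X \<inter> uminus ` X = {}" unfolding X_def using vo by (auto split: if_splits)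
  have X2: "X \<union> uminus ` X = J"
  proof (intro equalityI subsetI)
    fix i assume i: "i \<in> J"
    show "i \<in> X \<union> uminus ` X"
    proof (cases "i \<in> X")
      case False
      then have "- i \<in> X" using i nz[OF i] vo[of i] unfolding X_def by (auto split: if_splits)
      then show ?thesis by (metis UnI2 image_eqI minus_minus)
    qed simp
  qed (auto simp: X_def)
  have XI: "i \<in> I" if "i \<in> X" for i using that by (auto simp: X_def I_def split: if_splits)
  have Xs: "?s i \<in> X" if iX: "i \<in> X" for i
  proof (cases is_A)
    case True
    have "X = I" unfolding X_def I_def using True by simp
    then show ?thesis using iX s by simp
  next
    case False
    have iI: "i \<in> I" using XI iX by blast
    show ?thesis
    proof (cases "v i = 0")
      case True
      have "of_nat 1 * v i \<in> \<int>" unfolding True by simp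
      from unsplit_cycle[OF w fi p tr ns iI this] have "?s i = i" by simp
      then show ?thesis using iX by simp
    next
      case vn: False
      then have "v i > 0" "i \<in> J" using iX False by (auto simp: X_def)
      then show ?thesis using False vs s by (simp add: X_def)
    qed
  qed
  define c where "c i = \<lfloor>\<Sum>m<?r i. fst w ((?s ^^ m) i)\<rfloor>" for i
  have c: "(\<Sum>m<?r i. fst w ((?s ^^ m) i)) = of_int (c i)" for i
  proof -
    have "(\<Sum>m<?r i. fst w ((?s ^^ m) i)) \<in> \<int>" using fi by (intro Ints_sum) auto
    then show ?thesis by (auto simp: c_def elim: Ints_cases)
  qed
  have slope: "of_nat (?r i) * v i = of_int (c i)" for i
  proof -
    have "p ((?s ^^ m) i) = (\<Sum>k<m. of_rat (fst w ((?s ^^ Suc k) i))) + p i - of_nat m * v i" for m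
    proof (induction m)
      case (Suc m)
      then show ?case using ps[of "(?s ^^ m) i"] vit[of m i] by (simp add: algebra_simps)
    qed simp
    from this[of "?r i"] have "of_nat (?r i) * v i = (\<Sum>k<?r i. real_of_rat (fst w ((?s ^^ Suc k) i)))"
      using pp(2)[of i] by simp
    also have "\<dots> = (\<Sum>k<?r i. real_of_rat (fst w ((?s ^^ k) i)))"
      by (rule sum_period_shift[of "\<lambda>k. real_of_rat (fst w ((?s ^^ k) i))"]) (simp add: pp(2))
    also have "\<dots> = of_rat (of_int (c i))" unfolding c[symmetric] by (simp add: of_rat_sum)
    finally show ?thesis by simp
  qed
  \<comment> \<open>Dividing \<open>r\<close> by the gcd \<open>q\<close> keeps the multiple of the
    slope integral, so by \<open>cyc\<close> the length \<open>r\<close> is at most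
    \<open>r / q\<close>.\<close>
  have gc: "gcd (int (?r i)) (c i) = 1" if iX: "i \<in> X" for i
  proof -
    define q where "q = nat (gcd (int (?r i)) (c i))"
    have qi: "int q = gcd (int (?r i)) (c i)" by (simp add: q_def)
    have "q > 0" using qi pp(1)[of i] by (metis gcd_eq_0_iff gr0I int_ops(1) not_one_le_zero of_nat_eq_0_iff)
    have "int q dvd int (?r i)" "int q dvd c i" unfolding qi by auto
    then have "q dvd ?r i" "int q dvd c i" by simp_all
    then obtain b e where b: "?r i = q * b" and e: "c i = int q * e" by (elim dvdE)
    have b1: "b \<ge> 1" using b pp(1)[of i] by (cases b) auto
    have "real q * (of_nat b * v i) = real q * of_int e" using slope[of i] b e by (simp add: mult.assoc)
    then have "of_nat b * v i = of_int e" using \<open>q > 0\<close> by simp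
    then have "?r i \<le> b" using cyc[OF XI[OF iX] _ b1] by simp
    then have "q * b \<le> 1 * b" using b by simp
    then have "q \<le> 1" using b1 by simp
    then show ?thesis using \<open>q > 0\<close> qi by simp
  qed
  have c0: "c i \<ge> 0" if "i \<in> X" "\<not> is_A" for i
  proof -
    have "v i \<ge> 0" using that by (auto simp: X_def)
    then have "real_of_int (c i) \<ge> 0" unfolding slope[symmetric] by simp
    then show ?thesis by simp
  qed
  have X3: "is_A \<Longrightarrow> X \<subseteq> {1..int n}" by (auto simp: X_def J_def)
  show ?thesis by (rule dist_construct[OF w fi X1 X2 Xs X3 c gc c0])
qed

text \<open>The unsplit conjugate has the same coset of \<open>Wa\<close>, hence an integral
  translation part as well.\<close>

lemma good_distinguished:
  assumes w: "w \<in> carrier G" and fi: "fst w \<in> int_vecs n" and g: "good T n w"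
  shows "\<exists>l. admissible T n l \<and> dist_elt l \<in> carrier G \<and> w \<in> conj_class G (dist_elt l)"
proof -
  obtain h p v where h: "h \<in> Wa" and p: "p \<in> alcove"
    and tr: "ap (h \<cdot> w \<cdot> ginv h) p = p + v" "lp (h \<cdot> w \<cdot> ginv h) v = v"
    and ns: "\<not> splits_at (h \<cdot> w \<cdot> ginv h) p v"
    using good_unsplit_conj[OF w g] by blast
  let ?w = "h \<cdot> w \<cdot> ginv h"
  have hc: "h \<in> carrier G" using h by simp
  have wc: "?w \<in> carrier G" using hc w by simp
  have "fst ?w - fst w \<in> coroot_lattice T n" using coset_conj[OF w hc] coset_eq_iff[OF wc w] by simp
  then have d: "(fst ?w - fst w) i \<in> \<int>" "fst w i \<in> \<int>" for i
    using fi by (auto simp: coroot_lattice_iff int_vecs_def)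
  have "fst ?w i \<in> \<int>" for i using Ints_add[OF d[of i]] by simp
  then obtain l k where l: "admissible T n l" "k \<in> carrier G" "dist_elt l \<in> carrier G" "?w = k \<cdot> dist_elt l \<cdot> ginv k"
    using unsplit_dist[OF wc _ chamD(1)[OF p] tr ns] by blast
  let ?g = "ginv h \<cdot> k"
  have "w = ginv h \<cdot> ?w \<cdot> h"
  proof -
    have "ginv h \<cdot> (h \<cdot> z) = z" if "z \<in> carrier G" for z using that hc by (simp flip: G.m_assoc)
    then show ?thesis using hc w by (simp add: G.m_assoc)
  qed
  also have "\<dots> = ?g \<cdot> dist_elt l \<cdot> ginv ?g"
    unfolding l(4) using hc l(2,3) by (simp add: G.m_assoc G.inv_mult_group)
  finally have "w \<in> conj_class G (dist_elt l)" unfolding conj_class_def using hc l(2) by blast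
  then show ?thesis using l by blast
qed

text \<open>A shortest element of the fiber is good by \<open>not_good_smaller\<close>; it supplies
  the distinguished class, and its length is that of all good elements. The Bruhat order strictly
  raises lengths, and an element that is not good has a smaller one in its fiber, so Bruhat
  minimality agrees with goodness.\<close>

lemma fiber_equivalence:
  assumes a: "a \<in> f_map T n ` ext_aff_int T n" and w: "w \<in> f_fiber T n a"
  shows "(good T n w \<longleftrightarrow> min_length_in T n w (distinguished_class T n a)) \<and>
         (min_length_in T n w (distinguished_class T n a) \<longleftrightarrow> bruhat_minimal_in T n w (f_fiber T n a))"
proof -
  let ?F = "f_fiber T n a"
  have F: "x \<in> ?F \<longleftrightarrow> x \<in> carrier G \<and> f_map T n x = a" for x by (simp add: f_fiber_def)
  obtain z where z: "z \<in> carrier G" "fst z \<in> int_vecs n" "f_map T n z = a"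
    using a unfolding ext_aff_int_def by auto
  have int: "fst x \<in> int_vecs n" if "x \<in> ?F" for x
  proof -
    have x: "x \<in> carrier G" "f_map T n x = f_map T n z" using that F z by auto
    then have "fst x - fst z \<in> coroot_lattice T n" using f_map_eq_iff[OF x(1) z(1)] coset_eq_iff[OF x(1) z(1)] by blast
    then have d: "(fst x - fst z) i \<in> \<int>" "fst z i \<in> \<int>" for i using z(2) by (auto simp: coroot_lattice_iff int_vecs_def)
    have "fst x i \<in> \<int>" for i using Ints_add[OF d[of i]] by simp
    then show ?thesis using trans_lattice_vecs[OF carrier_fst[OF x(1)]] by (simp add: int_vecs_def)
  qed
  have Nc: "rho_norm (newton_vec T n x) = rho_norm (newton_vec T n y)" if "x \<in> ?F" "y \<in> ?F" for x y
    using f_map_rho_norm that F by metis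
  have conj_F: "conj_class G x \<subseteq> ?F" if x: "x \<in> ?F" for x
  proof
    fix y assume "y \<in> conj_class G x"
    then obtain g where g: "g \<in> carrier G" "y = g \<cdot> x \<cdot> ginv g" unfolding conj_class_def by blast
    have xc: "x \<in> carrier G" "f_map T n x = a" using x F by auto
    have "y \<in> carrier G" unfolding g(2) using g(1) xc(1) by simp
    moreover have "f_map T n y = a" unfolding g(2) using f_map_conj[OF xc(1) g(1)] xc(2) by simp
    ultimately show "y \<in> ?F" using F by blast
  qed
  have "\<exists>x. x \<in> ?F \<and> (\<forall>y. y \<in> ?F \<longrightarrow> len x \<le> len y)"
    using ex_has_least_nat[of "\<lambda>x. x \<in> ?F" w len] w by blast
  then obtain x0 where x0: "x0 \<in> ?F" "\<And>y. y \<in> ?F \<Longrightarrow> len x0 \<le> len y" by blast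
  have gx0: "good T n x0"
  proof (rule ccontr)
    assume "\<not> good T n x0"
    then obtain y where "len y < len x0" "y \<in> carrier G" "f_map T n y = f_map T n x0"
      using not_good_smaller x0(1) F by metis
    moreover from this have "y \<in> ?F" using F x0(1) by simp
    ultimately show False using x0(2) by fastforce
  qed
  have good_len: "good T n x \<longleftrightarrow> len x = len x0" if x: "x \<in> ?F" for x
  proof -
    have "(of_nat (len x0) :: rat) = rho_norm (newton_vec T n x0)" using good_iff gx0 x0(1) F by blast
    then have "(of_nat (len x0) :: rat) = rho_norm (newton_vec T n x)" using Nc[OF x x0(1)] by simp
    then show ?thesis using good_iff[of x] x F by (metis of_nat_eq_iff)
  qed
  obtain l where l: "admissible T n l" "dist_elt l \<in> carrier G" "x0 \<in> conj_class G (dist_elt l)"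
    using good_distinguished[OF _ int[OF x0(1)] gx0] x0(1) F by blast
  let ?C = "conj_class G (dist_elt l)"
  have fl: "f_map T n y = f_map T n (dist_elt l)" if "y \<in> ?C" for y
    using that f_map_conj[OF l(2)] unfolding conj_class_def by auto
  have dl: "dist_elt l \<in> ?F" using fl[OF l(3)] x0(1) F l(2) by simp
  have uniq: "l' = l" if "admissible T n l'" "dist_elt l' \<in> ?F" for l'
    using dist_elt_unique[OF that(1) _ l(1,2)] that(2) dl F by simp
  have dc: "distinguished_class T n a = ?C"
    unfolding distinguished_class_def
  proof (rule the_equality)
    show "distinguished T n ?C \<and> ?C \<subseteq> ?F" using l(1) conj_F[OF dl] unfolding distinguished_def by blast
  next
    fix C assume C: "distinguished T n C \<and> C \<subseteq> ?F"
    then obtain l' where l': "admissible T n l'" "C = conj_class G (dist_elt l')" unfolding distinguished_def by blast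
    \<comment> \<open>Membership of \<open>dist_elt l'\<close> in the group is not yet known, so
      conjugation by the unit is computed from the product formula.\<close>
    have "dist_elt l' = \<one>\<^bsub>G\<^esub> \<cdot> dist_elt l' \<cdot> ginv \<one>\<^bsub>G\<^esub>" 
      by (simp only: G.inv_one) (simp add: one_G mult_G prod_eq_iff)
    then have "dist_elt l' \<in> C" unfolding l'(2) conj_class_def using G.one_closed by blast
    then show "C = ?C" using uniq l' C by blast
  qed
  have wc: "w \<in> carrier G" using w F by blast
  have min_iff: "min_length_in T n w ?C \<longleftrightarrow> w \<in> ?C \<and> len w = len x0"
  proof
    assume m: "min_length_in T n w ?C"
    then have "aff_length T n w \<le> aff_length T n x0" using l(3) by (simp add: min_length_in_def)
    then have "len w \<le> len x0" using wc x0(1) F by (simp add: aff_length_len)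
    then show "w \<in> ?C \<and> len w = len x0" using m x0(2)[OF w] by (simp add: min_length_in_def)
  next
    assume m: "w \<in> ?C \<and> len w = len x0"
    have "aff_length T n w \<le> aff_length T n y" if "y \<in> ?C" for y
    proof -
      have "y \<in> ?F" using conj_F[OF dl] that by blast
      then show ?thesis using x0(2)[of y] m wc F by (simp add: aff_length_len)
    qed
    then show "min_length_in T n w ?C" using m by (simp add: min_length_in_def)
  qed
  \<comment> \<open>The distinguished element conjugate to \<open>w\<close> lies in the same fiber,
    so uniqueness places \<open>w\<close> in this class.\<close>
  have goodC: "w \<in> ?C" if "good T n w"
  proof -
    obtain l' where l': "admissible T n l'" "dist_elt l' \<in> carrier G" "w \<in> conj_class G (dist_elt l')"
      using good_distinguished[OF wc int[OF w] \<open>good T n w\<close>] by blast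
    have "f_map T n w = f_map T n (dist_elt l')" using l'(3) f_map_conj[OF l'(2)] unfolding conj_class_def by auto
    then have "dist_elt l' \<in> ?F" using w F l'(2) by simp
    then show ?thesis using uniq l' by metis
  qed
  have 12: "good T n w \<longleftrightarrow> min_length_in T n w ?C"
    using min_iff good_len[OF w] goodC by blast
  have "bruhat_minimal_in T n w ?F" if g: "good T n w"
    unfolding bruhat_minimal_in_def
  proof (intro conjI ballI impI w)
    fix y assume y: "y \<in> ?F" "bruhat_le T n y w"
    then show "y = w" using bruhat_le_len[OF y(2)] x0(2)[OF y(1)] good_len[OF w] g by auto
  qed
  moreover have "good T n w" if m: "bruhat_minimal_in T n w ?F"
  proof (rule ccontr)
    assume "\<not> good T n w"
    then obtain y where y: "ble y w" "len y < len w" "y \<in> carrier G" "f_map T n y = f_map T n w"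
      using not_good_smaller[OF wc] by blast
    then have "y \<in> ?F" "bruhat_le T n y w" using w F ble_bruhat_le by auto
    then have "y = w" using m by (simp add: bruhat_minimal_in_def)
    then show False using y(2) by simp
  qed
  ultimately show ?thesis unfolding dc using 12 by blast
qed

end

theorem corollary8p6:
  fixes T :: cartan_type and n :: nat
    and a :: "vec set \<times> aff set" and w :: aff
  assumes "n \<ge> 1"
    and "a \<in> f_map T n ` ext_aff_int T n"
    and "w \<in> f_fiber T n a"
  shows "(good T n w \<longleftrightarrow> min_length_in T n w (distinguished_class T n a)) \<and>
         (min_length_in T n w (distinguished_class T n a) \<longleftrightarrow> bruhat_minimal_in T n w (f_fiber T n a))"
proof -
  interpret affine_weyl T n by standard (rule assms(1))
  show ?thesis by (rule fiber_equivalence[OF assms(2,3)])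
qed

end
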